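(* Let $\Gamma$ be the group associated with a triangle presentation and $\Delta$ the associated triangle building with boundary $\Omega$. Let $\Pi\subseteq\Omega$ be the set of periodic limit points and $\Lambda\subseteq\Omega$ the set of rigidly periodic limit points. Then $\Lambda$ and $\Pi$ are dense $\Gamma$-invariant subsets of $\Omega$.
   Context: **Triangle groups.** Let $(P,L)$ be a finite projective plane of order $q\ge 2$ and $\lambda:P\to L$ a bijection. A triangle presentation is a set $\mathcal{T}\subseteq P^3$ such that: (1) for all $x,y\in P$, $(x,y,z)\in\mathcal T$ for some $z\in P$ if and only if $y$ and $\lambda(x)$ are incident; (2) $(x,y,z)\in\mathcal T\Rightarrow (y,z,x)\in\mathcal T$; (3) for all $x,y\in P$, $(x,y,z)\in\mathcal T$ for at most one $z\in P$. Put $\Gamma=\langle a_x\ (x\in P) : a_xa_ya_z=e \text{ for all }(x,y,z)\in\mathcal T\rangle$, with identity $e$. The Cayley graph of $\Gamma$ (via right multiplication by the $a_x^{\pm1}$) is the one-skeleton of a thick affine building $\Delta=\Delta_{\mathcal T}$ of type $\tilde A_2$ (a triangle building): the vertices are the elements of $\Gamma$, and the chambers (triangles) are the sets $\{g,ga_x^{-1},ga_y\}$ with $(x,y,z)\in\mathcal T$ for some $z$. $\Gamma$ acts simply transitively on the vertices by left multiplication. Edges are oriented as $g\to ga_x$. **Boundary.** An apartment is a subcomplex isomorphic to the Coxeter complex of type $\tilde A_2$ (a Euclidean plane tessellated by equilateral triangles). A sector is one of the six simplicial cones based at a vertex of an apartment. Two sectors are equivalent if they contain a common subsector. $\Omega$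 is the set of equivalence classes of sectors; a sector in the class $\omega$ is called a representative of $\omega$, and for each vertex $v$ there is a unique representative $\mathcal S_v(\omega)$ based at $v$. For $u\in \mathcal S_v(\omega)$ let $I_v^u(\omega)$ be the convex hull of $u$ and the chamber of $\mathcal S_v(\omega)$ containing $v$. The sets $U_v^u(\omega)=\{\omega' : I_v^u(\omega)\subseteq \mathcal S_v(\omega')\}$ form a base for a totally disconnected compact Hausdorff topology on $\Omega$. $\Gamma$ acts on $\Omega$ by left multiplication of sectors. **Periodic sectors.** For a sector $\mathcal S$ based at $v$, one of its two bounding rays has all edges oriented away from $v$ and the other all edges oriented towards $v$; let $a_{i,j}\in\Gamma$ ($i,j\ge0$) be the vertex reached from $v=a_{0,0}$ by $i$ unit steps parallel to the first and $j$ unit steps parallel to the second. $\mathcal S$ is $(r,s)$-periodic, $(r,s)\in\mathbb Z^2$, if $a_{i,j}^{-1}a_{k,l}=a_{i+r,j+s}^{-1}a_{k+r,l+s}$ whenever all the indices $i,j,k,l,i+r,j+s,k+r,l+s$ are $\geq0$; it is periodic if it is $(r,s)$-periodic for some $(r,s)\ne(0,0)$. It is rigidly periodic if it is doubly periodic (it is $(r,s)$-periodic and $(t,u)$-periodic for two linearly independent vectors $(r,s),(t,u)$) or it is $(r,s)$-periodic for some $r,s\neq0$ with $s\ne -r$. $\Pi$ (periodic limit points) is the set of $\omega\in\Omega$ having a periodic representative sector; $\Lambda$ (rigidly periodic limit points) is the set of $\omega\in\Omega$ having a rigidly periodic representative sector. *)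

theory Defs
  imports "HOL-Algebra.Group" "HOL-Analysis.Abstract_Topology"
begin

section \<open>Projective planes and triangle presentations\<close>

definition projective_plane :: "'p set \<Rightarrow> 'l set \<Rightarrow> ('p \<Rightarrow> 'l \<Rightarrow> bool) \<Rightarrow> bool" where
  "projective_plane P L I \<longleftrightarrow>
     (\<forall>x\<in>P. \<forall>y\<in>P. x \<noteq> y \<longrightarrow> (\<exists>!l. l \<in> L \<and> I x l \<and> I y l)) \<and>
     (\<forall>l\<in>L. \<forall>m\<in>L. l \<noteq> m \<longrightarrow> (\<exists>!x. x \<in> P \<and> I x l \<and> I x m)) \<and>
     (\<exists>Q\<subseteq>P. card Q = 4 \<and> (\<forall>l\<in>L. card {x \<in> Q. I x l} \<le> 2))"

definition finite_projective_plane_of_order ::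
    "nat \<Rightarrow> 'p set \<Rightarrow> 'l set \<Rightarrow> ('p \<Rightarrow> 'l \<Rightarrow> bool) \<Rightarrow> bool" where
  "finite_projective_plane_of_order q P L I \<longleftrightarrow>
     finite P \<and> finite L \<and> projective_plane P L I \<and> (\<forall>l\<in>L. card {x \<in> P. I x l} = q + 1)"

definition triangle_presentation ::
    "'p set \<Rightarrow> ('p \<Rightarrow> 'l \<Rightarrow> bool) \<Rightarrow> ('p \<Rightarrow> 'l) \<Rightarrow> ('p \<times> 'p \<times> 'p) set \<Rightarrow> bool" where
  "triangle_presentation P I lam T \<longleftrightarrow>
     T \<subseteq> P \<times> P \<times> P \<and>
     (\<forall>x\<in>P. \<forall>y\<in>P. (\<exists>z\<in>P. (x, y, z) \<in> T) \<longleftrightarrow> I y (lam x)) \<and>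
     (\<forall>x y z. (x, y, z) \<in> T \<longrightarrow> (y, z, x) \<in> T) \<and>
     (\<forall>x\<in>P. \<forall>y\<in>P. \<forall>z z'. (x, y, z) \<in> T \<longrightarrow> (x, y, z') \<in> T \<longrightarrow> z = z')"


section \<open>Groups given by generators and relators\<close>

text \<open>Words are lists of letters; the letter \<open>(x, True)\<close> stands for the generator \<open>x\<close> and
  \<open>(x, False)\<close> for its formal inverse.\<close>

definition words :: "'x set \<Rightarrow> ('x \<times> bool) list set" where
  "words X = lists (X \<times> UNIV)"

inductive_set word_cong :: "'x set \<Rightarrow> ('x \<times> bool) list set \<Rightarrow> ('x \<times> bool) list rel"
  for X R where
  refl: "w \<in> words X \<Longrightarrow> (w, w) \<in> word_cong X R"
| sym: "(v, w) \<in> word_cong X R \<Longrightarrow> (w, v) \<in> word_cong X R"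
| trans: "(u, v) \<in> word_cong X R \<Longrightarrow> (v, w) \<in> word_cong X R \<Longrightarrow> (u, w) \<in> word_cong X R"
| cancel: "u \<in> words X \<Longrightarrow> v \<in> words X \<Longrightarrow> x \<in> X \<Longrightarrow>
    (u @ [(x, b), (x, \<not> b)] @ v, u @ v) \<in> word_cong X R"
| relator: "u \<in> words X \<Longrightarrow> v \<in> words X \<Longrightarrow> r \<in> R \<inter> words X \<Longrightarrow>
    (u @ r @ v, u @ v) \<in> word_cong X R"

definition presented_group ::
    "'x set \<Rightarrow> ('x \<times> bool) list set \<Rightarrow> ('x \<times> bool) list set monoid" where
  "presented_group X R =
     \<lparr>carrier = words X // word_cong X R,
      mult = (\<lambda>A B. \<Union>a\<in>A. \<Union>b\<in>B. word_cong X R `` {a @ b}),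
      one = word_cong X R `` {[]}\<rparr>"

lemma words_append [simp]: "u @ v \<in> words X \<longleftrightarrow> u \<in> words X \<and> v \<in> words X"
  by (auto simp: words_def)

lemma words_Nil [simp]: "[] \<in> words X"
  by (auto simp: words_def)

lemma word_cong_words: "(u, v) \<in> word_cong X R \<Longrightarrow> u \<in> words X \<and> v \<in> words X"
  by (induction rule: word_cong.induct) (auto simp: words_def)

lemma equiv_word_cong: "equiv (words X) (word_cong X R)"
proof (rule equivI)
  show "word_cong X R \<subseteq> words X \<times> words X" using word_cong_words by fast
  show "refl_on (words X) (word_cong X R)" by (auto intro: refl_onI word_cong.refl)
  show "sym (word_cong X R)" by (rule symI) (rule word_cong.sym)
  show "trans (word_cong X R)" by (rule transI) (rule word_cong.trans)
qed

lemma word_cong_context: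
  "(u, v) \<in> word_cong X R \<Longrightarrow> s \<in> words X \<Longrightarrow> t \<in> words X \<Longrightarrow>
    (s @ u @ t, s @ v @ t) \<in> word_cong X R"
proof (induction rule: word_cong.induct)
  case (refl w)
  then show ?case by (simp add: word_cong.refl)
next
  case (sym v w)
  then show ?case by (simp add: word_cong.sym)
next
  case (trans u v w)
  then show ?case using word_cong.trans by blast
next
  case (cancel u v x b)
  then show ?case using word_cong.cancel[of "s @ u" X "v @ t" x b R] by simp
next
  case (relator u v r)
  then show ?case using word_cong.relator[of "s @ u" X "v @ t" r R] by simp
qed

lemma word_cong_append:
  assumes "(u, u') \<in> word_cong X R" "(v, v') \<in> word_cong X R"
  shows "(u @ v, u' @ v') \<in> word_cong X R"
  using word_cong_context[OF assms(1), of "[]" v] word_cong_context[OF assms(2), of u' "[]"]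
    word_cong_words[OF assms(1)] word_cong_words[OF assms(2)]
    word_cong.trans[of "u @ v" "u' @ v" X R "u' @ v'"]
  by simp

lemma word_cong_inverse:
  assumes "w \<in> words X"
  shows "(rev (map (\<lambda>(x, b). (x, \<not> b)) w) @ w, []) \<in> word_cong X R"
  using assms
proof (induction w)
  case Nil
  then show ?case by (auto intro: word_cong.refl)
next
  case (Cons p w)
  obtain x b where p: "p = (x, b)" by (cases p)
  let ?i = "rev (map (\<lambda>(x, b). (x, \<not> b)) w)"
  have w: "w \<in> words X" and x: "x \<in> X" using Cons.prems p by (auto simp: words_def)
  have i: "?i \<in> words X" using w by (auto simp: words_def)
  have "(?i @ [(x, \<not> b), (x, \<not> \<not> b)] @ w, ?i @ w) \<in> word_cong X R"
    by (rule word_cong.cancel[OF i w x])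
  from word_cong.trans[OF this Cons.IH[OF w]] show ?case using p by simp
qed

lemma presented_group_mult:
  assumes "u \<in> words X" "v \<in> words X"
  shows "word_cong X R `` {u} \<otimes>\<^bsub>presented_group X R\<^esub> word_cong X R `` {v}
           = word_cong X R `` {u @ v}"
proof -
  have "congruent2 (word_cong X R) (word_cong X R) (\<lambda>a b. word_cong X R `` {a @ b})"
    unfolding congruent2_def
    using equiv_class_eq[OF equiv_word_cong word_cong_append] by blast
  from UN_equiv_class2[OF equiv_word_cong equiv_word_cong this assms]
  show ?thesis by (simp add: presented_group_def)
qed

lemma carrier_presented_group:
  "a \<in> carrier (presented_group X R) \<longleftrightarrow> (\<exists>u\<in>words X. a = word_cong X R `` {u})"
  by (auto simp: presented_group_def quotient_def)

lemma one_presented_group: "\<one>\<^bsub>presented_group X R\<^esub> = word_cong X R `` {[]}"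
  by (simp add: presented_group_def)

lemma group_presented_group: "group (presented_group X R)"
proof (rule groupI)
  fix a b assume "a \<in> carrier (presented_group X R)" "b \<in> carrier (presented_group X R)"
  then obtain u v where "u \<in> words X" "v \<in> words X"
    "a = word_cong X R `` {u}" "b = word_cong X R `` {v}"
    by (auto simp: carrier_presented_group)
  then show "a \<otimes>\<^bsub>presented_group X R\<^esub> b \<in> carrier (presented_group X R)"
    using presented_group_mult[of u X v R] words_append carrier_presented_group by metis
next
  show "\<one>\<^bsub>presented_group X R\<^esub> \<in> carrier (presented_group X R)"
    using words_Nil carrier_presented_group one_presented_group by metis
next
  fix a b c assume "a \<in> carrier (presented_group X R)" "b \<in> carrier (presented_group X R)"
    "c \<in> carrier (presented_group X R)"
  then obtain u v w where "u \<in> words X" "v \<in> words X" "w \<in> words X"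
    "a = word_cong X R `` {u}" "b = word_cong X R `` {v}" "c = word_cong X R `` {w}"
    by (auto simp: carrier_presented_group)
  then show "a \<otimes>\<^bsub>presented_group X R\<^esub> b \<otimes>\<^bsub>presented_group X R\<^esub> c
      = a \<otimes>\<^bsub>presented_group X R\<^esub> (b \<otimes>\<^bsub>presented_group X R\<^esub> c)"
    by (simp add: presented_group_mult)
next
  fix a assume "a \<in> carrier (presented_group X R)"
  then obtain u where u: "u \<in> words X" "a = word_cong X R `` {u}"
    by (auto simp: carrier_presented_group)
  show "\<one>\<^bsub>presented_group X R\<^esub> \<otimes>\<^bsub>presented_group X R\<^esub> a = a"
    using u presented_group_mult[of "[]" X u R] by (simp add: one_presented_group)
  let ?i = "rev (map (\<lambda>(x, b). (x, \<not> b)) u)"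
  have i: "?i \<in> words X" using u(1) by (auto simp: words_def)
  have "word_cong X R `` {?i} \<otimes>\<^bsub>presented_group X R\<^esub> a = \<one>\<^bsub>presented_group X R\<^esub>"
    unfolding u(2) presented_group_mult[OF i u(1)] one_presented_group
    by (rule equiv_class_eq[OF equiv_word_cong word_cong_inverse[OF u(1)]])
  then show "\<exists>b\<in>carrier (presented_group X R).
      b \<otimes>\<^bsub>presented_group X R\<^esub> a = \<one>\<^bsub>presented_group X R\<^esub>"
    using i carrier_presented_group by metis
qed

definition triangle_relators :: "('p \<times> 'p \<times> 'p) set \<Rightarrow> ('p \<times> bool) list set" where
  "triangle_relators T = {[(x, True), (y, True), (z, True)] |x y z. (x, y, z) \<in> T}"

definition triangle_group ::
    "'p set \<Rightarrow> ('p \<times> 'p \<times> 'p) set \<Rightarrow> ('p \<times> bool) list set monoid" where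
  "triangle_group P T = presented_group P (triangle_relators T)"

definition gen :: "'p set \<Rightarrow> ('p \<times> 'p \<times> 'p) set \<Rightarrow> 'p \<Rightarrow> ('p \<times> bool) list set" where
  "gen P T x = word_cong P (triangle_relators T) `` {[(x, True)]}"


section \<open>Apartments, sectors and the boundary of a complex of type A2-tilde\<close>

text \<open>A simplicial complex is represented by the set of its nonempty simplices, each simplex
  being the set of its vertices.\<close>

definition complex_of :: "'v set set \<Rightarrow> 'v set set" where
  "complex_of Ch = {s. s \<noteq> {} \<and> (\<exists>C\<in>Ch. s \<subseteq> C)}"

definition simplicial_iso :: "('v \<Rightarrow> 'w) \<Rightarrow> 'v set set \<Rightarrow> 'w set set \<Rightarrow> bool" where
  "simplicial_iso f K K' \<longleftrightarrow> bij_betw f (\<Union>K) (\<Union>K') \<and> (`) f ` K = K'"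

text \<open>The plane tessellated by equilateral triangles, in coordinates with respect to a basis
  \<open>e1, e2\<close> of unit vectors at angle \<open>\<pi>/3\<close>: the six neighbours of the origin are, in cyclic
  order, \<open>e1, e2, e2 - e1, -e1, -e2, e1 - e2\<close>.\<close>

definition coxeter_A2_tilde :: "(int \<times> int) set set" where
  "coxeter_A2_tilde = complex_of
     ({{(i, j), (i + 1, j), (i, j + 1)} |i j. True} \<union>
      {{(i + 1, j), (i, j + 1), (i + 1, j + 1)} |i j. True})"

definition apartment :: "'v set set \<Rightarrow> 'v set set \<Rightarrow> bool" where
  "apartment K A \<longleftrightarrow> A \<subseteq> K \<and> (\<exists>f. simplicial_iso f coxeter_A2_tilde A)"

text \<open>One of the six simplicial cones based at the origin.  The automorphism group of the
  tessellation contains all translations and the rotation \<open>(i, j) \<mapsto> (-j, i + j)\<close> by \<open>\<pi>/3\<close>, so the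
  images of this cone under all isomorphisms onto an apartment are the six cones based at each
  of the vertices of that apartment.\<close>

definition standard_cone :: "(int \<times> int) set set" where
  "standard_cone = {s \<in> coxeter_A2_tilde. s \<subseteq> {(i, j). 0 \<le> i \<and> 0 \<le> j}}"

definition sector_at :: "'v set set \<Rightarrow> 'v \<Rightarrow> 'v set set \<Rightarrow> bool" where
  "sector_at K v S \<longleftrightarrow>
     (\<exists>A f. apartment K A \<and> simplicial_iso f coxeter_A2_tilde A \<and> f (0, 0) = v \<and>
            S = (`) f ` standard_cone)"

definition sectors :: "'v set set \<Rightarrow> 'v set set set" where
  "sectors K = {S. \<exists>v. sector_at K v S}"

definition sector_equiv :: "'v set set \<Rightarrow> 'v set set rel" where
  "sector_equiv K = {(S, S'). S \<in> sectors K \<and> S' \<in> sectors K \<and>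
     (\<exists>S''\<in>sectors K. S'' \<subseteq> S \<and> S'' \<subseteq> S')}"

definition boundary :: "'v set set \<Rightarrow> 'v set set set set" where
  "boundary K = sectors K // sector_equiv K"

definition rep_sector :: "'v set set \<Rightarrow> 'v \<Rightarrow> 'v set set set \<Rightarrow> 'v set set" where
  "rep_sector K v \<omega> = (THE S. S \<in> \<omega> \<and> sector_at K v S)"

definition half_apartments :: "'v set set \<Rightarrow> 'v set set set" where
  "half_apartments K = {(`) f ` {s \<in> coxeter_A2_tilde. s \<subseteq> {(i, j). 0 \<le> i}} |A f.
     apartment K A \<and> simplicial_iso f coxeter_A2_tilde A}"

text \<open>The convex hull of a set of simplices contained in some apartment is the intersection of
  the half-apartments containing it.  (As in \<open>standard_cone\<close>, a single half-plane suffices in the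
  definition of half-apartments, since the automorphisms of the tessellation permute the
  half-planes bounded by its lines transitively.)\<close>

definition convex_hull :: "'v set set \<Rightarrow> 'v set set \<Rightarrow> 'v set set" where
  "convex_hull K X = \<Inter>{H \<in> half_apartments K. X \<subseteq> H}"

definition base_chamber :: "'v set set \<Rightarrow> 'v \<Rightarrow> 'v set" where
  "base_chamber S v = (THE C. C \<in> S \<and> card C = 3 \<and> v \<in> C)"

definition hull_from :: "'v set set \<Rightarrow> 'v \<Rightarrow> 'v \<Rightarrow> 'v set set set \<Rightarrow> 'v set set" where
  "hull_from K v u \<omega> = convex_hull K {{u}, base_chamber (rep_sector K v \<omega>) v}"

definition basic_nbhd :: "'v set set \<Rightarrow> 'v \<Rightarrow> 'v \<Rightarrow> 'v set set set \<Rightarrow> 'v set set set set" where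
  "basic_nbhd K v u \<omega> = {\<omega>' \<in> boundary K. hull_from K v u \<omega> \<subseteq> rep_sector K v \<omega>'}"

definition boundary_topology :: "'v set set \<Rightarrow> 'v set set set topology" where
  "boundary_topology K = topology_generated_by
     {basic_nbhd K v u \<omega> |v u \<omega>. \<omega> \<in> boundary K \<and> v \<in> \<Union>K \<and> u \<in> \<Union>(rep_sector K v \<omega>)}"


section \<open>The triangle building of a triangle presentation and its periodic limit points\<close>

definition triangle_building ::
    "'p set \<Rightarrow> ('p \<times> 'p \<times> 'p) set \<Rightarrow> ('p \<times> bool) list set set set" where
  "triangle_building P T = (let G = triangle_group P T in complex_of
     {{g, g \<otimes>\<^bsub>G\<^esub> inv\<^bsub>G\<^esub> (gen P T x), g \<otimes>\<^bsub>G\<^esub> gen P T y} |g x y.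
        g \<in> carrier G \<and> (\<exists>z. (x, y, z) \<in> T)})"

definition oriented_edge ::
    "'p set \<Rightarrow> ('p \<times> 'p \<times> 'p) set \<Rightarrow> ('p \<times> bool) list set \<Rightarrow> ('p \<times> bool) list set \<Rightarrow> bool" where
  "oriented_edge P T g h \<longleftrightarrow> (\<exists>x\<in>P. h = g \<otimes>\<^bsub>triangle_group P T\<^esub> gen P T x)"

text \<open>\<open>sector_coords P T S a\<close>: the vertices \<open>a (i, j)\<close> with \<open>i, j \<ge> 0\<close> are the vertices of the sector
  \<open>S\<close>, where \<open>i\<close> counts unit steps parallel to the bounding ray oriented away from the base vertex
  and \<open>j\<close> unit steps parallel to the bounding ray oriented towards it.\<close>

definition sector_coords ::
    "'p set \<Rightarrow> ('p \<times> 'p \<times> 'p) set \<Rightarrow> ('p \<times> bool) list set set set \<Rightarrow>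
      (int \<times> int \<Rightarrow> ('p \<times> bool) list set) \<Rightarrow> bool" where
  "sector_coords P T S a \<longleftrightarrow>
     (\<exists>A. apartment (triangle_building P T) A \<and> simplicial_iso a coxeter_A2_tilde A) \<and>
     S = (`) a ` standard_cone \<and>
     (\<forall>i\<ge>0. oriented_edge P T (a (i, 0)) (a (i + 1, 0))) \<and>
     (\<forall>j\<ge>0. oriented_edge P T (a (0, j + 1)) (a (0, j)))"

definition rs_periodic ::
    "'p set \<Rightarrow> ('p \<times> 'p \<times> 'p) set \<Rightarrow> ('p \<times> bool) list set set set \<Rightarrow> int \<Rightarrow> int \<Rightarrow> bool" where
  "rs_periodic P T S r s \<longleftrightarrow> (let G = triangle_group P T in
     \<exists>a. sector_coords P T S a \<and>
       (\<forall>i\<ge>0. \<forall>j\<ge>0. \<forall>k\<ge>0. \<forall>l\<ge>0. i + r \<ge> 0 \<longrightarrow> j + s \<ge> 0 \<longrightarrow> k + r \<ge> 0 \<longrightarrow> l + s \<ge> 0 \<longrightarrow>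
          inv\<^bsub>G\<^esub> (a (i, j)) \<otimes>\<^bsub>G\<^esub> a (k, l) =
          inv\<^bsub>G\<^esub> (a (i + r, j + s)) \<otimes>\<^bsub>G\<^esub> a (k + r, l + s)))"

definition periodic_sector ::
    "'p set \<Rightarrow> ('p \<times> 'p \<times> 'p) set \<Rightarrow> ('p \<times> bool) list set set set \<Rightarrow> bool" where
  "periodic_sector P T S \<longleftrightarrow> (\<exists>r s. (r, s) \<noteq> (0, 0) \<and> rs_periodic P T S r s)"

definition doubly_periodic_sector ::
    "'p set \<Rightarrow> ('p \<times> 'p \<times> 'p) set \<Rightarrow> ('p \<times> bool) list set set set \<Rightarrow> bool" where
  "doubly_periodic_sector P T S \<longleftrightarrow>
     (\<exists>r s t u. r * u - s * t \<noteq> 0 \<and> rs_periodic P T S r s \<and> rs_periodic P T S t u)"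

definition rigidly_periodic_sector ::
    "'p set \<Rightarrow> ('p \<times> 'p \<times> 'p) set \<Rightarrow> ('p \<times> bool) list set set set \<Rightarrow> bool" where
  "rigidly_periodic_sector P T S \<longleftrightarrow>
     doubly_periodic_sector P T S \<or>
     (\<exists>r s. r \<noteq> 0 \<and> s \<noteq> 0 \<and> s \<noteq> - r \<and> rs_periodic P T S r s)"

definition Omega :: "'p set \<Rightarrow> ('p \<times> 'p \<times> 'p) set \<Rightarrow> ('p \<times> bool) list set set set set set" where
  "Omega P T = boundary (triangle_building P T)"

definition Omega_topology ::
    "'p set \<Rightarrow> ('p \<times> 'p \<times> 'p) set \<Rightarrow> ('p \<times> bool) list set set set set topology" where
  "Omega_topology P T = boundary_topology (triangle_building P T)"

definition periodic_points ::
    "'p set \<Rightarrow> ('p \<times> 'p \<times> 'p) set \<Rightarrow> ('p \<times> bool) list set set set set set" where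
  "periodic_points P T = {\<omega> \<in> Omega P T. \<exists>S\<in>\<omega>. periodic_sector P T S}"

definition rigidly_periodic_points ::
    "'p set \<Rightarrow> ('p \<times> 'p \<times> 'p) set \<Rightarrow> ('p \<times> bool) list set set set set set" where
  "rigidly_periodic_points P T = {\<omega> \<in> Omega P T. \<exists>S\<in>\<omega>. rigidly_periodic_sector P T S}"

definition boundary_action ::
    "'p set \<Rightarrow> ('p \<times> 'p \<times> 'p) set \<Rightarrow> ('p \<times> bool) list set \<Rightarrow>
      ('p \<times> bool) list set set set set \<Rightarrow> ('p \<times> bool) list set set set set" where
  "boundary_action P T g \<omega> = (\<lambda>S. (`) (\<lambda>h. g \<otimes>\<^bsub>triangle_group P T\<^esub> h) ` S) ` \<omega>"

definition dense_in_Omega ::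
    "'p set \<Rightarrow> ('p \<times> 'p \<times> 'p) set \<Rightarrow> ('p \<times> bool) list set set set set set \<Rightarrow> bool" where
  "dense_in_Omega P T D \<longleftrightarrow> D \<subseteq> Omega P T \<and> Omega_topology P T closure_of D = Omega P T"

definition group_invariant ::
    "'p set \<Rightarrow> ('p \<times> 'p \<times> 'p) set \<Rightarrow> ('p \<times> bool) list set set set set set \<Rightarrow> bool" where
  "group_invariant P T D \<longleftrightarrow>
     (\<forall>g\<in>carrier (triangle_group P T). boundary_action P T g ` D = D)"

end

theory Submission
  imports Defs
begin

text \<open>
The whole argument takes place in the Cayley graph with its edges directed as \<open>g \<rightarrow> g a\<^sub>x\<close>.  At
a vertex \<open>v\<close> call the targets of the edges leaving \<open>v\<close> points and the sources of the edges entering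
\<open>v\<close> lines, and call a point \<open>h\<close> and a line \<open>k\<close> incident when \<open>h \<rightarrow> k\<close> is an edge: this is the
projective plane of the triangle presentation, and the chambers of the building are the directed
triangles.  An apartment is described by a \<^emph>\<open>flat\<close>, a map from \<open>\<int>\<^sup>2\<close> to the vertices that follows
edges in the directions \<open>e\<^sub>0 = (1, 0)\<close>, \<open>e\<^sub>1 = (- 1, 1)\<close>, \<open>e\<^sub>2 = (0, - 1)\<close> and is straight, that is, two
consecutive steps in one direction lead to a point that is not incident with the line from which
they came.  A sector is the image of the first quadrant of a flat.

Two facts about flats replace the general theory of affine buildings.

The first is global.  Each element of the group is given by at most one normal word
\<open>a\<^sub>x \<dots> a\<^sub>x\<^sub>' a\<^sub>y\<^sup>-\<^sup>1 \<dots> a\<^sub>y\<^sub>'\<^sup>-\<^sup>1\<close> in which no two neighbouring letters can be shortened or exchanged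
(\<open>normal_word_unique\<close>); this is shown by letting all words act on normal words.  In the graph it
says that a straight path which runs first along and then against the edges is determined by its
ends.  Hence flats are injective, and two flats with the same origin that share a vertex
\<open>(m, n)\<close> of their quadrants agree on the whole parallelogram between the origin and that vertex
(\<open>parallelogram_unique\<close>).  So a sector is determined by its base vertex and its class.

The second is local.  The two chambers between consecutive vertices on the diagonal of a flat
form a diamond, and any sequence of diamonds of which each is opposite to the next at their common
vertex extends to a flat (\<open>flat_of_gallery\<close>), because all other vertices are successive joins or
meets in the planes.  This gives, for each edge leaving the base vertex of a sector, a sector of
the same class at the end of that edge (\<open>neighbour_sector\<close>), and by iteration one at every vertex
(\<open>sector_change_base\<close>), with a bound on the coordinates involved that depends on the two vertices
only.

Because of that bound every neighbourhood of a boundary point \<open>\<omega>\<close> contains a cylinder, the set of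
all \<open>\<omega>'\<close> whose sector at the identity passes through a given vertex \<open>(N, N)\<close> of the sector of \<open>\<omega>\<close>
(\<open>dense_if_meets_cylinders\<close>).  It remains to find a rigidly periodic point in each cylinder.  Up to
translation there are finitely many diamonds, and each of them has as many possible
successors as predecessors, always the same number.  Such a finite relation is recurrent: a walk
that has led from one diamond to another can be continued back to the first.  So the diamonds
between \<open>(0, 0)\<close> and \<open>(N, N)\<close> are part of a closed walk, whose endless repetition is the diagonal
of a flat \<open>b\<close> with \<open>b (i + M, j + M) = g b (i, j)\<close> for some \<open>g\<close> in the group and some \<open>M > 0\<close>
(\<open>periodic_flat_through\<close>).  Its sector is \<open>(M, M)\<close>-periodic, hence rigidly periodic.

Invariance holds because left multiplication carries flats to flats and does not change the
quotients \<open>a\<^sup>-\<^sup>1 b\<close> of two vertices.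
\<close>

section \<open>Flats spanned by diagonal galleries\<close>

text \<open>The neighbours of \<open>v\<close> are regarded as a plane whose points are the \<open>h\<close> with \<open>E v h\<close>, whose lines are the \<open>k\<close>
with \<open>E k v\<close>, and whose incidence is \<open>E h k\<close>.  Reversing all edges exchanges points and lines.\<close>

locale link_planes =
  fixes E :: "'v \<Rightarrow> 'v \<Rightarrow> bool"
  assumes join: "E v h \<Longrightarrow> E v h' \<Longrightarrow> h \<noteq> h' \<Longrightarrow> \<exists>k. E k v \<and> E h k \<and> E h' k"
    and meet: "E k v \<Longrightarrow> E k' v \<Longrightarrow> k \<noteq> k' \<Longrightarrow> \<exists>h. E v h \<and> E h k \<and> E h k'"
    and link_no_square: "E v h \<Longrightarrow> E v h' \<Longrightarrow> E k v \<Longrightarrow> E k' v \<Longrightarrow>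
      E h k \<Longrightarrow> E h k' \<Longrightarrow> E h' k \<Longrightarrow> E h' k' \<Longrightarrow> h = h' \<or> k = k'"
begin

lemma link_planes_reverse: "link_planes (\<lambda>u v. E v u)"
proof (unfold_locales, goal_cases)
  case (1 v h h')
  then show ?case using meet by blast
next
  case (2 v h h')
  then show ?case using join by blast
next
  case (3 v h h' k k')
  then show ?case using link_no_square[of v k k' h h'] by blast
qed

text \<open>The first three conditions are the edges in the directions \<open>e\<^sub>0\<close>, \<open>e\<^sub>1\<close>, \<open>e\<^sub>2\<close>, the last three are
the straightness in these directions.\<close>

definition flat :: "(int \<times> int \<Rightarrow> 'v) \<Rightarrow> bool" where
  "flat a \<longleftrightarrow> (\<forall>i j.
     E (a (i, j)) (a (i + 1, j)) \<and> E (a (i + 1, j)) (a (i, j + 1)) \<and> E (a (i, j + 1)) (a (i, j)) \<and>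
     \<not> E (a (i + 2, j)) (a (i, j)) \<and> \<not> E (a (i, j + 2)) (a (i + 2, j)) \<and>
     \<not> E (a (i, j)) (a (i, j + 2)))"

text \<open>Three consecutive layers of a flat, a layer being the set of all \<open>(i, j)\<close> with a given value of
\<open>i - j\<close>, listed by \<open>j\<close>.  The negated edges are the straightness in the directions \<open>e\<^sub>0\<close> and \<open>e\<^sub>2\<close>,
in which \<open>i - j\<close> grows.\<close>

definition strip :: "(int \<Rightarrow> 'v) \<Rightarrow> (int \<Rightarrow> 'v) \<Rightarrow> (int \<Rightarrow> 'v) \<Rightarrow> bool" where
  "strip s w u \<longleftrightarrow> (\<forall>k.
     E (s k) (w k) \<and> E (s (k + 1)) (w k) \<and> E (w k) (u k) \<and> E (w (k + 1)) (u k) \<and>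
     E (u k) (s (k + 1)) \<and> \<not> E (u k) (s k) \<and> \<not> E (u k) (s (k + 2)) \<and> w k \<noteq> w (k + 1))"

definition joining :: "'v \<Rightarrow> 'v \<Rightarrow> 'v \<Rightarrow> 'v" where
  "joining v h h' = (SOME k. E k v \<and> E h k \<and> E h' k)"

lemma joining:
  assumes "E v h" "E v h'" "h \<noteq> h'"
  shows "E (joining v h h') v" "E h (joining v h h')" "E h' (joining v h h')"
proof -
  have "E (joining v h h') v \<and> E h (joining v h h') \<and> E h' (joining v h h')"
    unfolding joining_def using someI_ex[OF join[OF assms]] .
  then show "E (joining v h h') v" "E h (joining v h h')" "E h' (joining v h h')" by auto
qed

lemma joining_eq:
  assumes "E v h" "E v h'" "h \<noteq> h'" "E k v" "E h k" "E h' k"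
  shows "joining v h h' = k"
  using joining[OF assms(1-3)] link_no_square assms by metis

text \<open>In the plane at \<open>w (k + 1)\<close> the vertices \<open>u k\<close> and \<open>u (k + 1)\<close> are two different points, and the
new vertex is the line joining them.  The new layer is straight: otherwise the new vertex and a
vertex of \<open>s\<close> would be two points with two common lines in the plane at a vertex of \<open>u\<close>.\<close>

lemma strip_step:
  assumes "strip s w u"
  shows "strip w u (\<lambda>k. joining (w (k + 1)) (u k) (u (k + 1)))" (is "strip w u ?t")
proof -
  have sw0: "E (s k) (w k)" "E (s (k + 1)) (w k)" for k
    using assms unfolding strip_def by auto
  have sw: "E (s k) (w k)" "E (s (k + 1)) (w k)" "E (s (k + 2)) (w (k + 1))" for k
    using sw0[of k] sw0[of "k + 1"] by (auto simp: add.assoc)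
  have wu: "E (w k) (u k)" "E (w (k + 1)) (u k)" "w k \<noteq> w (k + 1)" for k
    using assms unfolding strip_def by auto
  have us0: "E (u k) (s (k + 1))" "\<not> E (u k) (s k)" "\<not> E (u k) (s (k + 2))" for k
    using assms unfolding strip_def by auto
  have us: "E (u k) (s (k + 1))" "E (u (k + 1)) (s (k + 2))"
    "\<not> E (u k) (s k)" "\<not> E (u (k + 1)) (s (k + 1))" "\<not> E (u k) (s (k + 2))" for k
    using us0[of k] us0[of "k + 1"] by (auto simp: add.assoc)
  have ne: "u k \<noteq> u (k + 1)" for k using us by metis
  have t: "E (?t k) (w (k + 1))" "E (u k) (?t k)" "E (u (k + 1)) (?t k)" for k
    using joining[OF wu(2) wu(1)[of "k + 1"] ne] by auto
  have w2: "w (k + 1) \<noteq> w (k + 2)" "E (w (k + 2)) (u (k + 1))" "E (s (k + 2)) (w (k + 2))" for k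
    using wu(3)[of "k + 1"] wu(2)[of "k + 1"] sw(1)[of "k + 2"] by (simp_all add: algebra_simps)
  have "\<not> E (?t k) (w k)" for k
  proof
    assume "E (?t k) (w k)"
    moreover have "?t k \<noteq> s (k + 1)" using t us by metis
    ultimately show False
      using link_no_square[of "u k" "?t k" "s (k + 1)" "w k" "w (k + 1)"] t us wu sw by blast
  qed
  moreover have "\<not> E (?t k) (w (k + 2))" for k
  proof
    assume "E (?t k) (w (k + 2))"
    moreover have "?t k \<noteq> s (k + 2)" using t us by metis
    ultimately show False
      using link_no_square[of "u (k + 1)" "?t k" "s (k + 2)" "w (k + 1)" "w (k + 2)"] t us wu sw w2
      by blast
  qed
  ultimately show ?thesis unfolding strip_def using wu t ne by blast
qed

fun layer :: "(int \<Rightarrow> 'v) \<Rightarrow> (int \<Rightarrow> 'v) \<Rightarrow> nat \<Rightarrow> int \<Rightarrow> 'v" where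
  "layer s w 0 = s"
| "layer s w (Suc 0) = w"
| "layer s w (Suc (Suc n)) =
     (\<lambda>k. joining (layer s w n (k + 1)) (layer s w (Suc n) k) (layer s w (Suc n) (k + 1)))"

lemma layer_2:
  assumes "strip s w u" shows "layer s w 2 = u"
proof
  fix k
  have "joining (s (k + 1)) (w k) (w (k + 1)) = u k"
    using assms unfolding strip_def by (intro joining_eq) auto
  then show "layer s w 2 k = u k" by (simp add: numeral_2_eq_2)
qed

lemma strip_layer:
  assumes "strip s w u"
  shows "strip (layer s w n) (layer s w (Suc n)) (layer s w (Suc (Suc n)))"
proof (induction n)
  case 0
  then show ?case using layer_2[OF assms] assms by (simp add: numeral_2_eq_2)
next
  case (Suc n)
  show ?case using strip_step[OF Suc] by simp
qed

text \<open>The chamber \<open>g k, p k, l k\<close> and the chamber on the other side of its edge from \<open>p k\<close> to \<open>l k\<close>, whose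
third vertex is \<open>g (k + 1)\<close>.  The last two conditions say that at \<open>g (k + 1)\<close> the flag
\<open>p (k + 1), l (k + 1)\<close> of the next chamber is opposite to the flag \<open>p k, l k\<close>.\<close>

definition gallery_at :: "(int \<Rightarrow> 'v) \<Rightarrow> (int \<Rightarrow> 'v) \<Rightarrow> (int \<Rightarrow> 'v) \<Rightarrow> int \<Rightarrow> bool" where
  "gallery_at g p l k \<longleftrightarrow>
     E (g k) (p k) \<and> E (p k) (l k) \<and> E (l k) (g k) \<and>
     E (l k) (g (k + 1)) \<and> E (g (k + 1)) (p k) \<and> g k \<noteq> g (k + 1) \<and>
     \<not> E (p (k + 1)) (l k) \<and> \<not> E (p k) (l (k + 1))"

lemma gallery_strip:
  assumes "\<forall>k. gallery_at g p l k"
  shows "strip (\<lambda>k. l (k - 1)) g p"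
  unfolding strip_def
proof
  fix k :: int
  have k: "k + 2 - 1 = k + 1" by simp
  have "gallery_at g p l k" "gallery_at g p l (k - 1)" using assms by auto
  then show "E (l (k - 1)) (g k) \<and> E (l (k + 1 - 1)) (g k) \<and> E (g k) (p k) \<and> E (g (k + 1)) (p k) \<and>
     E (p k) (l (k + 1 - 1)) \<and> \<not> E (p k) (l (k - 1)) \<and> \<not> E (p k) (l (k + 2 - 1)) \<and> g k \<noteq> g (k + 1)"
    unfolding k by (auto simp: gallery_at_def)
qed

text \<open>Straightness in the direction \<open>e\<^sub>1\<close> comes from the other two directions: if it failed at a vertex,
then in the plane at that vertex the points in the directions \<open>e\<^sub>0\<close> and \<open>e\<^sub>1\<close> would lie on two
common lines, which would have to be equal, and this contradicts straightness in the direction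
\<open>e\<^sub>2\<close>.\<close>

lemma flat_from_strips:
  assumes strips: "\<And>d. strip (\<lambda>k. f (k + d, k)) (\<lambda>k. f (k + d + 1, k)) (\<lambda>k. f (k + d + 2, k))"
  shows "flat f"
proof -
  have 1: "E (f (i, j)) (f (i + 1, j))" for i j
    using strips[of "i - j"] unfolding strip_def by (auto dest!: spec[of _ j] simp: algebra_simps)
  have 2: "E (f (i + 1, j)) (f (i, j + 1))" for i j
    using strips[of "i - j - 1"] unfolding strip_def by (auto dest!: spec[of _ j] simp: algebra_simps)
  have 3: "E (f (i, j + 1)) (f (i, j))" for i j
    using strips[of "i - j - 1"] unfolding strip_def by (auto dest!: spec[of _ j] simp: algebra_simps)
  have 4: "\<not> E (f (i + 2, j)) (f (i, j))" for i j
    using strips[of "i - j"] unfolding strip_def by (auto dest!: spec[of _ j] simp: algebra_simps)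
  have 5: "\<not> E (f (i, j)) (f (i, j + 2))" for i j
    using strips[of "i - j - 2"] unfolding strip_def by (auto dest!: spec[of _ j] simp: algebra_simps)
  have 6: "\<not> E (f (i, j + 2)) (f (i + 2, j))" for i j
  proof
    assume a: "E (f (i, j + 2)) (f (i + 2, j))"
    let ?v = "f (i + 1, j + 1)"
    have q: "E ?v (f (i + 2, j + 1))" "E ?v (f (i, j + 2))" "E ?v (f (i + 1, j))"
      "E (f (i, j + 1)) ?v" "E (f (i + 2, j)) ?v" "E (f (i + 1, j + 2)) ?v"
      using 1[of "i + 1" "j + 1"] 2[of i "j + 1"] 3[of "i + 1" j] 1[of i "j + 1"] 2[of "i + 1" j]
        3[of "i + 1" "j + 1"] by (simp_all add: algebra_simps)
    have e: "E (f (i + 2, j + 1)) (f (i + 2, j))" "E (f (i + 2, j + 1)) (f (i + 1, j + 2))"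
      "E (f (i, j + 2)) (f (i, j + 1))" "E (f (i, j + 2)) (f (i + 1, j + 2))"
      "E (f (i + 1, j)) (f (i, j + 1))" "E (f (i + 1, j)) (f (i + 2, j))"
      using 3[of "i + 2" j] 2[of "i + 1" "j + 1"] 3[of i "j + 1"] 1[of i "j + 2"] 2[of i j]
        1[of "i + 1" j] by (simp_all add: algebra_simps)
    have "f (i + 2, j + 1) \<noteq> f (i, j + 2)" using e 4[of i "j + 1"] by metis
    then have "f (i + 2, j) = f (i + 1, j + 2)"
      using link_no_square[OF q(1,2,5,6) e(1,2) a e(4)] by blast
    then show False using e 5[of "i + 1" j] by metis
  qed
  show ?thesis unfolding flat_def using 1 2 3 4 5 6 by blast
qed

text \<open>The layers on one side of the diagonal are built by iterating \<open>strip_step\<close>.  Reversing the edges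
and exchanging the two coordinates turns flats into flats of the reversed graph, so the layers on
the other side are built in the same way.\<close>

theorem flat_of_gallery:
  assumes "\<forall>k. gallery_at g p l k"
  shows "\<exists>f. flat f \<and> (\<forall>k. f (k, k) = g k \<and> f (k + 1, k) = p k \<and> f (k, k + 1) = l k)"
proof -
  interpret op: link_planes "\<lambda>u v. E v u" by (rule link_planes_reverse)
  have "op.gallery_at g l p k" for k using assms unfolding gallery_at_def op.gallery_at_def by blast
  then have os: "op.strip (\<lambda>k. p (k - 1)) g l" using op.gallery_strip by blast
  have s: "strip (\<lambda>k. l (k - 1)) g p" using gallery_strip assms by blast
  \<comment> \<open>\<open>X n\<close> is the layer \<open>i - j = n - 1\<close>; likewise \<open>Y n\<close> is the layer \<open>j - i = n - 1\<close>, listed by \<open>i\<close>.\<close>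
  define X where "X = layer (\<lambda>k. l (k - 1)) g"
  define Y where "Y = op.layer (\<lambda>k. p (k - 1)) g"
  define f where "f = (\<lambda>(i, j). if j \<le> i then X (nat (i - j) + 1) j else Y (nat (j - i) + 1) i)"
  have X2: "X 2 = p" "Y 2 = l" using layer_2[OF s] op.layer_2[OF os] by (simp_all add: X_def Y_def)
  have X01: "X 0 k = l (k - 1)" "Y 0 k = p (k - 1)" "X 1 = g" "Y 1 = g" for k
    by (simp_all add: X_def Y_def)
  have fX: "f (k + d, k) = X (nat (d + 1)) k" if "-1 \<le> d" for d k
  proof (cases "d = -1")
    case True
    then show ?thesis using X2 X01 by (simp add: f_def numeral_2_eq_2)
  next
    case False
    then have "nat (d + 1) = nat d + 1" using that by simp
    then show ?thesis using False that by (simp add: f_def)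
  qed
  have fY: "f (k + d, k) = Y (nat (1 - d)) (k + d)" if d1: "d \<le> 1" for d k
  proof -
    consider "d < 0" | "d = 0" | "d = 1" using d1 by force
    then show ?thesis
    proof cases
      case 1
      then have "nat (1 - d) = nat (- d) + 1" by simp
      then show ?thesis using 1 by (simp add: f_def)
    qed (use X2 X01 in \<open>simp_all add: f_def numeral_2_eq_2\<close>)
  qed
  have "strip (\<lambda>k. f (k + d, k)) (\<lambda>k. f (k + d + 1, k)) (\<lambda>k. f (k + d + 2, k))" for d
  proof (cases "-1 \<le> d")
    case True
    then have n: "nat (d + 2) = Suc (nat (d + 1))" "nat (d + 3) = Suc (Suc (nat (d + 1)))" by auto
    have "f (k + d + 1, k) = X (nat (d + 2)) k" "f (k + d + 2, k) = X (nat (d + 3)) k" for k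
      using fX[of "d + 1" k] fX[of "d + 2" k] True by (simp_all add: algebra_simps)
    then show ?thesis using strip_layer[OF s, of "nat (d + 1)"] fX[OF True] n by (simp add: X_def)
  next
    case False
    define n where "n = nat (- 1 - d)"
    have n: "nat (1 - d) = Suc (Suc n)" "nat (- d) = Suc n" using False by (auto simp: n_def)
    have f: "f (k + d, k) = Y (Suc (Suc n)) (k + d)" "f (k + d + 1, k) = Y (Suc n) (k + d + 1)"
      "f (k + d + 2, k) = Y n (k + d + 2)" for k
      using fY[of d k] fY[of "d + 1" k] fY[of "d + 2" k] False n
      by (simp_all add: n_def algebra_simps)
    have o: "op.strip (Y n) (Y (Suc n)) (Y (Suc (Suc n)))"
      using op.strip_layer[OF os, of n] by (simp add: Y_def)
    have o0: "E (Y (Suc n) k) (Y n k) \<and> E (Y (Suc n) k) (Y n (k + 1)) \<and>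
      E (Y (Suc (Suc n)) k) (Y (Suc n) k) \<and> E (Y (Suc (Suc n)) k) (Y (Suc n) (k + 1)) \<and>
      E (Y n (k + 1)) (Y (Suc (Suc n)) k) \<and> \<not> E (Y n k) (Y (Suc (Suc n)) k) \<and>
      \<not> E (Y n (k + 2)) (Y (Suc (Suc n)) k) \<and> Y (Suc n) k \<noteq> Y (Suc n) (k + 1)" for k
      using o unfolding op.strip_def by blast
    have sh: "k + 1 + d = k + d + 1" "k + 1 + d + 1 = k + d + 2" "k + 2 + d = k + d + 2"
      "k + d + 1 + 1 = k + d + 2" for k by auto
    show ?thesis unfolding strip_def
    proof
      fix k
      show "E (f (k + d, k)) (f (k + d + 1, k)) \<and> E (f (k + 1 + d, k + 1)) (f (k + d + 1, k)) \<and>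
        E (f (k + d + 1, k)) (f (k + d + 2, k)) \<and> E (f (k + 1 + d + 1, k + 1)) (f (k + d + 2, k)) \<and>
        E (f (k + d + 2, k)) (f (k + 1 + d, k + 1)) \<and> \<not> E (f (k + d + 2, k)) (f (k + d, k)) \<and>
        \<not> E (f (k + d + 2, k)) (f (k + 2 + d, k + 2)) \<and>
        f (k + d + 1, k) \<noteq> f (k + 1 + d + 1, k + 1)"
        unfolding f using o0[of "k + d"] o0[of "k + d + 1"] o0[of "k + d + 2"] by (simp add: sh)
    qed
  qed
  then have "flat f" by (rule flat_from_strips)
  moreover have "f (k, k) = g k \<and> f (k + 1, k) = p k \<and> f (k, k + 1) = l k" for k
    using X2 X01 by (simp add: f_def numeral_2_eq_2)
  ultimately show ?thesis by blast
qed

end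

section \<open>Uniqueness of straight paths and of parallelograms\<close>

text \<open>The first quadrant, its images under the rotation \<open>(i, j) \<mapsto> (- i - j, i)\<close> of order three, and the
negatives of these are the six sectors of the tessellation at the origin.\<close>

lemma plane_cone_cases:
  fixes x y :: int
  obtains m n where "m \<ge> 0" "n \<ge> 0"
    "(x, y) \<in> {(m, n), (- m, - n), (- m - n, m), (m + n, - m), (n, - m - n), (- n, m + n)}"
proof -
  consider "x \<ge> 0" "y \<ge> 0" | "x \<le> 0" "y \<le> 0" | "x \<le> 0" "y \<ge> 0" "x + y \<le> 0"
    | "x \<le> 0" "y \<ge> 0" "x + y \<ge> 0" | "x \<ge> 0" "y \<le> 0" "x + y \<le> 0" | "x \<ge> 0" "y \<le> 0" "x + y \<ge> 0"
    by linarith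
  then show thesis
  proof cases
    case 1 then show ?thesis by (intro that[of x y]) auto
  next
    case 2 then show ?thesis by (intro that[of "-x" "-y"]) auto
  next
    case 3 then show ?thesis by (intro that[of y "-x-y"]) auto
  next
    case 4 then show ?thesis by (intro that[of "x+y" "-x"]) auto
  next
    case 5 then show ?thesis by (intro that[of "-x-y" x]) auto
  next
    case 6 then show ?thesis by (intro that[of "-y" "x+y"]) auto
  qed
qed

context link_planes
begin

text \<open>First \<open>m\<close> steps along the edges, then \<open>n\<close> steps against them; no step undoes or can be merged with
the previous one.\<close>

definition straight_path :: "(nat \<Rightarrow> 'v) \<Rightarrow> nat \<Rightarrow> nat \<Rightarrow> bool" where
  "straight_path f m n \<longleftrightarrow>
     (\<forall>t<m. E (f t) (f (Suc t))) \<and> (\<forall>t. m \<le> t \<and> t < m + n \<longrightarrow> E (f (Suc t)) (f t)) \<and>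
     (\<forall>t. t + 2 \<le> m \<longrightarrow> \<not> E (f (t + 2)) (f t)) \<and>
     (\<forall>t. m \<le> t \<and> t + 2 \<le> m + n \<longrightarrow> \<not> E (f t) (f (t + 2))) \<and>
     (0 < m \<and> 0 < n \<longrightarrow> f (m - 1) \<noteq> f (m + 1))"

lemma flatD:
  assumes "flat a"
  shows "E (a (i, j)) (a (i + 1, j))" "E (a (i + 1, j)) (a (i, j + 1))" "E (a (i, j + 1)) (a (i, j))"
    "\<not> E (a (i + 2, j)) (a (i, j))" "\<not> E (a (i, j + 2)) (a (i + 2, j))"
    "\<not> E (a (i, j)) (a (i, j + 2))"
  using assms unfolding flat_def by auto

lemma flat_shift:
  assumes "flat a" shows "flat (\<lambda>(i, j). a (i + c, j + d))"
  unfolding flat_def prod.case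
proof (intro allI)
  fix i j :: int
  have e: "i + 1 + c = i + c + 1" "i + 2 + c = i + c + 2" "j + 1 + d = j + d + 1"
    "j + 2 + d = j + d + 2" by auto
  show "E (a (i + c, j + d)) (a (i + 1 + c, j + d)) \<and>
      E (a (i + 1 + c, j + d)) (a (i + c, j + 1 + d)) \<and> E (a (i + c, j + 1 + d)) (a (i + c, j + d)) \<and>
      \<not> E (a (i + 2 + c, j + d)) (a (i + c, j + d)) \<and>
      \<not> E (a (i + c, j + 2 + d)) (a (i + 2 + c, j + d)) \<and>
      \<not> E (a (i + c, j + d)) (a (i + c, j + 2 + d))"
    unfolding e using flatD[OF assms] by blast
qed

text \<open>The rotation of order three permutes the directions \<open>e\<^sub>0\<close>, \<open>e\<^sub>1\<close>, \<open>e\<^sub>2\<close> cyclically.\<close>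

lemma flat_rotate:
  assumes "flat a" shows "flat (\<lambda>(i, j). a (- i - j, i))"
  unfolding flat_def
proof (intro allI)
  fix i j :: int
  have e: "- i - j - 1 + 1 = - i - j" "- i - j - 2 + 2 = - i - j" "- (i + 1) - j = - i - j - 1" "- i - 1 - j = - i - j - 1" "- i - 2 - j = - i - j - 2"
    "- i - (j + 1) = - i - j - 1" "- (i + 2) - j = - i - j - 2" "- i - (j + 2) = - i - j - 2"
    by auto
  show "E ((\<lambda>(i, j). a (- i - j, i)) (i, j)) ((\<lambda>(i, j). a (- i - j, i)) (i + 1, j)) \<and>
     E ((\<lambda>(i, j). a (- i - j, i)) (i + 1, j)) ((\<lambda>(i, j). a (- i - j, i)) (i, j + 1)) \<and>
     E ((\<lambda>(i, j). a (- i - j, i)) (i, j + 1)) ((\<lambda>(i, j). a (- i - j, i)) (i, j)) \<and>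
     \<not> E ((\<lambda>(i, j). a (- i - j, i)) (i + 2, j)) ((\<lambda>(i, j). a (- i - j, i)) (i, j)) \<and>
     \<not> E ((\<lambda>(i, j). a (- i - j, i)) (i, j + 2)) ((\<lambda>(i, j). a (- i - j, i)) (i + 2, j)) \<and>
     \<not> E ((\<lambda>(i, j). a (- i - j, i)) (i, j)) ((\<lambda>(i, j). a (- i - j, i)) (i, j + 2))"
    using flatD(2)[OF assms, of "- i - j - 1" i] flatD(3)[OF assms, of "- i - j - 1" i]
      flatD(1)[OF assms, of "- i - j - 1" i] flatD(4)[OF assms, of "- i - j - 2" i]
      flatD(5)[OF assms, of "- i - j - 2" i] flatD(6)[OF assms, of "- i - j - 2" i]
    by (simp add: e)
qed

lemma flat_corner_ne:
  assumes "flat a" shows "a (i, j) \<noteq> a (i + 1, j + 1)"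
  using flatD(2)[OF assms, of "i + 1" j] flatD(4)[OF assms, of i j] by (auto simp: add.assoc)

lemma flat_straight_path:
  assumes "flat a"
  shows "straight_path (\<lambda>t. if t \<le> m then a (int t, 0) else a (int m, int (t - m))) m n"
  unfolding straight_path_def
proof (intro conjI allI impI)
  fix t assume "t + 2 \<le> m"
  then show "\<not> E (if t + 2 \<le> m then a (int (t + 2), 0) else a (int m, int (t + 2 - m)))
     (if t \<le> m then a (int t, 0) else a (int m, int (t - m)))"
    using flatD(4)[OF assms, of "int t" 0] by (simp add: add.commute)
next
  fix t assume t: "m \<le> t \<and> t + 2 \<le> m + n"
  then have "int (t + 2 - m) = int (t - m) + 2" by auto
  then show "\<not> E (if t \<le> m then a (int t, 0) else a (int m, int (t - m)))
     (if t + 2 \<le> m then a (int (t + 2), 0) else a (int m, int (t + 2 - m)))"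
    using flatD(6)[OF assms, of "int m" "int (t - m)"] t by (cases "t = m") (simp_all del: of_nat_diff)
next
  fix t assume t: "m \<le> t \<and> t < m + n"
  then have "int (Suc t - m) = int (t - m) + 1" by auto
  then show "E (if Suc t \<le> m then a (int (Suc t), 0) else a (int m, int (Suc t - m)))
     (if t \<le> m then a (int t, 0) else a (int m, int (t - m)))"
    using flatD(3)[OF assms, of "int m" "int (t - m)"] t by (cases "t = m") (simp_all del: of_nat_diff)
next
  fix t assume t: "t < m"
  then show "E (if t \<le> m then a (int t, 0) else a (int m, int (t - m)))
     (if Suc t \<le> m then a (int (Suc t), 0) else a (int m, int (Suc t - m)))"
    using flatD(1)[OF assms, of "int t" 0] by (auto simp: add.commute)
next
  assume "0 < m \<and> 0 < n"
  then show "(if m - 1 \<le> m then a (int (m - 1), 0) else a (int m, int (m - 1 - m))) \<noteq>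
     (if m + 1 \<le> m then a (int (m + 1), 0) else a (int m, int (m + 1 - m)))"
    using flat_corner_ne[OF assms, of "int m - 1" 0] by (auto simp: of_nat_diff)
qed

text \<open>Rows are filled from below and from the right.  In the plane at \<open>(i + 1, j)\<close> the vertices \<open>(i, j)\<close>
and \<open>(i + 1, j + 1)\<close> are two different lines, and \<open>(i, j + 1)\<close> is the point where they meet.\<close>

lemma parallelogram_fill:
  assumes "flat a" "flat b" "n \<ge> 0"
    and "\<And>i. 0 \<le> i \<Longrightarrow> i \<le> m \<Longrightarrow> a (i, 0) = b (i, 0)"
    and "\<And>j. 0 \<le> j \<Longrightarrow> j \<le> n \<Longrightarrow> a (m, j) = b (m, j)"
    and ij: "0 \<le> i" "i \<le> m" "0 \<le> j" "j \<le> n"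
  shows "a (i, j) = b (i, j)"
proof -
  have "\<forall>i. 0 \<le> i \<longrightarrow> i \<le> m \<longrightarrow> a (i, int j) = b (i, int j)" if "int j \<le> n" for j
    using that
  proof (induction j)
    case (Suc j)
    have row: "a (i, int j) = b (i, int j)" if "0 \<le> i" "i \<le> m" for i using Suc that by auto
    have "a (m - int k, int j + 1) = b (m - int k, int j + 1)" if "int k \<le> m" for k
      using that
    proof (induction k)
      case 0
      then show ?case using assms(5)[of "int j + 1"] Suc by simp
    next
      case (Suc k)
      define i where "i = m - int (Suc k)"
      have i: "0 \<le> i" "m - int k = i + 1" "i + 1 \<le> m" using Suc by (auto simp: i_def)
      have up: "a (i + 1, int j + 1) = b (i + 1, int j + 1)" using Suc i by simp
      have r: "a (i, int j) = b (i, int j)" "a (i + 1, int j) = b (i + 1, int j)" using row i by auto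
      have "E (a (i + 1, int j)) (a (i, int j + 1))" "E (a (i + 1, int j)) (b (i, int j + 1))"
        "E (a (i, int j)) (a (i + 1, int j))" "E (a (i + 1, int j + 1)) (a (i + 1, int j))"
        "E (a (i, int j + 1)) (a (i, int j))" "E (a (i, int j + 1)) (a (i + 1, int j + 1))"
        "E (b (i, int j + 1)) (a (i, int j))" "E (b (i, int j + 1)) (a (i + 1, int j + 1))"
        using flatD(1-3)[OF assms(1)] flatD(1-3)[OF assms(2)] r up by metis+
      from link_no_square[OF this] have "a (i, int j + 1) = b (i, int j + 1)"
        using flat_corner_ne[OF assms(1)] by blast
      then show ?case by (simp add: i_def)
    qed
    note left = this
    have "a (i, int j + 1) = b (i, int j + 1)" if i: "0 \<le> i" "i \<le> m" for i
    proof -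
      have "int (nat (m - i)) = m - i" using i by simp
      then show ?thesis using left[of "nat (m - i)"] i by (simp del: int_nat_eq)
    qed
    then show ?case by (simp add: add.commute)
  qed (use assms(4) in auto)
  from this[of "nat j"] ij show ?thesis by auto
qed

end

text \<open>The uniqueness of straight paths is the only global property; it takes the place of the simple
connectedness of the building.\<close>

locale triangle_graph = link_planes +
  assumes path_unique: "straight_path f m n \<Longrightarrow> straight_path f' m' n' \<Longrightarrow> f 0 = f' 0 \<Longrightarrow>
      f (m + n) = f' (m' + n') \<Longrightarrow> m = m' \<and> n = n' \<and> (\<forall>t\<le>m + n. f t = f' t)"
begin

text \<open>The lower and the right side of a parallelogram form a straight path, so they are determined by
the two corners; the interior follows by \<open>parallelogram_fill\<close>.\<close>

theorem parallelogram_unique: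
  assumes "flat a" "flat b" "a (0, 0) = b (0, 0)" "a (m, n) = b (m', n')"
    and nn: "0 \<le> m" "0 \<le> n" "0 \<le> m'" "0 \<le> n'"
  shows "m = m' \<and> n = n' \<and> (\<forall>i j. 0 \<le> i \<longrightarrow> i \<le> m \<longrightarrow> 0 \<le> j \<longrightarrow> j \<le> n \<longrightarrow> a (i, j) = b (i, j))"
proof -
  let ?f = "\<lambda>a m t. if t \<le> m then a (int t, 0) else a (int m, int (t - m))"
  have eq: "nat m = nat m' \<and> nat n = nat n' \<and> (\<forall>t\<le>nat m + nat n. ?f a (nat m) t = ?f b (nat m') t)"
    using flat_straight_path[OF assms(1), of "nat m" "nat n"]
      flat_straight_path[OF assms(2), of "nat m'" "nat n'"]
    by (rule path_unique) (use assms in auto)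
  then have mn: "m = m'" "n = n'" using nn by auto
  have "a (i, 0) = b (i, 0)" if "0 \<le> i" "i \<le> m" for i
    using conjunct2[OF conjunct2[OF eq], rule_format, of "nat i"] that nn mn
      nat_mono[OF that(2)] by auto
  moreover have "a (m, j) = b (m, j)" if "0 \<le> j" "j \<le> n" for j
    using conjunct2[OF conjunct2[OF eq], rule_format, of "nat (m + j)"] that nn mn
    by (cases "j = 0") (auto simp: nat_add_distrib)
  ultimately show ?thesis using mn parallelogram_fill[OF assms(1,2)] nn by blast
qed

lemma no_two_cycle: "E u v \<Longrightarrow> \<not> E v u"
proof
  assume "E u v" "E v u"
  let ?f = "\<lambda>t::nat. if t = 0 then u else v"
  have "straight_path ?f 1 0" "straight_path ?f 0 1"
    using \<open>E u v\<close> \<open>E v u\<close> by (auto simp: straight_path_def)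
  from path_unique[OF this] show False by simp
qed

lemma flat_displacement:
  assumes "flat a" "0 \<le> m" "0 \<le> n"
  shows "a (m, n) = a (0, 0) \<Longrightarrow> m = 0 \<and> n = 0"
    and "E (a (0, 0)) (a (m, n)) \<Longrightarrow> m = 1 \<and> n = 0"
    and "E (a (m, n)) (a (0, 0)) \<Longrightarrow> m = 0 \<and> n = 1"
proof -
  let ?g = "\<lambda>t. if t \<le> nat m then a (int t, 0) else a (int (nat m), int (t - nat m))"
  let ?f = "\<lambda>t::nat. if t = 0 then a (0, 0) else a (m, n)"
  have g: "straight_path ?g (nat m) (nat n)" by (rule flat_straight_path[OF assms(1)])
  have ends: "?g 0 = a (0, 0)" "?g (nat m + nat n) = a (m, n)" using assms(2,3) by auto
  have f_unique: "nat m = m' \<and> nat n = n'"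
    if "straight_path f m' n'" "f 0 = a (0, 0)" "f (m' + n') = a (m, n)" for f m' n'
    using path_unique[OF g that(1) HOL.trans[OF ends(1) that(2)[symmetric]]
        HOL.trans[OF ends(2) that(3)[symmetric]]] by blast
  show "m = 0 \<and> n = 0" if "a (m, n) = a (0, 0)"
    using parallelogram_unique[OF assms(1,1) HOL.refl that] assms by simp
  show "m = 1 \<and> n = 0" if "E (a (0, 0)) (a (m, n))"
  proof -
    have f: "straight_path ?f 1 0" using that by (simp add: straight_path_def)
    have "nat m = 1 \<and> nat n = 0"
      by (rule f_unique[OF f]) simp_all
    then show ?thesis using assms(2,3) by linarith
  qed
  show "m = 0 \<and> n = 1" if "E (a (m, n)) (a (0, 0))"
  proof -
    have f: "straight_path ?f 0 1" using that by (simp add: straight_path_def)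
    have "nat m = 0 \<and> nat n = 1"
      by (rule f_unique[OF f]) simp_all
    then show ?thesis using assms(2,3) by linarith
  qed
qed

text \<open>Reduction of statements on two vertices of a flat to the first quadrant: after a rotation,
and an exchange of the two vertices in half of the cases, the second vertex lies in the quadrant
based at the first one.  The last three conditions of each case recover from \<open>(m, n)\<close> the original
displacement when the vertices are equal or adjacent.\<close>

lemma flat_cone_cases:
  fixes a x y
  assumes "flat a"
  obtains b m n where "flat b" "0 \<le> m" "0 \<le> n"
    "b (0, 0) = a (0, 0)" "b (m, n) = a (x, y)"
    "(m, n) = (0, 0) \<longrightarrow> (x, y) = (0, 0)"
    "(m, n) = (1, 0) \<longrightarrow> (x, y) \<in> {(1, 0), (-1, 1), (0, -1)}"
    "(m, n) = (0, 1) \<longrightarrow> (x, y) \<in> {(-1, 0), (1, -1), (0, 1)}"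
  | b m n where "flat b" "0 \<le> m" "0 \<le> n"
    "b (0, 0) = a (x, y)" "b (m, n) = a (0, 0)"
    "(m, n) = (0, 0) \<longrightarrow> (x, y) = (0, 0)"
    "(m, n) = (1, 0) \<longrightarrow> (x, y) \<in> {(-1, 0), (1, -1), (0, 1)}"
    "(m, n) = (0, 1) \<longrightarrow> (x, y) \<in> {(1, 0), (-1, 1), (0, -1)}"
proof -
  let ?r = "\<lambda>a::int \<times> int \<Rightarrow> 'a. \<lambda>(i, j). a (- i - j, i)"
  let ?s = "\<lambda>(i, j). a (i + x, j + y)"
  have r1: "flat (?r a)" using flat_rotate[OF assms] .
  have r2: "flat (?r (?r a))" using flat_rotate[OF r1] .
  have s0: "flat ?s" using flat_shift[OF assms] .
  have s1: "flat (?r ?s)" using flat_rotate[OF s0] .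
  have s2: "flat (?r (?r ?s))" using flat_rotate[OF s1] .
  obtain m n where mn: "m \<ge> 0" "n \<ge> 0"
    "(x, y) \<in> {(m, n), (- m, - n), (- m - n, m), (m + n, - m), (n, - m - n), (- n, m + n)}"
    using plane_cone_cases by blast
  then consider "(x, y) = (m, n)" | "(x, y) = (- m, - n)" | "(x, y) = (- m - n, m)"
    | "(x, y) = (m + n, - m)" | "(x, y) = (n, - m - n)" | "(x, y) = (- n, m + n)" by auto
  then show thesis
  proof cases
    case 1 then show ?thesis using assms mn by (intro that(1)[of a m n]) auto
  next
    case 2 then show ?thesis using s0 mn by (intro that(2)[of ?s m n]) auto
  next
    case 3 then show ?thesis using r1 mn by (intro that(1)[of "?r a" m n]) auto
  next
    case 4 then show ?thesis using s1 mn by (intro that(2)[of "?r ?s" m n]) auto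
  next
    case 5 then show ?thesis using r2 mn by (intro that(1)[of "?r (?r a)" m n]) auto
  next
    case 6 then show ?thesis using s2 mn by (intro that(2)[of "?r (?r ?s)" m n]) auto
  qed
qed

lemma flat_from_origin:
  assumes "flat a"
  shows "a (x, y) = a (0, 0) \<Longrightarrow> (x, y) = (0, 0)"
    and "E (a (0, 0)) (a (x, y)) \<Longrightarrow> (x, y) \<in> {(1, 0), (-1, 1), (0, -1)}"
proof -
  show "(x, y) = (0, 0)" if eq: "a (x, y) = a (0, 0)"
    using assms
  proof (rule flat_cone_cases[of a x y], goal_cases)
    case (1 b m n)
    have "b (m, n) = b (0, 0)" using 1(4,5) eq by simp
    from flat_displacement(1)[OF 1(1-3) this] show ?thesis using 1(6) by (elim conjE) (simp only: simp_thms)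
  next
    case (2 b m n)
    have "b (m, n) = b (0, 0)" using 2(4,5) eq by simp
    from flat_displacement(1)[OF 2(1-3) this] show ?thesis using 2(6) by (elim conjE) (simp only: simp_thms)
  qed
  show "(x, y) \<in> {(1, 0), (-1, 1), (0, -1)}" if e: "E (a (0, 0)) (a (x, y))"
    using assms
  proof (rule flat_cone_cases[of a x y], goal_cases)
    case (1 b m n)
    have "E (b (0, 0)) (b (m, n))" using 1(4,5) e by simp
    from flat_displacement(2)[OF 1(1-3) this] show ?thesis using 1(7) by (elim conjE) (simp only: simp_thms)
  next
    case (2 b m n)
    have "E (b (m, n)) (b (0, 0))" using 2(4,5) e by simp
    from flat_displacement(3)[OF 2(1-3) this] show ?thesis using 2(8) by (elim conjE) (simp only: simp_thms)
  qed
qed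

lemma flat_inj:
  assumes "flat a" shows "inj a"
proof (rule injI)
  fix p q assume "a p = a q"
  then show "p = q"
    using flat_from_origin(1)[OF flat_shift[OF assms, of "fst p" "snd p"], of "fst q - fst p" "snd q - snd p"]
    by (auto simp: prod_eq_iff)
qed

lemma flat_edge_direction:
  assumes "flat a" "E (a (i, j)) (a (k, l))"
  shows "(k, l) \<in> {(i + 1, j), (i - 1, j + 1), (i, j - 1)}"
  using flat_from_origin(2)[OF flat_shift[OF assms(1), of i j], of "k - i" "l - j"] assms(2) by auto

end

section \<open>Sectors based at neighbouring vertices\<close>

lemma constant_step:
  fixes x y :: "nat \<Rightarrow> int"
  assumes "\<And>n. x (Suc n) = x n + c" "\<And>n. y (Suc n) = y n + d"
  shows "x n = x 0 + int n * c \<and> y n = y 0 + int n * d"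
  by (induction n) (simp_all add: assms algebra_simps)

text \<open>Steps along the edges of a flat for \<open>\<epsilon> = 1\<close>, steps against them for \<open>\<epsilon> = - 1\<close>.\<close>

definition unit_step :: "int \<Rightarrow> int \<times> int \<Rightarrow> int \<times> int \<Rightarrow> bool" where
  "unit_step \<epsilon> = (\<lambda>(x, y) q. q \<in> {(x + \<epsilon>, y), (x - \<epsilon>, y + \<epsilon>), (x, y - \<epsilon>)})"

lemma unit_step_reverse: "unit_step (- 1) p q \<longleftrightarrow> unit_step 1 q p"
  by (cases p; cases q) (auto simp: unit_step_def)

text \<open>The sum of two different unit steps is the negative of the third, which \<open>no_turn\<close> excludes; so all
steps are equal.  Of the three possible steps only one keeps both coordinates nonnegative for ever.\<close>

lemma straight_steps:
  fixes x y :: "nat \<Rightarrow> int" and \<epsilon> :: int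
  assumes step: "\<And>n. unit_step \<epsilon> (x n, y n) (x (Suc n), y (Suc n))"
    and no_turn: "\<And>n. \<not> unit_step \<epsilon> (x (Suc (Suc n)), y (Suc (Suc n))) (x n, y n)"
    and pos: "\<And>n. 0 \<le> x n" "\<And>n. 0 \<le> y n" and "\<epsilon> = 1 \<or> \<epsilon> = - 1"
  shows "if \<epsilon> = 1 then \<forall>n. x n = x 0 + int n \<and> y n = y 0 else \<forall>n. x n = x 0 \<and> y n = y 0 + int n"
proof -
  have turn: "u' = u \<and> v' = v"
    if "(u, v) \<in> {(\<epsilon>, 0), (- \<epsilon>, \<epsilon>), (0, - \<epsilon>)}" "(u', v') \<in> {(\<epsilon>, 0), (- \<epsilon>, \<epsilon>), (0, - \<epsilon>)}"
      "(u + u', v + v') \<notin> {(- \<epsilon>, 0), (\<epsilon>, - \<epsilon>), (0, \<epsilon>)}" for u v u' v'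
    using assms(5) that by (elim disjE) auto
  have nonneg_dir: "(u, v) = (if \<epsilon> = 1 then (1, 0) else (0, 1))"
    if "(u, v) \<in> {(\<epsilon>, 0), (- \<epsilon>, \<epsilon>), (0, - \<epsilon>)}" "0 \<le> u" "0 \<le> v" "\<epsilon> = 1 \<or> \<epsilon> = - 1" for u v
    using that by auto
  define dx where "dx n = x (Suc n) - x n" for n
  define dy where "dy n = y (Suc n) - y n" for n
  have d: "(dx n, dy n) \<in> {(\<epsilon>, 0), (- \<epsilon>, \<epsilon>), (0, - \<epsilon>)}" for n
    using step[of n] by (auto simp: unit_step_def dx_def dy_def)
  have nt: "(dx n + dx (Suc n), dy n + dy (Suc n)) \<notin> {(- \<epsilon>, 0), (\<epsilon>, - \<epsilon>), (0, \<epsilon>)}" for n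
    using no_turn[of n] unfolding dx_def dy_def unit_step_def by (auto simp: algebra_simps)
  have "dx (Suc n) = dx n \<and> dy (Suc n) = dy n" for n
    by (rule turn[OF d d nt])
  then have c: "dx n = dx 0 \<and> dy n = dy 0" for n by (induction n) auto
  have xy: "x n = x 0 + int n * dx 0 \<and> y n = y 0 + int n * dy 0" for n
  proof (rule constant_step)
    fix n
    show "x (Suc n) = x n + dx 0" "y (Suc n) = y n + dy 0"
      using c[of n] by (auto simp: dx_def dy_def)
  qed
  have "0 \<le> dx 0"
  proof (rule ccontr)
    assume "\<not> 0 \<le> dx 0"
    then have "dx 0 = - 1" using d[of 0] assms(5) by auto
    then show False using xy[of "nat (x 0) + 1"] pos(1)[of "nat (x 0) + 1"] pos(1)[of 0] by simp
  qed
  moreover have "0 \<le> dy 0"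
  proof (rule ccontr)
    assume "\<not> 0 \<le> dy 0"
    then have "dy 0 = - 1" using d[of 0] assms(5) by auto
    then show False using xy[of "nat (y 0) + 1"] pos(2)[of "nat (y 0) + 1"] pos(2)[of 0] by simp
  qed
  ultimately have dir: "(dx 0, dy 0) = (if \<epsilon> = 1 then (1, 0) else (0, 1))"
    by (rule nonneg_dir[OF d _ _ assms(5)])
  show ?thesis
  proof (cases "\<epsilon> = 1")
    case True
    then have "x n = x 0 + int n \<and> y n = y 0" for n using xy[of n] dir by simp
    then show ?thesis unfolding if_P[OF True] by blast
  next
    case False
    then have "x n = x 0 \<and> y n = y 0 + int n" for n using xy[of n] dir by simp
    then show ?thesis unfolding if_not_P[OF False] by blast
  qed
qed

context triangle_graph
begin

lemma flat_edge_iff: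
  assumes "flat a"
  shows "E (a (i, j)) (a (k, l)) \<longleftrightarrow> (k, l) \<in> {(i + 1, j), (i - 1, j + 1), (i, j - 1)}"
proof
  assume "(k, l) \<in> {(i + 1, j), (i - 1, j + 1), (i, j - 1)}"
  then show "E (a (i, j)) (a (k, l))"
    using flatD(1)[OF assms, of i j] flatD(2)[OF assms, of "i - 1" j] flatD(3)[OF assms, of i "j - 1"]
    by auto
qed (rule flat_edge_direction[OF assms])

text \<open>Seen in the coordinates of \<open>a\<close>, each row of \<open>e\<close> is a straight walk along the edges inside the first
quadrant and each column is one against the edges, so \<open>straight_steps\<close> gives their directions.\<close>

theorem subsector_translate:
  assumes "flat a" "flat e"
    and sub: "\<And>i j. 0 \<le> i \<Longrightarrow> 0 \<le> j \<Longrightarrow> \<exists>k l. 0 \<le> k \<and> 0 \<le> l \<and> e (i, j) = a (k, l)"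
  obtains c d where "0 \<le> c" "0 \<le> d" "\<And>i j. 0 \<le> i \<Longrightarrow> 0 \<le> j \<Longrightarrow> e (i, j) = a (i + c, j + d)"
proof -
  have "\<exists>k l. \<forall>i j. 0 \<le> i \<longrightarrow> 0 \<le> j \<longrightarrow> 0 \<le> k i j \<and> 0 \<le> l i j \<and> e (i, j) = a (k i j, l i j)"
    using sub by metis
  then obtain x y where xy:
    "\<And>i j. 0 \<le> i \<Longrightarrow> 0 \<le> j \<Longrightarrow> 0 \<le> x i j \<and> 0 \<le> y i j \<and> e (i, j) = a (x i j, y i j)"
    by blast
  have edge: "E (e (i, j)) (e (k, l)) \<longleftrightarrow> unit_step 1 (x i j, y i j) (x k l, y k l)"
    if "0 \<le> i" "0 \<le> j" "0 \<le> k" "0 \<le> l" for i j k l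
    unfolding unit_step_def prod.case flat_edge_iff[OF assms(1), symmetric]
    using xy[OF that(1,2)] xy[OF that(3,4)] by simp
  have row: "x i j = x 0 j + i \<and> y i j = y 0 j" if "0 \<le> i" "0 \<le> j" for i j
  proof -
    have "if 1 = (1::int) then \<forall>n. x (int n) j = x (int 0) j + int n \<and> y (int n) j = y (int 0) j
      else \<forall>n. x (int n) j = x (int 0) j \<and> y (int n) j = y (int 0) j + int n"
    proof (rule straight_steps)
      fix n
      have "E (e (int n, j)) (e (int (Suc n), j))"
        using flatD(1)[OF assms(2), of "int n" j] by (simp add: add.commute)
      then show "unit_step 1 (x (int n) j, y (int n) j) (x (int (Suc n)) j, y (int (Suc n)) j)"
        using edge that by simp
      have "\<not> E (e (int (Suc (Suc n)), j)) (e (int n, j))"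
        using flatD(4)[OF assms(2), of "int n" j] by (simp add: add.commute)
      then show "\<not> unit_step 1 (x (int (Suc (Suc n))) j, y (int (Suc (Suc n))) j) (x (int n) j, y (int n) j)"
        using edge that by simp
    qed (use xy that in auto)
    then have "x (int (nat i)) j = x 0 j + int (nat i) \<and> y (int (nat i)) j = y 0 j"
      by (metis of_nat_0)
    then show ?thesis using that by simp
  qed
  have col: "x 0 j = x 0 0 \<and> y 0 j = y 0 0 + j" if "0 \<le> j" for j
  proof -
    have "if - 1 = (1::int) then \<forall>n. x 0 (int n) = x 0 (int 0) + int n \<and> y 0 (int n) = y 0 (int 0)
      else \<forall>n. x 0 (int n) = x 0 (int 0) \<and> y 0 (int n) = y 0 (int 0) + int n"
    proof (rule straight_steps)
      fix n
      have "E (e (0, int (Suc n))) (e (0, int n))"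
        using flatD(3)[OF assms(2), of 0 "int n"] by (simp add: add.commute)
      then show "unit_step (- 1) (x 0 (int n), y 0 (int n)) (x 0 (int (Suc n)), y 0 (int (Suc n)))"
        using edge unit_step_reverse by simp
      have "\<not> E (e (0, int n)) (e (0, int (Suc (Suc n))))"
        using flatD(6)[OF assms(2), of 0 "int n"] by (simp add: add.commute)
      then show "\<not> unit_step (- 1) (x 0 (int (Suc (Suc n))), y 0 (int (Suc (Suc n)))) (x 0 (int n), y 0 (int n))"
        using edge unit_step_reverse by simp
    qed (use xy that in auto)
    then have "x 0 (int (nat j)) = x 0 0 \<and> y 0 (int (nat j)) = y 0 0 + int (nat j)"
      by (metis of_nat_0 one_neq_neg_one)
    then show ?thesis using that by simp
  qed
  show thesis
  proof (rule that)
    show "0 \<le> x 0 0" "0 \<le> y 0 0" using xy by auto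
    fix i j :: int assume "0 \<le> i" "0 \<le> j"
    then show "e (i, j) = a (i + x 0 0, j + y 0 0)"
      using xy[of i j] row[of i j] col[of j] by (auto simp: add.commute)
  qed
qed

lemma diagonal_unique:
  assumes "flat a" "flat b" "\<And>k. 0 \<le> k \<Longrightarrow> a (k, k) = b (k, k)" "0 \<le> i" "0 \<le> j"
  shows "a (i, j) = b (i, j)"
  using parallelogram_unique[OF assms(1,2) assms(3)[of 0] assms(3)[of "max i j"], THEN conjunct2,
      THEN conjunct2, rule_format, of i j] assms(4,5) by auto

lemma gallery_of_flat:
  assumes "flat a"
  shows "gallery_at (\<lambda>k. a (k + x, k + y)) (\<lambda>k. a (k + x + 1, k + y)) (\<lambda>k. a (k + x, k + y + 1)) k"
proof -
  have e: "k + 1 + x = k + x + 1" "k + 1 + y = k + y + 1" "k + x + 1 + 1 = k + x + 2"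
    "k + y + 1 + 1 = k + y + 2" by auto
  show ?thesis
    unfolding gallery_at_def e using flatD[OF assms] flat_corner_ne[OF assms] by blast
qed

end

locale thick_triangle_graph = triangle_graph +
  assumes opposite: "E v p \<Longrightarrow> E p l \<Longrightarrow> E l v \<Longrightarrow>
      \<exists>p' l'. E v p' \<and> E p' l' \<and> E l' v \<and> \<not> E p l' \<and> \<not> E p' l"
    and thick: "E u v \<Longrightarrow> \<exists>w'. w' \<noteq> w \<and> E v w' \<and> E w' u"
begin

text \<open>Sectors provide only the half \<open>k \<ge> 0\<close> of a gallery, while a flat is built from a gallery indexed
by all integers.  The other half may be any choice of opposite flags and of further chambers.\<close>

lemma gallery_extend:
  assumes gal: "\<And>k. 0 \<le> k \<Longrightarrow> gallery_at g p l k"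
  obtains g' p' l' where "\<And>k. gallery_at g' p' l' k"
    "\<And>k. 0 \<le> k \<Longrightarrow> g' k = g k \<and> p' k = p k \<and> l' k = l k"
proof -
  define Q where "Q = (\<lambda>_::nat. \<lambda>(g, p, l) (g', p', l'). E l' g \<and> E g p' \<and> g' \<noteq> g \<and> \<not> E p l' \<and> \<not> E p' l)"
  define R where "R = (\<lambda>n (g', p', l'). E g' p' \<and> E p' l' \<and> E l' g' \<and>
      (n = (0::nat) \<longrightarrow> g' = g 0 \<and> p' = p 0 \<and> l' = l 0))"
  have "\<exists>F. \<forall>n. R n (F n) \<and> Q n (F n) (F (Suc n))"
  proof (rule dependent_nat_choice)
    show "\<exists>x. R 0 x" using gal[of 0] by (auto simp: R_def gallery_at_def)
    fix x n assume "R n x"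
    then obtain v p l where x: "x = (v, p, l)" "E v p" "E p l" "E l v"
      by (cases x) (auto simp: R_def)
    then obtain p' l' where p': "E v p'" "E p' l'" "E l' v" "\<not> E p l'" "\<not> E p' l"
      using opposite by blast
    obtain w where "w \<noteq> v" "E l' w" "E w p'" using thick[OF p'(2)] by blast
    then have "R (Suc n) (w, p', l') \<and> Q n x (w, p', l')" using x p' by (simp add: R_def Q_def)
    then show "\<exists>y. R (Suc n) y \<and> Q n x y" by blast
  qed
  then obtain F where F: "\<And>n. R n (F n)" "\<And>n. Q n (F n) (F (Suc n))" by blast
  define g' where "g' k = (if 0 \<le> k then g k else fst (F (nat (- k))))" for k
  define p' where "p' k = (if 0 \<le> k then p k else fst (snd (F (nat (- k)))))" for k
  define l' where "l' k = (if 0 \<le> k then l k else snd (snd (F (nat (- k)))))" for k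
  have F0: "F 0 = (g 0, p 0, l 0)" using F(1)[of 0] by (cases "F 0") (auto simp: R_def)
  have neg: "F (nat (- k)) = (g' k, p' k, l' k)" if "k \<le> 0" for k
    using that F0 by (cases "k = 0") (auto simp: g'_def p'_def l'_def)
  show thesis
  proof
    fix k :: int
    show "gallery_at g' p' l' k"
    proof (cases "0 \<le> k")
      case True
      then show ?thesis using gal[of k] by (simp add: gallery_at_def g'_def p'_def l'_def)
    next
      case False
      then have "nat (- k) = Suc (nat (- (k + 1)))" by simp
      then show ?thesis
        using F(1)[of "nat (- k)"] F(2)[of "nat (- (k + 1))"] neg[of k] neg[of "k + 1"] False
        by (simp add: gallery_at_def R_def Q_def)
    qed
  qed (auto simp: g'_def p'_def l'_def)
qed

lemma flat_of_half_gallery: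
  assumes "\<And>k. 0 \<le> k \<Longrightarrow> gallery_at g p l k"
  shows "\<exists>f. flat f \<and> (\<forall>k\<ge>0. f (k, k) = g k \<and> f (k + 1, k) = p k \<and> f (k, k + 1) = l k)"
proof -
  obtain g' p' l' where g': "\<And>k. gallery_at g' p' l' k"
    "\<And>k. 0 \<le> k \<Longrightarrow> g' k = g k \<and> p' k = p k \<and> l' k = l k"
    using gallery_extend[OF assms] by blast
  then obtain f where "flat f" "\<forall>k. f (k, k) = g' k \<and> f (k + 1, k) = p' k \<and> f (k, k + 1) = l' k"
    using flat_of_gallery by blast
  then show ?thesis using g' by auto
qed

text \<open>A new column is attached to the left of the quadrant of \<open>a\<close>, in which \<open>v\<close> has the coordinates
\<open>(- 1, 1)\<close> with respect to \<open>a\<close>.  The gallery of the new flat is the shifted diagonal of \<open>a\<close>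
preceded by a single new diamond, whose fourth vertex \<open>n\<close> is the point at \<open>a (0, 1)\<close> where the lines
\<open>v\<close> and \<open>a (0, 2)\<close> meet.\<close>

lemma neighbour_sector_column:
  assumes a: "flat a" and v: "E (a (0, 0)) v" "E v (a (0, 1))" "v \<noteq> a (1, 0)"
  shows "\<exists>b. flat b \<and> b (0, 0) = v \<and> (\<forall>i\<ge>0. \<forall>j\<ge>0. b (i + 1, j) = a (i, j + 1))"
proof -
  note A = flatD[OF a]
  have e: "E (a (0, 2)) (a (0, 1))" "\<not> E (a (0, 0)) (a (0, 2))" using A(3)[of 0 1] A(6)[of 0 0] by auto
  then obtain n where n: "E (a (0, 1)) n" "E n v" "E n (a (0, 2))"
    using meet[OF v(2) e(1)] v by metis
  let ?g = "\<lambda>k::int. if k = 0 then v else a (k + - 1, k + 1)"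
  let ?p = "\<lambda>k. a (k + - 1 + 1, k + 1)"
  let ?l = "\<lambda>k::int. if k = 0 then n else a (k + - 1, k + 1 + 1)"
  have "gallery_at ?g ?p ?l k" if "0 \<le> k" for k
  proof (cases "k = 0")
    case False
    then show ?thesis using gallery_of_flat[OF a, of "- 1" 1 k] that by (simp add: gallery_at_def)
  next
    case True
    have "\<not> E (a (1, 2)) n"
    proof
      assume "E (a (1, 2)) n"
      moreover have "E (a (0, 2)) (a (1, 2))" "E (a (1, 1)) (a (0, 2))" "E (a (0, 1)) (a (1, 1))"
        "E (a (1, 2)) (a (1, 1))"
        using A(1)[of 0 2] A(2)[of 0 1] A(1)[of 0 1] A(3)[of 1 1] by auto
      moreover have "a (1, 2) \<noteq> a (0, 1)" using flat_inj[OF a] by (auto dest: injD)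
      ultimately have "n = a (1, 1)" using link_no_square[of "a (0, 2)" "a (0, 1)" "a (1, 2)" n "a (1, 1)"] n e
        by metis
      then have "E (a (1, 1)) v" using n by simp
      moreover have "E (a (1, 1)) (a (1, 0))" "E (a (1, 0)) (a (0, 1))" "E (a (0, 1)) (a (0, 0))"
        "E (a (0, 0)) (a (1, 0))"
        using A(3)[of 1 0] A(2)[of 0 0] A(3)[of 0 0] A(1)[of 0 0] by auto
      ultimately have "a (1, 1) = a (0, 0)"
        using link_no_square[of "a (0, 1)" "a (1, 1)" "a (0, 0)" v "a (1, 0)"] v \<open>E (a (0, 1)) (a (1, 1))\<close>
        by metis
      then show False using flat_inj[OF a] by (auto dest: injD)
    qed
    moreover have "\<not> E (a (0, 1)) (a (0, 3))" using A(6)[of 0 1] by simp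
    ultimately show ?thesis using n v e True by (auto simp: gallery_at_def)
  qed
  from flat_of_half_gallery[OF this]
  obtain f where f: "flat f" "\<And>k. 0 \<le> k \<Longrightarrow> f (k, k) = ?g k" "\<And>k. 0 \<le> k \<Longrightarrow> f (k + 1, k) = ?p k"
      "\<And>k. 0 \<le> k \<Longrightarrow> f (k, k + 1) = ?l k"
    by blast
  show ?thesis
  proof (intro exI[of _ f] conjI allI impI f(1))
    show "f (0, 0) = v" using f(2)[of 0] by simp
    fix i j :: int assume "0 \<le> i" "0 \<le> j"
    then show "f (i + 1, j) = a (i, j + 1)"
      using diagonal_unique[OF flat_shift[OF f(1), of 1 0] flat_shift[OF a, of 0 1], of i j] f(3) by simp
  qed
qed

text \<open>Here a new row is attached below the quadrant of \<open>a\<close>, and \<open>v\<close> has the coordinates \<open>(0, - 1)\<close> with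
respect to \<open>a\<close>.  The new diamond at the beginning of the diagonal has as its fourth vertex the line
\<open>m\<close> at \<open>a (0, 0)\<close> that joins the points \<open>v\<close> and \<open>a (1, 0)\<close>.\<close>

lemma neighbour_sector_row:
  assumes a: "flat a" and v: "E (a (0, 0)) v" "\<not> E v (a (0, 1))"
  shows "\<exists>b. flat b \<and> b (0, 0) = v \<and> (\<forall>i\<ge>0. \<forall>j\<ge>0. b (i, j + 1) = a (i, j))"
proof -
  note A = flatD[OF a]
  have e: "E (a (0, 0)) (a (1, 0))" "E (a (1, 0)) (a (0, 1))" "E (a (0, 1)) (a (0, 0))"
    using A(1-3)[of 0 0] by auto
  then obtain m where m: "E m (a (0, 0))" "E v m" "E (a (1, 0)) m"
    using join[OF v(1) e(1)] v by metis
  let ?g = "\<lambda>k::int. if k = 0 then v else a (k + 0, k + - 1)"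
  let ?p = "\<lambda>k. if k = 0 then m else a (k + 0 + 1, k + - 1)"
  let ?l = "\<lambda>k::int. a (k + 0, k + - 1 + 1)"
  have "gallery_at ?g ?p ?l k" if "0 \<le> k" for k
  proof (cases "k = 0")
    case False
    then show ?thesis using gallery_of_flat[OF a, of 0 "- 1" k] that by (simp add: gallery_at_def)
  next
    case True
    have "\<not> E m (a (1, 1))"
    proof
      assume "E m (a (1, 1))"
      moreover have "E (a (1, 1)) (a (1, 0))" "E (a (0, 1)) (a (1, 1))"
        using A(3)[of 1 0] A(1)[of 0 1] by auto
      moreover have "a (1, 1) \<noteq> a (0, 0)" using flat_inj[OF a] by (auto dest: injD)
      ultimately have "m = a (0, 1)"
        using link_no_square[of "a (1, 0)" m "a (0, 1)" "a (0, 0)" "a (1, 1)"] m e by metis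
      then show False using m v by simp
    qed
    moreover have "\<not> E (a (2, 0)) (a (0, 0))" using A(4)[of 0 0] by simp
    ultimately show ?thesis using m v e True by (auto simp: gallery_at_def)
  qed
  from flat_of_half_gallery[OF this]
  obtain f where f: "flat f" "\<And>k. 0 \<le> k \<Longrightarrow> f (k, k) = ?g k" "\<And>k. 0 \<le> k \<Longrightarrow> f (k + 1, k) = ?p k"
      "\<And>k. 0 \<le> k \<Longrightarrow> f (k, k + 1) = ?l k"
    by blast
  show ?thesis
  proof (intro exI[of _ f] conjI allI impI f(1))
    show "f (0, 0) = v" using f(2)[of 0] by simp
    fix i j :: int assume "0 \<le> i" "0 \<le> j"
    then show "f (i, j + 1) = a (i, j)"
      using diagonal_unique[OF flat_shift[OF f(1), of 0 1] a, of i j] f(4) by simp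
  qed
qed

text \<open>There are three positions of the point \<open>v\<close> with respect to the flag \<open>a (1, 0), a (0, 1)\<close> of the base
chamber: equal to the point, another point on the line, or not on the line.\<close>

lemma neighbour_sector:
  assumes a: "flat a" and v: "E (a (0, 0)) v"
  shows "\<exists>b c d. flat b \<and> b (0, 0) = v \<and> \<bar>c\<bar> \<le> 1 \<and> \<bar>d\<bar> \<le> 1 \<and>
    (\<forall>i\<ge>1. \<forall>j\<ge>1. b (i + c, j + d) = a (i, j))"
proof (cases "v = a (1, 0)")
  case True
  then show ?thesis using flat_shift[OF a, of 1 0]
    by (intro exI[of _ "\<lambda>(i, j). a (i + 1, j + 0)"] exI[of _ "- 1"] exI[of _ 0]) auto
next
  case False
  show ?thesis
  proof (cases "E v (a (0, 1))")
    case True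
    from neighbour_sector_column[OF a v this False] obtain b where b: "flat b" "b (0, 0) = v"
      "\<And>i j. 0 \<le> i \<Longrightarrow> 0 \<le> j \<Longrightarrow> b (i + 1, j) = a (i, j + 1)"
      by blast
    have "b (i + 1, j + - 1) = a (i, j)" if "1 \<le> i" "1 \<le> j" for i j using b(3)[of i "j - 1"] that by simp
    then show ?thesis using b by (intro exI[of _ b] exI[of _ 1] exI[of _ "- 1"]) auto
  next
    case False
    from neighbour_sector_row[OF a v this] obtain b where b: "flat b" "b (0, 0) = v"
      "\<And>i j. 0 \<le> i \<Longrightarrow> 0 \<le> j \<Longrightarrow> b (i, j + 1) = a (i, j)"
      by blast
    then show ?thesis by (intro exI[of _ b] exI[of _ 0] exI[of _ 1]) auto
  qed
qed

text \<open>The bound \<open>N\<close> does not depend on the flat.  This uniformity makes the change of the base vertex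
continuous in the boundary point.\<close>

theorem sector_change_base:
  assumes "E\<^sup>*\<^sup>* v v'"
  shows "\<exists>N\<ge>0. \<forall>a. flat a \<longrightarrow> a (0, 0) = v \<longrightarrow> (\<exists>b c d. flat b \<and> b (0, 0) = v' \<and> \<bar>c\<bar> \<le> N \<and> \<bar>d\<bar> \<le> N \<and>
     (\<forall>i j. N \<le> i \<longrightarrow> N \<le> j \<longrightarrow> b (i + c, j + d) = a (i, j)))"
  using assms
proof (induction rule: rtranclp_induct)
  case base
  show ?case by (intro exI[of _ "0::int"]) (auto intro!: exI[of _ "0::int"])
next
  case (step y z)
  then obtain N :: int where N: "0 \<le> N" "\<And>a. flat a \<Longrightarrow> a (0, 0) = v \<Longrightarrow> \<exists>b c d. flat b \<and> b (0, 0) = y \<and>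
      \<bar>c\<bar> \<le> N \<and> \<bar>d\<bar> \<le> N \<and> (\<forall>i j. N \<le> i \<longrightarrow> N \<le> j \<longrightarrow> b (i + c, j + d) = a (i, j))"
    by blast
  show ?case
  proof (intro exI[of _ "2 * N + 1"] conjI allI impI)
    fix a assume "flat a" "a (0, 0) = v"
    from N(2)[OF this] obtain b c d where b: "flat b" "b (0, 0) = y" "\<bar>c\<bar> \<le> N" "\<bar>d\<bar> \<le> N"
      "\<And>i j. N \<le> i \<Longrightarrow> N \<le> j \<Longrightarrow> b (i + c, j + d) = a (i, j)" by blast
    have "E (b (0, 0)) z" using b step by simp
    from neighbour_sector[OF b(1) this] obtain b' c' d' where b': "flat b'" "b' (0, 0) = z" "\<bar>c'\<bar> \<le> 1" "\<bar>d'\<bar> \<le> 1"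
      "\<And>i j. 1 \<le> i \<Longrightarrow> 1 \<le> j \<Longrightarrow> b' (i + c', j + d') = b (i, j)"
      by blast
    have "b' (i + (c + c'), j + (d + d')) = a (i, j)" if "2 * N + 1 \<le> i" "2 * N + 1 \<le> j" for i j
    proof -
      have "N \<le> i" "N \<le> j" using that \<open>0 \<le> N\<close> by auto
      moreover have "1 \<le> i + c" "1 \<le> j + d" using that b(3,4) by auto
      ultimately show ?thesis using b(5)[of i j] b'(5)[of "i + c" "j + d"] by (simp add: add.assoc)
    qed
    moreover have "\<bar>c + c'\<bar> \<le> 2 * N + 1" "\<bar>d + d'\<bar> \<le> 2 * N + 1" using b b' N(1) by auto
    ultimately show "\<exists>b c d. flat b \<and> b (0, 0) = z \<and> \<bar>c\<bar> \<le> 2 * N + 1 \<and> \<bar>d\<bar> \<le> 2 * N + 1 \<and>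
      (\<forall>i j. 2 * N + 1 \<le> i \<longrightarrow> 2 * N + 1 \<le> j \<longrightarrow> b (i + c, j + d) = a (i, j))"
      using b' by blast
  qed (use N in auto)
qed

end

section \<open>Recurrence and periodic flats\<close>

text \<open>The set \<open>S\<close> of all elements reachable from \<open>z'\<close> is closed under successors.  As many pairs of the
relation end in \<open>S\<close> as begin in \<open>S\<close>, so none of them enters \<open>S\<close> from outside, and \<open>S\<close> is closed
under predecessors as well.\<close>

lemma regular_relation_recurrent:
  assumes fin: "finite Z" and sub: "R \<subseteq> Z \<times> Z"
    and out_deg: "\<And>z. z \<in> Z \<Longrightarrow> card (R `` {z}) = d"
    and in_deg: "\<And>z. z \<in> Z \<Longrightarrow> card (R\<inverse> `` {z}) = d"
    and reach: "(z, z') \<in> R\<^sup>*" "z' \<in> Z"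
  shows "(z', z) \<in> R\<^sup>*"
proof -
  define S where "S = R\<^sup>* `` {z'}"
  have SZ: "S \<subseteq> Z"
  proof
    fix u assume "u \<in> S"
    then have "(z', u) \<in> R\<^sup>*" by (simp add: S_def)
    then show "u \<in> Z" using reach(2) sub by (induction rule: rtrancl_induct) auto
  qed
  have finR: "finite R" using fin sub finite_subset by blast
  have finS: "finite S" using SZ fin finite_subset by blast
  have 1: "card (SIGMA u:S. R `` {u}) = d * card S"
    using finS finR out_deg SZ by (subst card_SigmaI) (auto intro!: finite_Image simp: subset_iff)
  have 2: "card (SIGMA u:S. R\<inverse> `` {u}) = d * card S"
    using finS finR in_deg SZ by (subst card_SigmaI) (auto intro!: finite_Image simp: subset_iff)
  have sub': "(SIGMA u:S. R `` {u}) \<subseteq> prod.swap ` (SIGMA u:S. R\<inverse> `` {u})"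
  proof
    fix e assume "e \<in> (SIGMA u:S. R `` {u})"
    then obtain u v where e: "e = (u, v)" "u \<in> S" "(u, v) \<in> R" by auto
    then have "v \<in> S" by (auto simp: S_def intro: rtrancl.rtrancl_into_rtrancl)
    then have "(v, u) \<in> (SIGMA u:S. R\<inverse> `` {u})" using e by auto
    then show "e \<in> prod.swap ` (SIGMA u:S. R\<inverse> `` {u})" using e by force
  qed
  have "card (prod.swap ` (SIGMA u:S. R\<inverse> `` {u})) = d * card S"
    using 2 by (subst card_image) auto
  moreover have "finite (prod.swap ` (SIGMA u:S. R\<inverse> `` {u}))"
    using finS finR by (auto intro!: finite_SigmaI finite_Image)
  ultimately have eq: "(SIGMA u:S. R `` {u}) = prod.swap ` (SIGMA u:S. R\<inverse> `` {u})"
    using card_subset_eq[OF _ sub'] 1 by simp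
  have pred_closed: "u \<in> S" if "(u, v) \<in> R" "v \<in> S" for u v
  proof -
    have "(u, v) \<in> prod.swap ` (SIGMA u:S. R\<inverse> `` {u})" using that by force
    then show ?thesis using eq by auto
  qed
  have "z \<in> S" using reach(1)
  proof (induction rule: converse_rtrancl_induct)
    case base
    then show ?case by (simp add: S_def)
  qed (use pred_closed in blast)
  then show ?thesis by (simp add: S_def)
qed

text \<open>In every plane there are \<open>D\<close> points, and there are \<open>q + 1\<close> points on each line and \<open>q + 1\<close> lines
through each point; the latter two numbers both count the triangles on an edge.\<close>

locale regular_triangle_graph = triangle_graph +
  fixes D q :: nat
  assumes out_degree: "E u v \<Longrightarrow> finite {w. E u w} \<and> card {w. E u w} = D"
    and triangles: "E u v \<Longrightarrow> finite {w. E v w \<and> E w u} \<and> card {w. E v w \<and> E w u} = q + 1"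
    and degree_bounds: "1 \<le> q" "q + 1 < D"
begin

abbreviation opposite_diamonds :: "'a \<Rightarrow> 'a \<Rightarrow> 'a \<Rightarrow> ('a \<times> 'a \<times> 'a) set" where
  "opposite_diamonds v x0 y0 \<equiv> {(x, y, w). E v x \<and> E x y \<and> E y v \<and> E y w \<and> E w x \<and> w \<noteq> v \<and>
     \<not> E x y0 \<and> \<not> E x0 y}"

text \<open>There are \<open>D - (q + 1)\<close> points \<open>x\<close> not on \<open>y0\<close>; all of the \<open>q + 1\<close> lines through \<open>x\<close> except the one
joining it to \<open>x0\<close> may serve as \<open>y\<close>; and all of the \<open>q + 1\<close> triangles on the edge from \<open>x\<close> to \<open>y\<close>
except the one with vertex \<open>v\<close> give a \<open>w\<close>.\<close>

lemma card_opposite_diamonds: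
  assumes "E v x0" "E x0 y0" "E y0 v"
  shows "card (opposite_diamonds v x0 y0) = (D - (q + 1)) * (q * q)"
    and "finite (opposite_diamonds v x0 y0)"
proof -
  define A where "A = {x. E v x \<and> \<not> E x y0}"
  define B where "B x = {y. E x y \<and> E y v \<and> \<not> E x0 y}" for x
  define C where "C x y = {w. E y w \<and> E w x \<and> w \<noteq> v}" for x y
  have eq: "opposite_diamonds v x0 y0
     = (SIGMA x:A. SIGMA y:B x. C x y)"
    by (auto simp: A_def B_def C_def)
  have "A = {x. E v x} - {x. E v x \<and> E x y0}" by (auto simp: A_def)
  moreover have "{x. E v x \<and> E x y0} \<subseteq> {x. E v x}" by blast
  ultimately have A: "finite A" "card A = D - (q + 1)"
    using out_degree[OF assms(1)] triangles[OF assms(3)]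
      card_Diff_subset[of "{x. E v x \<and> E x y0}" "{x. E v x}"] by simp_all
  have B: "finite (B x) \<and> card (B x) = q" if "x \<in> A" for x
  proof -
    have x: "E v x" "x \<noteq> x0" using that assms by (auto simp: A_def)
    then obtain k where k: "E k v" "E x k" "E x0 k" using join[OF x(1) assms(1)] by blast
    have "k' = k" if "E k' v" "E x k'" "E x0 k'" for k'
      using link_no_square[OF x(1) assms(1) that(1) k(1) that(2) k(2) that(3) k(3)] x(2) by simp
    then have "B x = {y. E x y \<and> E y v} - {k}" using k unfolding B_def by blast
    then show ?thesis using triangles[OF x(1)] k by simp
  qed
  have C: "finite (C x y) \<and> card (C x y) = q" if "x \<in> A" "y \<in> B x" for x y
  proof -
    have e: "E x y" "E v x" "E y v" using that by (auto simp: A_def B_def)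
    have "C x y = {w. E y w \<and> E w x} - {v}" by (auto simp: C_def)
    then show ?thesis using triangles[OF e(1)] e by simp
  qed
  have "card (SIGMA y:B x. C x y) = q * q" "finite (SIGMA y:B x. C x y)" if "x \<in> A" for x
    using B[OF that] C[OF that] by (auto simp: card_SigmaI)
  then show "card (opposite_diamonds v x0 y0) = (D - (q + 1)) * (q * q)"
    "finite (opposite_diamonds v x0 y0)"
    unfolding eq using A by (auto simp: card_SigmaI)
qed

end

sublocale regular_triangle_graph \<subseteq> thick_triangle_graph
proof
  fix v p l assume f: "E v p" "E p l" "E l v"
  have "(D - (q + 1)) * (q * q) \<noteq> 0" using degree_bounds by simp
  then have "card (opposite_diamonds v p l) \<noteq> 0" using card_opposite_diamonds(1)[OF f] by simp
  then have "opposite_diamonds v p l \<noteq> {}"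
    by (metis card.empty)
  then show "\<exists>p' l'. E v p' \<and> E p' l' \<and> E l' v \<and> \<not> E p l' \<and> \<not> E p' l" by blast
next
  fix u v w :: 'a assume "E u v"
  from triangles[OF this] degree_bounds have "card {w. E v w \<and> E w u} > card {w}" by simp
  then have "\<not> {w. E v w \<and> E w u} \<subseteq> {w}" using card_mono[of "{w}"] by (meson finite.emptyI finite.insertI leD)
  then show "\<exists>w'. w' \<noteq> w \<and> E v w' \<and> E w' u" by blast
qed

locale homogeneous_triangle_graph = group G + regular_triangle_graph E D q
  for G :: "('v, 'b) monoid_scheme" (structure) and E :: "'v \<Rightarrow> 'v \<Rightarrow> bool" and D q +
  assumes E_carrier: "E u v \<Longrightarrow> u \<in> carrier G \<and> v \<in> carrier G"
    and E_left_mult: "g \<in> carrier G \<Longrightarrow> u \<in> carrier G \<Longrightarrow> v \<in> carrier G \<Longrightarrow>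
      E (g \<otimes> u) (g \<otimes> v) \<longleftrightarrow> E u v"
begin

lemma E_shift_left:
  "g \<in> carrier G \<Longrightarrow> u \<in> carrier G \<Longrightarrow> v \<in> carrier G \<Longrightarrow> E (g \<otimes> u) v \<longleftrightarrow> E u (inv g \<otimes> v)"
  using E_left_mult[of "inv g" "g \<otimes> u" v] by (simp add: m_assoc[symmetric])

lemma E_shift_right:
  "g \<in> carrier G \<Longrightarrow> u \<in> carrier G \<Longrightarrow> v \<in> carrier G \<Longrightarrow> E v (g \<otimes> u) \<longleftrightarrow> E (inv g \<otimes> v) u"
  using E_left_mult[of "inv g" v "g \<otimes> u"] by (simp add: m_assoc[symmetric])

lemma flat_carrier: "flat a \<Longrightarrow> a p \<in> carrier G"
  using flatD(1) E_carrier by (cases p) blast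

lemma flat_left_mult:
  assumes "flat a" "g \<in> carrier G"
  shows "flat (\<lambda>p. g \<otimes> a p)"
  using assms flat_carrier[OF assms(1)] unfolding flat_def by (simp add: E_left_mult)

text \<open>Two chambers with a common edge from \<open>p\<close> to \<open>l\<close>, translated so that one of the two vertices
off this edge is the identity; the other one is \<open>h\<close>.\<close>

definition diamonds :: "('v \<times> 'v \<times> 'v) set" where
  "diamonds = {(p, l, h). E \<one> p \<and> E p l \<and> E l \<one> \<and> E l h \<and> E h p \<and> h \<noteq> \<one>}"

text \<open>The second diamond, placed at the end \<open>h\<close> of the first, continues the gallery: at \<open>h\<close> the two
flags are opposite.\<close>

definition diamond_step :: "(('v \<times> 'v \<times> 'v) \<times> ('v \<times> 'v \<times> 'v)) set" where
  "diamond_step = {((p, l, h), (p', l', h')). (p, l, h) \<in> diamonds \<and> (p', l', h') \<in> diamonds \<and>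
     \<not> E (h \<otimes> p') l \<and> \<not> E p (h \<otimes> l')}"

text \<open>The same diamond seen from its other end.  This involution exchanges successors and predecessors,
so that both are counted by \<open>card_opposite_diamonds\<close>.\<close>

definition diamond_reverse :: "'v \<times> 'v \<times> 'v \<Rightarrow> 'v \<times> 'v \<times> 'v" where
  "diamond_reverse = (\<lambda>(p, l, h). (inv h \<otimes> p, inv h \<otimes> l, inv h))"

lemma diamonds_carrier:
  "(p, l, h) \<in> diamonds \<Longrightarrow> p \<in> carrier G \<and> l \<in> carrier G \<and> h \<in> carrier G"
  using E_carrier by (auto simp: diamonds_def)

lemma diamond_reverse_diamond:
  assumes "z \<in> diamonds"
  shows "diamond_reverse z \<in> diamonds"
proof -
  obtain p l h where z: "z = (p, l, h)" "(p, l, h) \<in> diamonds" using assms by (cases z) auto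
  note c = diamonds_carrier[OF z(2)]
  have "inv h \<noteq> \<one>" using z c by (auto simp: diamonds_def inv_eq_1_iff)
  then show ?thesis using z c E_left_mult[of "inv h" p l]
    E_shift_right[of "inv h" p \<one>] E_shift_left[of "inv h" l \<one>]
    E_left_mult[of "inv h" l \<one>] E_left_mult[of "inv h" \<one> p]
    by (auto simp: diamonds_def diamond_reverse_def)
qed

lemma diamond_reverse_reverse:
  assumes "z \<in> diamonds"
  shows "diamond_reverse (diamond_reverse z) = z"
proof -
  obtain p l h where z: "z = (p, l, h)" "(p, l, h) \<in> diamonds" using assms by (cases z) auto
  note c = diamonds_carrier[OF z(2)]
  then show ?thesis using z by (simp add: diamond_reverse_def m_assoc[symmetric])
qed

lemma diamond_step_reverse:
  assumes "(z, z') \<in> diamond_step"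
  shows "(diamond_reverse z', diamond_reverse z) \<in> diamond_step"
proof -
  obtain p l h p' l' h' where z: "z = (p, l, h)" "z' = (p', l', h')" by (cases z; cases z') auto
  have d: "(p, l, h) \<in> diamonds" "(p', l', h') \<in> diamonds" "\<not> E (h \<otimes> p') l" "\<not> E p (h \<otimes> l')"
    using assms z by (auto simp: diamond_step_def)
  note c = diamonds_carrier[OF d(1)] diamonds_carrier[OF d(2)]
  have "\<not> E (inv h' \<otimes> (inv h \<otimes> p)) (inv h' \<otimes> l')" "\<not> E (inv h' \<otimes> p') (inv h' \<otimes> (inv h \<otimes> l))"
    using c d(3,4) E_shift_right[of h l' p] E_shift_left[of h p' l] by (simp_all add: E_left_mult)
  then show ?thesis
    using diamond_reverse_diamond[OF d(1)] diamond_reverse_diamond[OF d(2)] z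
    by (simp add: diamond_step_def diamond_reverse_def)
qed

lemma card_diamond_step:
  assumes "z \<in> diamonds"
  shows "card (diamond_step `` {z}) = (D - (q + 1)) * (q * q)"
proof -
  obtain p l h where z: "z = (p, l, h)" and d: "(p, l, h) \<in> diamonds" using assms by (cases z) auto
  note c = diamonds_carrier[OF d]
  let ?S = "opposite_diamonds h p l"
  let ?m = "\<lambda>(x, y, w). (h \<otimes> x, h \<otimes> y, h \<otimes> w)"
  have "bij_betw ?m (diamond_step `` {z}) ?S"
    unfolding bij_betw_def
  proof
    show "inj_on ?m (diamond_step `` {z})"
    proof (rule inj_onI)
      fix s t assume st: "s \<in> diamond_step `` {z}" "t \<in> diamond_step `` {z}" "?m s = ?m t"
      obtain x y w x' y' w' where e: "s = (x, y, w)" "t = (x', y', w')" by (cases s; cases t) auto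
      then have "(x, y, w) \<in> diamonds" "(x', y', w') \<in> diamonds" using st by (auto simp: diamond_step_def)
      then show "s = t" using st(3) e c diamonds_carrier by auto
    qed
    show "?m ` (diamond_step `` {z}) = ?S"
    proof (intro equalityI subsetI)
      fix s assume "s \<in> ?m ` (diamond_step `` {z})"
      then obtain x y w where s: "s = (h \<otimes> x, h \<otimes> y, h \<otimes> w)" and xyw: "(x, y, w) \<in> diamonds"
        "\<not> E (h \<otimes> x) l" "\<not> E p (h \<otimes> y)"
        using z by (auto simp: diamond_step_def)
      note c' = diamonds_carrier[OF xyw(1)]
      have "E h (h \<otimes> x)" "E (h \<otimes> y) h"
        using E_left_mult[of h \<one> x] E_left_mult[of h y \<one>] c c' xyw(1) by (auto simp: diamonds_def)
      moreover have "h \<otimes> w \<noteq> h" using c c' xyw(1) r_cancel_one by (auto simp: diamonds_def)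
      ultimately show "s \<in> ?S" using s c c' xyw by (auto simp: diamonds_def E_left_mult)
    next
      fix s assume s: "s \<in> ?S"
      obtain x y w where e: "s = (x, y, w)" by (cases s)
      have xyw: "E h x" "E x y" "E y h" "E y w" "E w x" "w \<noteq> h" "\<not> E x l" "\<not> E p y" using s e by auto
      have c': "x \<in> carrier G" "y \<in> carrier G" "w \<in> carrier G" using xyw E_carrier by auto
      have cancel: "h \<otimes> (inv h \<otimes> u) = u" if "u \<in> carrier G" for u
        using that c by (simp add: m_assoc[symmetric])
      have "E \<one> (inv h \<otimes> x)" "E (inv h \<otimes> y) \<one>"
        using E_shift_left[of h \<one> x] E_shift_right[of h \<one> y] c c' xyw by auto
      moreover have "inv h \<otimes> w \<noteq> \<one>" using c c' xyw inv_solve_left[of \<one> h w] by auto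
      ultimately have "(inv h \<otimes> x, inv h \<otimes> y, inv h \<otimes> w) \<in> diamonds"
        using c c' xyw by (auto simp: diamonds_def E_left_mult)
      then have "(inv h \<otimes> x, inv h \<otimes> y, inv h \<otimes> w) \<in> diamond_step `` {z}"
        using z d xyw(7,8) c' cancel by (simp add: diamond_step_def)
      moreover have "?m (inv h \<otimes> x, inv h \<otimes> y, inv h \<otimes> w) = s"
        using e c' cancel by simp
      ultimately show "s \<in> ?m ` (diamond_step `` {z})" by (rule image_eqI[rotated, OF _ HOL.sym])
    qed
  qed
  then have "card (diamond_step `` {z}) = card ?S" by (rule bij_betw_same_card)
  also have "E h p" "E p l" "E l h" using d by (auto simp: diamonds_def)
  from card_opposite_diamonds(1)[OF this] have "card ?S = (D - (q + 1)) * (q * q)" .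
  finally show ?thesis .
qed

lemma card_diamond_step_converse:
  assumes "z \<in> diamonds"
  shows "card (diamond_step\<inverse> `` {z}) = (D - (q + 1)) * (q * q)"
proof -
  have dom: "u \<in> diamonds" "v \<in> diamonds" if "(u, v) \<in> diamond_step" for u v
    using that by (auto simp: diamond_step_def)
  have "diamond_step\<inverse> `` {z} = diamond_reverse ` (diamond_step `` {diamond_reverse z})"
  proof (intro equalityI subsetI)
    fix u assume "u \<in> diamond_step\<inverse> `` {z}"
    then have "(u, z) \<in> diamond_step" by simp
    then show "u \<in> diamond_reverse ` (diamond_step `` {diamond_reverse z})"
      using diamond_step_reverse diamond_reverse_reverse dom by (metis ImageI image_eqI singletonI)
  next
    fix u assume "u \<in> diamond_reverse ` (diamond_step `` {diamond_reverse z})"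
    then obtain v where v: "(diamond_reverse z, v) \<in> diamond_step" "u = diamond_reverse v" by blast
    then show "u \<in> diamond_step\<inverse> `` {z}"
      using diamond_step_reverse[OF v(1)] diamond_reverse_reverse[OF assms] by simp
  qed
  moreover have "inj_on diamond_reverse (diamond_step `` {diamond_reverse z})"
    using diamond_reverse_reverse dom by (metis (no_types, lifting) ImageE inj_onI)
  ultimately show ?thesis
    using card_diamond_step[OF diamond_reverse_diamond[OF assms]] by (simp add: card_image)
qed

lemma finite_diamonds: "finite diamonds"
proof (cases "\<exists>p. E \<one> p")
  case False
  then have "diamonds = {}" by (auto simp: diamonds_def)
  then show ?thesis by simp
next
  case True
  then obtain p0 where p0: "E \<one> p0" ..
  have "diamonds \<subseteq> (SIGMA p:{p. E \<one> p}. SIGMA l:{l. E p l \<and> E l \<one>}. {h. E l h \<and> E h p})"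
    by (auto simp: diamonds_def)
  moreover have "finite (SIGMA p:{p. E \<one> p}. SIGMA l:{l. E p l \<and> E l \<one>}. {h. E l h \<and> E h p})"
    using out_degree[OF p0] triangles by (intro finite_SigmaI) auto
  ultimately show ?thesis by (rule finite_subset)
qed

lemma diamond_step_recurrent:
  assumes "(z, z') \<in> diamond_step\<^sup>*" "z' \<in> diamonds"
  shows "(z', z) \<in> diamond_step\<^sup>*"
proof (rule regular_relation_recurrent[OF finite_diamonds _ card_diamond_step
      card_diamond_step_converse assms])
  show "diamond_step \<subseteq> diamonds \<times> diamonds" by (auto simp: diamond_step_def)
qed

text \<open>The vertices on the diagonal of the gallery obtained by placing each diamond of a walk at the end
of the preceding one.\<close>

fun developed :: "(nat \<Rightarrow> 'v \<times> 'v \<times> 'v) \<Rightarrow> nat \<Rightarrow> 'v" where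
  "developed \<zeta> 0 = \<one>"
| "developed \<zeta> (Suc k) = developed \<zeta> k \<otimes> snd (snd (\<zeta> k))"

lemma developed_carrier:
  assumes "\<And>k. \<zeta> k \<in> diamonds"
  shows "developed \<zeta> k \<in> carrier G"
proof (induction k)
  case (Suc k)
  have "snd (snd (\<zeta> k)) \<in> carrier G" using assms[of k] diamonds_carrier by (cases "\<zeta> k") auto
  then show ?case using Suc by simp
qed simp

theorem flat_of_diamond_walk:
  assumes "\<And>k. (\<zeta> k, \<zeta> (Suc k)) \<in> diamond_step"
  shows "\<exists>f. flat f \<and> (\<forall>k. f (int k, int k) = developed \<zeta> k)"
proof -
  define p where "p k = fst (\<zeta> k)" for k
  define l where "l k = fst (snd (\<zeta> k))" for k
  define h where "h k = snd (snd (\<zeta> k))" for k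
  have \<zeta>: "\<zeta> k = (p k, l k, h k)" for k by (simp add: p_def l_def h_def)
  have dia: "(p k, l k, h k) \<in> diamonds" for k using assms[of k] \<zeta> by (auto simp: diamond_step_def)
  note c = diamonds_carrier[OF dia]
  have g: "developed \<zeta> k \<in> carrier G" for k using developed_carrier dia \<zeta> by simp
  define P where "P k = developed \<zeta> (nat k) \<otimes> p (nat k)" for k
  define L where "L k = developed \<zeta> (nat k) \<otimes> l (nat k)" for k
  have "gallery_at (\<lambda>k. developed \<zeta> (nat k)) P L k" if k: "0 \<le> k" for k
  proof -
    define n where "n = nat k"
    have n: "nat k = n" "nat (k + 1) = Suc n" using k by (auto simp: n_def)
    let ?g = "developed \<zeta> n"
    have d: "E \<one> (p n)" "E (p n) (l n)" "E (l n) \<one>" "E (l n) (h n)" "E (h n) (p n)" "h n \<noteq> \<one>"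
      using dia[of n] by (auto simp: diamonds_def)
    have s: "\<not> E (h n \<otimes> p (Suc n)) (l n)" "\<not> E (p n) (h n \<otimes> l (Suc n))"
      using assms[of n] \<zeta> by (auto simp: diamond_step_def)
    have g': "developed \<zeta> (Suc n) = ?g \<otimes> h n" by (simp add: h_def)
    have E1: "E ?g (?g \<otimes> p n)" "E (?g \<otimes> l n) ?g"
      using E_left_mult[of ?g \<one> "p n"] E_left_mult[of ?g "l n" \<one>] g c d by auto
    have "?g \<noteq> ?g \<otimes> h n" using d(6) g[of n] c[of n] by simp
    then show ?thesis unfolding gallery_at_def P_def L_def n g'
      using d s g[of n] c[of n] c[of "Suc n"] E1 by (simp add: E_left_mult m_assoc)
  qed
  from flat_of_half_gallery[OF this] obtain f where "flat f"
    "\<forall>k\<ge>0. f (k, k) = developed \<zeta> (nat k)" by blast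
  then show ?thesis by (intro exI[of _ f]) auto
qed

lemma developed_periodic:
  assumes "\<And>k. \<zeta> k \<in> diamonds" "\<And>k. \<zeta> (k + M) = \<zeta> k"
  shows "developed \<zeta> (k + M) = developed \<zeta> M \<otimes> developed \<zeta> k"
proof (induction k)
  case 0
  then show ?case using developed_carrier[of \<zeta> M, OF assms(1)] by simp
next
  case (Suc k)
  have "snd (snd (\<zeta> k)) \<in> carrier G" using assms(1)[of k] diamonds_carrier by (cases "\<zeta> k") auto
  then show ?case using Suc assms(2) developed_carrier[of \<zeta>, OF assms(1)] by (simp add: m_assoc)
qed

text \<open>The walk \<open>z\<close> is followed up to \<open>z N\<close> and then along a path back to \<open>z 0\<close>, and the resulting circuit
of length \<open>M\<close> is repeated for ever.\<close>

lemma closed_walk: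
  assumes "\<And>k. k < N \<Longrightarrow> (z k, z (Suc k)) \<in> diamond_step" "(z N, z 0) \<in> diamond_step\<^sup>*" "0 < N"
  shows "\<exists>\<zeta> M. N \<le> M \<and> (\<forall>k. (\<zeta> k, \<zeta> (Suc k)) \<in> diamond_step) \<and> (\<forall>k. \<zeta> (k + M) = \<zeta> k) \<and>
    (\<forall>k<N. \<zeta> k = z k)"
proof -
  obtain n where "(z N, z 0) \<in> diamond_step ^^ n" using assms(2) rtrancl_imp_relpow by blast
  then obtain f where f: "f 0 = z N" "f n = z 0" "\<And>i. i < n \<Longrightarrow> (f i, f (Suc i)) \<in> diamond_step"
    unfolding relpow_fun_conv by blast
  define M where "M = N + n"
  define w where "w r = (if r < N then z r else f (r - N))" for r
  have w: "(w r, w (Suc r)) \<in> diamond_step" if "r < M" for r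
  proof (cases "Suc r \<le> N")
    case True
    then show ?thesis using assms(1)[of r] f(1) by (cases "Suc r = N") (auto simp: w_def)
  next
    case False
    then have "Suc r - N = Suc (r - N)" by simp
    then show ?thesis using f(3)[of "r - N"] False that by (auto simp: w_def M_def)
  qed
  have wM: "w M = w 0" using f assms(3) by (simp add: w_def M_def)
  have M0: "0 < M" using assms(3) by (simp add: M_def)
  define \<zeta> where "\<zeta> k = w (k mod M)" for k
  show ?thesis
  proof (intro exI[of _ \<zeta>] exI[of _ M] conjI allI impI)
    show "N \<le> M" by (simp add: M_def)
    show "\<zeta> (k + M) = \<zeta> k" for k by (simp add: \<zeta>_def)
    show "(\<zeta> k, \<zeta> (Suc k)) \<in> diamond_step" for k
      using w[of "k mod M"] M0 wM by (cases "Suc (k mod M) = M") (auto simp: \<zeta>_def mod_Suc)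
    show "\<zeta> k = z k" if "k < N" for k using that by (simp add: \<zeta>_def w_def M_def)
  qed
qed

text \<open>The diamonds on the diagonal of \<open>a\<close>, translated to the identity, form a walk.  Recurrence closes its
first \<open>N\<close> steps to a periodic walk, and the development of a periodic walk is invariant under the
translation by its value after one period.\<close>

theorem periodic_flat_through:
  assumes a: "flat a" "a (0, 0) = \<one>" and N: "0 < N"
  shows "\<exists>b g M. flat b \<and> b (0, 0) = \<one> \<and> b (int N, int N) = a (int N, int N) \<and>
    0 < M \<and> g \<in> carrier G \<and>
    (\<forall>i\<ge>0. \<forall>j\<ge>0. b (i + int M, j + int M) = g \<otimes> b (i, j))"
proof -
  define v where "v k = a (int k, int k)" for k :: nat
  define z where "z k = (inv (v k) \<otimes> a (int k + 1, int k), inv (v k) \<otimes> a (int k, int k + 1),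
     inv (v k) \<otimes> v (Suc k))" for k
  have vc: "v k \<in> carrier G" for k using flat_carrier[OF a(1)] by (simp add: v_def)
  have ac: "a p \<in> carrier G" for p using flat_carrier[OF a(1)] .
  have gal: "gallery_at (\<lambda>k. a (k, k)) (\<lambda>k. a (k + 1, k)) (\<lambda>k. a (k, k + 1)) k" for k
    using gallery_of_flat[OF a(1), of 0 0 k] by (simp add: gallery_at_def)
  have v1: "v (Suc k) = a (int k + 1, int k + 1)" for k by (simp add: v_def add.commute)
  have zd: "z k \<in> diamonds" for k
  proof -
    have "v k \<noteq> v (Suc k)" using gal[of "int k"] v1 by (simp add: gallery_at_def v_def)
    then have "inv (v k) \<otimes> v (Suc k) \<noteq> \<one>" using vc inv_solve_left[of \<one> "v k" "v (Suc k)"] by auto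
    moreover have "E \<one> (inv (v k) \<otimes> a (int k + 1, int k))" "E (inv (v k) \<otimes> a (int k, int k + 1)) \<one>"
      using gal[of "int k"] vc ac E_shift_left[of "v k" \<one> "a (int k + 1, int k)"]
        E_shift_right[of "v k" \<one> "a (int k, int k + 1)"]
      by (auto simp: gallery_at_def v_def)
    ultimately show ?thesis
      using gal[of "int k"] vc ac v1[of k] by (auto simp: z_def diamonds_def gallery_at_def E_left_mult)
  qed
  have zs: "(z k, z (Suc k)) \<in> diamond_step" for k
  proof -
    \<comment> \<open>Placing the diamond \<open>z (Suc k)\<close> at the end of \<open>z k\<close> undoes the change of the reference vertex.\<close>
    have m: "inv (v k) \<otimes> v (Suc k) \<otimes> (inv (v (Suc k)) \<otimes> u) = inv (v k) \<otimes> u" if "u \<in> carrier G" for u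
    proof -
      have "v (Suc k) \<otimes> (inv (v (Suc k)) \<otimes> u) = u" using that vc by (simp add: m_assoc[symmetric])
      then show ?thesis using that vc by (simp add: m_assoc)
    qed
    have "\<not> E (a (int k + 1 + 1, int k + 1)) (a (int k, int k + 1))"
      "\<not> E (a (int k + 1, int k)) (a (int k + 1, int k + 1 + 1))"
      using gal[of "int k"] by (auto simp: gallery_at_def)
    then have "\<not> E (inv (v k) \<otimes> a (int (Suc k) + 1, int (Suc k))) (inv (v k) \<otimes> a (int k, int k + 1))"
      "\<not> E (inv (v k) \<otimes> a (int k + 1, int k)) (inv (v k) \<otimes> a (int (Suc k), int (Suc k) + 1))"
      using vc ac by (simp_all add: E_left_mult add.commute)
    then show ?thesis using zd[of k] zd[of "Suc k"] m[OF ac]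
      unfolding diamond_step_def z_def by simp
  qed
  have "(z 0, z k) \<in> diamond_step\<^sup>*" for k
    by (induction k) (use zs in \<open>auto intro: rtrancl.rtrancl_into_rtrancl\<close>)
  then have "(z N, z 0) \<in> diamond_step\<^sup>*" using diamond_step_recurrent zd by blast
  from closed_walk[of N z, OF zs this N] obtain \<zeta> M where \<zeta>: "N \<le> M"
    "\<And>k. (\<zeta> k, \<zeta> (Suc k)) \<in> diamond_step" "\<And>k. \<zeta> (k + M) = \<zeta> k" "\<And>k. k < N \<Longrightarrow> \<zeta> k = z k"
    by blast
  have \<zeta>d: "\<zeta> k \<in> diamonds" for k using \<zeta>(2)[of k] by (auto simp: diamond_step_def)
  obtain b where b: "flat b" "\<And>k. b (int k, int k) = developed \<zeta> k"
    using flat_of_diamond_walk[of \<zeta>, OF \<zeta>(2)] by blast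
  have dv: "developed \<zeta> k = v k" if "k \<le> N" for k
    using that
  proof (induction k)
    case 0
    then show ?case using a(2) by (simp add: v_def)
  next
    case (Suc k)
    then show ?case using \<zeta>(4)[of k] vc by (simp add: z_def m_assoc[symmetric])
  qed
  define g where "g = developed \<zeta> M"
  have gc: "g \<in> carrier G" using developed_carrier[of \<zeta>, OF \<zeta>d] by (simp add: g_def)
  show ?thesis
  proof (intro exI[of _ b] exI[of _ g] exI[of _ M] conjI allI impI b(1))
    show "b (0, 0) = \<one>" using b(2)[of 0] by simp
    show "b (int N, int N) = a (int N, int N)" using b(2)[of N] dv[of N] by (simp add: v_def)
    show "0 < M" using \<zeta>(1) N by simp
    show "g \<in> carrier G" by (rule gc)
    fix i j :: int assume ij: "0 \<le> i" "0 \<le> j"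
    have "b (k + int M, k + int M) = g \<otimes> b (k, k)" if "0 \<le> k" for k
      using b(2)[of "nat k + M"] b(2)[of "nat k"] developed_periodic[of \<zeta> M "nat k", OF \<zeta>d \<zeta>(3)] that
      by (simp add: g_def)
    then show "b (i + int M, j + int M) = g \<otimes> b (i, j)"
      using diagonal_unique[OF flat_shift[OF b(1), of "int M" "int M"] flat_left_mult[OF b(1) gc] _ ij]
      by simp
  qed
qed

end

section \<open>Flats as apartments of the associated complex\<close>

lemma int_shift_invariant:
  fixes Q :: "int \<Rightarrow> bool"
  assumes "\<And>i. Q (i + 1) \<longleftrightarrow> Q i"
  shows "Q i \<longleftrightarrow> Q 0"
proof (induction i rule: int_induct[where k = 0])
  case (step1 i)
  then show ?case using assms[of i] by simp
next
  case (step2 i)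
  then show ?case using assms[of "i - 1"] by simp
qed simp

lemma coxeterI:
  "s \<noteq> {} \<Longrightarrow> s \<subseteq> {(i, j), (i + 1, j), (i, j + 1)} \<Longrightarrow> s \<in> coxeter_A2_tilde"
  "s \<noteq> {} \<Longrightarrow> s \<subseteq> {(i + 1, j), (i, j + 1), (i + 1, j + 1)} \<Longrightarrow> s \<in> coxeter_A2_tilde"
  unfolding coxeter_A2_tilde_def complex_of_def
  by (rule CollectI, rule conjI, assumption, rule bexI, assumption, fast)+

lemma coxeterE:
  assumes "s \<in> coxeter_A2_tilde"
  obtains i j where "s \<noteq> {}" "s \<subseteq> {(i, j), (i + 1, j), (i, j + 1)}"
  | i j where "s \<noteq> {}" "s \<subseteq> {(i + 1, j), (i, j + 1), (i + 1, j + 1)}"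
  using assms unfolding coxeter_A2_tilde_def complex_of_def by auto

lemma coxeter_chambers:
  "{(i, j), (i + 1, j), (i, j + 1)} \<in> coxeter_A2_tilde"
  "{(i + 1, j), (i, j + 1), (i + 1, j + 1)} \<in> coxeter_A2_tilde"
  by (rule coxeterI(1), simp, rule subset_refl) (rule coxeterI(2), simp, rule subset_refl)

lemma coxeter_vertex: "{p} \<in> coxeter_A2_tilde"
  by (cases p) (auto intro: coxeterI(1))

lemma Union_coxeter: "\<Union>coxeter_A2_tilde = UNIV"
  using coxeter_vertex by blast

lemma complex_of_subset: "t \<in> complex_of Ch \<Longrightarrow> s \<subseteq> t \<Longrightarrow> s \<noteq> {} \<Longrightarrow> s \<in> complex_of Ch"
  unfolding complex_of_def by blast

lemma coxeter_subset: "t \<in> coxeter_A2_tilde \<Longrightarrow> s \<subseteq> t \<Longrightarrow> s \<noteq> {} \<Longrightarrow> s \<in> coxeter_A2_tilde"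
  unfolding coxeter_A2_tilde_def by (rule complex_of_subset)

lemma coxeter_image:
  assumes "s \<in> coxeter_A2_tilde"
    and "\<And>i j. r ` {(i, j), (i + 1, j), (i, j + 1)} \<in> coxeter_A2_tilde"
    and "\<And>i j. r ` {(i + 1, j), (i, j + 1), (i + 1, j + 1)} \<in> coxeter_A2_tilde"
  shows "r ` s \<in> coxeter_A2_tilde"
  using assms(1)
proof (cases rule: coxeterE)
  case (1 i j)
  then show ?thesis using coxeter_subset[OF assms(2)[of i j] image_mono[OF 1(2)]] by simp
next
  case (2 i j)
  then show ?thesis using coxeter_subset[OF assms(3)[of i j] image_mono[OF 2(2)]] by simp
qed

lemma coxeter_swap: "s \<in> coxeter_A2_tilde \<Longrightarrow> (\<lambda>(i, j). (j, i)) ` s \<in> coxeter_A2_tilde"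
proof (erule coxeter_image)
  fix i j :: int
  show "(\<lambda>(i, j). (j, i)) ` {(i, j), (i + 1, j), (i, j + 1)} \<in> coxeter_A2_tilde"
    by (rule coxeterI(1)[of _ j i]) simp_all
  show "(\<lambda>(i, j). (j, i)) ` {(i + 1, j), (i, j + 1), (i + 1, j + 1)} \<in> coxeter_A2_tilde"
    by (rule coxeterI(2)[of _ j i]) simp_all
qed

lemma coxeter_shift:
  fixes c d :: int
  shows "s \<in> coxeter_A2_tilde \<Longrightarrow> (\<lambda>(i, j). (i + c, j + d)) ` s \<in> coxeter_A2_tilde"
proof (erule coxeter_image)
  fix i j :: int
  show "(\<lambda>(i, j). (i + c, j + d)) ` {(i, j), (i + 1, j), (i, j + 1)} \<in> coxeter_A2_tilde"
    by (rule coxeterI(1)[of _ "i + c" "j + d"]) simp_all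
  show "(\<lambda>(i, j). (i + c, j + d)) ` {(i + 1, j), (i, j + 1), (i + 1, j + 1)} \<in> coxeter_A2_tilde"
    by (rule coxeterI(2)[of _ "i + c" "j + d"]) simp_all
qed

lemma coxeter_reflect:
  fixes m n :: int
  shows "s \<in> coxeter_A2_tilde \<Longrightarrow> (\<lambda>(i, j). (m - i, n - j)) ` s \<in> coxeter_A2_tilde"
proof (erule coxeter_image)
  fix i j :: int
  show "(\<lambda>(i, j). (m - i, n - j)) ` {(i, j), (i + 1, j), (i, j + 1)} \<in> coxeter_A2_tilde"
    by (rule coxeterI(2)[of _ "m - i - 1" "n - j - 1"]) simp_all
  show "(\<lambda>(i, j). (m - i, n - j)) ` {(i + 1, j), (i, j + 1), (i + 1, j + 1)} \<in> coxeter_A2_tilde"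
    by (rule coxeterI(1)[of _ "m - i - 1" "n - j - 1"]) simp_all
qed

text \<open>Automorphisms of the tessellation reparametrize apartments.\<close>

lemma simplicial_iso_precompose:
  assumes iso: "simplicial_iso f coxeter_A2_tilde A"
    and r: "\<And>s. s \<in> coxeter_A2_tilde \<Longrightarrow> r ` s \<in> coxeter_A2_tilde"
      "\<And>s. s \<in> coxeter_A2_tilde \<Longrightarrow> r' ` s \<in> coxeter_A2_tilde" "\<And>p. r (r' p) = p" "\<And>p. r' (r p) = p"
  shows "simplicial_iso (\<lambda>p. f (r p)) coxeter_A2_tilde A"
proof -
  have b: "bij_betw f UNIV (\<Union>A)" "(`) f ` coxeter_A2_tilde = A"
    using iso by (auto simp: simplicial_iso_def Union_coxeter)
  have "bij r" using r(3,4) by (metis bijI')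
  then have "bij_betw (f \<circ> r) UNIV (\<Union>A)" using b(1) bij_betw_trans by blast
  have "(`) r ` coxeter_A2_tilde = coxeter_A2_tilde"
  proof
    show "coxeter_A2_tilde \<subseteq> (`) r ` coxeter_A2_tilde"
    proof
      fix s assume "s \<in> coxeter_A2_tilde"
      moreover have "s = r ` (r' ` s)" by (simp add: image_image r(3))
      ultimately show "s \<in> (`) r ` coxeter_A2_tilde" using r(2) by blast
    qed
  qed (use r(1) in auto)
  moreover have "(`) (\<lambda>p. f (r p)) ` coxeter_A2_tilde = (`) f ` ((`) r ` coxeter_A2_tilde)"
    by (simp only: image_image)
  ultimately have "(`) (\<lambda>p. f (r p)) ` coxeter_A2_tilde = A" using b(2) by (simp only:)
  then show ?thesis using \<open>bij_betw (f \<circ> r) UNIV (\<Union>A)\<close>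
    by (simp add: simplicial_iso_def Union_coxeter comp_def)
qed

context triangle_graph
begin

definition triangle :: "'a \<Rightarrow> 'a \<Rightarrow> 'a \<Rightarrow> bool" where
  "triangle u v w \<longleftrightarrow> E u v \<and> E v w \<and> E w u"

definition building :: "'a set set" where
  "building = complex_of {{u, v, w} |u v w. triangle u v w}"

definition sector_of :: "(int \<times> int \<Rightarrow> 'a) \<Rightarrow> 'a set set" where
  "sector_of a = (`) a ` standard_cone"

lemma flat_simplicial_iso:
  assumes "flat a"
  shows "simplicial_iso a coxeter_A2_tilde ((`) a ` coxeter_A2_tilde)"
    and "apartment building ((`) a ` coxeter_A2_tilde)"
proof -
  have "bij_betw a UNIV (\<Union>((`) a ` coxeter_A2_tilde))"
    using flat_inj[OF assms] Union_coxeter by (auto simp: bij_betw_def image_Union[symmetric])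
  then show 1: "simplicial_iso a coxeter_A2_tilde ((`) a ` coxeter_A2_tilde)"
    by (simp add: simplicial_iso_def Union_coxeter)
  have "a ` s \<in> building" if "s \<in> coxeter_A2_tilde" for s
    using that
  proof (cases rule: coxeterE)
    case (1 i j)
    then have "a ` s \<subseteq> {a (i, j), a (i + 1, j), a (i, j + 1)}" "a ` s \<noteq> {}" by auto
    moreover have "triangle (a (i, j)) (a (i + 1, j)) (a (i, j + 1))"
      using flatD[OF assms] by (simp add: triangle_def)
    ultimately show ?thesis unfolding building_def complex_of_def by blast
  next
    case (2 i j)
    then have "a ` s \<subseteq> {a (i + 1, j), a (i, j + 1), a (i + 1, j + 1)}" "a ` s \<noteq> {}" by auto
    moreover have "triangle (a (i + 1, j)) (a (i, j + 1)) (a (i + 1, j + 1))"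
      using flatD(1-3)[OF assms] by (simp add: triangle_def)
    ultimately show ?thesis unfolding building_def complex_of_def by blast
  qed
  then show "apartment building ((`) a ` coxeter_A2_tilde)" using 1 by (auto simp: apartment_def)
qed

lemma building_triangle:
  assumes "{x, y, z} \<in> building" "x \<noteq> y" "y \<noteq> z" "x \<noteq> z"
  shows "triangle x y z \<or> triangle x z y"
proof -
  obtain u v w where "{x, y, z} \<subseteq> {u, v, w}" "triangle u v w"
    using assms(1) by (auto simp: building_def complex_of_def)
  then show ?thesis using assms(2-4) by (auto simp: triangle_def)
qed

text \<open>Injectivity implies straightness.  If the point \<open>x\<close> and the line \<open>k\<close> in opposite directions from a
vertex were incident, then \<open>x\<close> and another of the three points around that vertex would both lie
on \<open>k\<close> and on a second of the three lines around it, contrary to \<open>link_no_square\<close>.\<close>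

lemma positive_flat:
  assumes "inj f"
    and up: "\<And>i j. triangle (f (i, j)) (f (i + 1, j)) (f (i, j + 1))"
  shows "flat f"
proof -
  have e: "E (f (i, j)) (f (i + 1, j))" "E (f (i + 1, j)) (f (i, j + 1))" "E (f (i, j + 1)) (f (i, j))"
    for i j using up[of i j] by (auto simp: triangle_def)
  have ne: "f p \<noteq> f p'" if "p \<noteq> p'" for p p' using assms(1) that by (auto dest: injD)
  have "\<not> E (f (i + 2, j)) (f (i, j))" for i j
  proof
    assume "E (f (i + 2, j)) (f (i, j))"
    moreover have "E (f (i + 1, j)) (f (i + 2, j))" "E (f (i + 1, j)) (f (i + 1, j - 1))"
      "E (f (i, j)) (f (i + 1, j))" "E (f (i + 2, j - 1)) (f (i + 1, j))" "E (f (i + 1, j - 1)) (f (i, j))"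
      "E (f (i + 2, j)) (f (i + 2, j - 1))" "E (f (i + 1, j - 1)) (f (i + 2, j - 1))"
      using e(1)[of "i + 1" j] e(3)[of "i + 1" "j - 1"] e(1)[of i j] e(2)[of "i + 1" "j - 1"]
        e(2)[of i "j - 1"] e(3)[of "i + 2" "j - 1"] e(1)[of "i + 1" "j - 1"] by (simp_all add: add.assoc)
    ultimately have "f (i + 2, j) = f (i + 1, j - 1) \<or> f (i, j) = f (i + 2, j - 1)"
      using link_no_square by metis
    then show False using ne by auto
  qed
  moreover have "\<not> E (f (i, j)) (f (i, j + 2))" for i j
  proof
    assume "E (f (i, j)) (f (i, j + 2))"
    moreover have "E (f (i, j + 1)) (f (i, j))" "E (f (i, j + 1)) (f (i + 1, j + 1))"
      "E (f (i, j + 2)) (f (i, j + 1))" "E (f (i + 1, j)) (f (i, j + 1))" "E (f (i + 1, j + 1)) (f (i, j + 2))"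
      "E (f (i, j)) (f (i + 1, j))" "E (f (i + 1, j + 1)) (f (i + 1, j))"
      using e(3)[of i j] e(1)[of i "j + 1"] e(3)[of i "j + 1"] e(2)[of i j]
        e(2)[of i "j + 1"] e(1)[of i j] e(3)[of "i + 1" j] by (simp_all add: add.assoc)
    ultimately have "f (i, j) = f (i + 1, j + 1) \<or> f (i, j + 2) = f (i + 1, j)"
      using link_no_square by metis
    then show False using ne by auto
  qed
  moreover have "\<not> E (f (i, j + 2)) (f (i + 2, j))" for i j
  proof
    assume "E (f (i, j + 2)) (f (i + 2, j))"
    moreover have "E (f (i + 1, j + 1)) (f (i, j + 2))" "E (f (i + 1, j + 1)) (f (i + 2, j + 1))"
      "E (f (i + 2, j)) (f (i + 1, j + 1))" "E (f (i + 1, j + 2)) (f (i + 1, j + 1))"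
      "E (f (i + 2, j + 1)) (f (i + 2, j))"
      "E (f (i, j + 2)) (f (i + 1, j + 2))" "E (f (i + 2, j + 1)) (f (i + 1, j + 2))"
      using e(2)[of i "j + 1"] e(1)[of "i + 1" "j + 1"] e(2)[of "i + 1" j] e(3)[of "i + 1" "j + 1"]
        e(3)[of "i + 2" j] e(1)[of i "j + 2"] e(2)[of "i + 1" "j + 1"] by (simp_all add: add.assoc)
    ultimately have "f (i, j + 2) = f (i + 2, j + 1) \<or> f (i + 2, j) = f (i + 1, j + 2)"
      using link_no_square by metis
    then show False using ne by auto
  qed
  ultimately show ?thesis unfolding flat_def using e by blast
qed

text \<open>The edges of a chamber form a directed cycle, so each chamber of the tessellation gets one of two
orientations.  Since neighbouring chambers share an edge, one choice holds throughout, and it is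
reversed by exchanging the coordinates.\<close>

lemma simplicial_iso_flat:
  assumes iso: "simplicial_iso f coxeter_A2_tilde A" and "A \<subseteq> building"
  shows "flat f \<or> flat (\<lambda>(i, j). f (j, i))"
proof -
  have inj: "inj f" using iso by (auto simp: simplicial_iso_def bij_betw_def Union_coxeter)
  have K: "f ` s \<in> building" if "s \<in> coxeter_A2_tilde" for s
    using assms that by (auto simp: simplicial_iso_def)
  have ne: "f p \<noteq> f p'" if "p \<noteq> p'" for p p' using inj that by (auto dest: injD)
  have up: "triangle (f (i, j)) (f (i + 1, j)) (f (i, j + 1)) \<or>
      triangle (f (i, j)) (f (i, j + 1)) (f (i + 1, j))" for i j
    using K[OF coxeter_chambers(1)[of i j]] ne by (intro building_triangle) auto
  have down: "triangle (f (i + 1, j)) (f (i, j + 1)) (f (i + 1, j + 1)) \<or>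
      triangle (f (i + 1, j)) (f (i + 1, j + 1)) (f (i, j + 1))" for i j
    using K[OF coxeter_chambers(2)[of i j]] ne by (intro building_triangle) auto
  \<comment> \<open>\<open>Q i j\<close> is the orientation of the edge shared by the two chambers at \<open>(i, j)\<close>.\<close>
  define Q where "Q i j \<longleftrightarrow> E (f (i + 1, j)) (f (i, j + 1))" for i j
  have Q: "Q (i + 1) j \<longleftrightarrow> Q i j" "Q i (j + 1) \<longleftrightarrow> Q i j" for i j
    using up[of "i + 1" j] up[of i "j + 1"] down[of i j] no_two_cycle
    unfolding Q_def triangle_def by blast+
  have const: "Q i j \<longleftrightarrow> Q 0 0" for i j
    using int_shift_invariant[of "\<lambda>i. Q i j" i] int_shift_invariant[of "\<lambda>j. Q 0 j" j] Q by blast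
  show ?thesis
  proof (cases "Q 0 0")
    case True
    then have "triangle (f (i, j)) (f (i + 1, j)) (f (i, j + 1))" for i j
      using const[of i j] up[of i j] no_two_cycle unfolding Q_def triangle_def by blast
    then show ?thesis using positive_flat[OF inj] by blast
  next
    case False
    then have "triangle (f (i, j)) (f (i, j + 1)) (f (i + 1, j))" for i j
      using const[of i j] up[of i j] no_two_cycle unfolding Q_def triangle_def by blast
    moreover have "inj (\<lambda>(i, j). f (j, i))" using inj by (auto intro!: injI dest: injD)
    ultimately show ?thesis using positive_flat[of "\<lambda>(i, j). f (j, i)"] by auto
  qed
qed

lemma standard_cone_swap: "(`) (\<lambda>(i, j). (j, i)) ` standard_cone = standard_cone"
proof -
  have sub: "(\<lambda>(i, j). (j, i)) ` s \<in> standard_cone" if "s \<in> standard_cone" for s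
    using that coxeter_swap by (auto simp: standard_cone_def)
  moreover have "s \<in> (`) (\<lambda>(i, j). (j, i)) ` standard_cone" if "s \<in> standard_cone" for s
  proof (rule image_eqI)
    show "s = (\<lambda>(i, j). (j, i)) ` (\<lambda>(i, j). (j, i)) ` s" by (auto simp: image_image split_beta)
  qed (rule sub[OF that])
  ultimately show ?thesis by blast
qed

text \<open>A parametrization with the wrong orientation is corrected by exchanging the coordinates, which
preserves the standard cone.\<close>

theorem sector_at_iff: "sector_at building v S \<longleftrightarrow> (\<exists>a. flat a \<and> a (0, 0) = v \<and> S = sector_of a)"
proof
  assume "sector_at building v S"
  then obtain A f where f: "apartment building A" "simplicial_iso f coxeter_A2_tilde A"
    "f (0, 0) = v" "S = (`) f ` standard_cone" by (auto simp: sector_at_def)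
  have "flat f \<or> flat (\<lambda>(i, j). f (j, i))"
    using simplicial_iso_flat[OF f(2)] f(1) by (auto simp: apartment_def)
  moreover have "(`) (\<lambda>(i, j). f (j, i)) ` standard_cone = (`) f ` (`) (\<lambda>(i, j). (j, i)) ` standard_cone"
    by (simp add: image_image split_beta)
  then have "sector_of (\<lambda>(i, j). f (j, i)) = S"
    unfolding sector_of_def f(4) standard_cone_swap .
  moreover have "sector_of f = S" using f(4) by (simp add: sector_of_def)
  ultimately show "\<exists>a. flat a \<and> a (0, 0) = v \<and> S = sector_of a" using f(3) by auto
next
  assume "\<exists>a. flat a \<and> a (0, 0) = v \<and> S = sector_of a"
  then show "sector_at building v S"
    unfolding sector_at_def sector_of_def using flat_simplicial_iso by blast
qed

lemma sectors_iff: "S \<in> sectors building \<longleftrightarrow> (\<exists>a. flat a \<and> S = sector_of a)"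
  unfolding sectors_def using sector_at_iff by auto

end

section \<open>Sector classes and convex hulls\<close>

text \<open>The flats coincide far out in the first quadrant up to a translation of the coordinates; for their
sectors this means to have a common subsector (\<open>sector_equiv_iff\<close>).\<close>

definition asymptotic :: "(int \<times> int \<Rightarrow> 'v) \<Rightarrow> (int \<times> int \<Rightarrow> 'v) \<Rightarrow> bool" where
  "asymptotic a b \<longleftrightarrow> (\<exists>c d N. \<forall>i\<ge>N. \<forall>j\<ge>N. b (i + c, j + d) = a (i, j))"

lemma asymptoticI: "(\<And>i j. N \<le> i \<Longrightarrow> N \<le> j \<Longrightarrow> b (i + c, j + d) = a (i, j)) \<Longrightarrow> asymptotic a b"
  unfolding asymptotic_def by blast

lemma asymptotic_refl: "asymptotic a a"
  by (rule asymptoticI[of 0 _ 0 0]) simp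

lemma asymptotic_sym:
  assumes "asymptotic a b" shows "asymptotic b a"
proof -
  obtain c d N where N: "\<And>i j. N \<le> i \<Longrightarrow> N \<le> j \<Longrightarrow> b (i + c, j + d) = a (i, j)"
    using assms unfolding asymptotic_def by blast
  show ?thesis
  proof (rule asymptoticI[of "N + \<bar>c\<bar> + \<bar>d\<bar>" _ "- c" "- d"])
    fix i j assume "N + \<bar>c\<bar> + \<bar>d\<bar> \<le> i" "N + \<bar>c\<bar> + \<bar>d\<bar> \<le> j"
    then have "N \<le> i - c" "N \<le> j - d" by linarith+
    then show "a (i + - c, j + - d) = b (i, j)" using N[of "i - c" "j - d"] by simp
  qed
qed

lemma asymptotic_trans:
  assumes "asymptotic a b" "asymptotic b e" shows "asymptotic a e"
proof -
  obtain c d N where N: "\<And>i j. N \<le> i \<Longrightarrow> N \<le> j \<Longrightarrow> b (i + c, j + d) = a (i, j)"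
    using assms(1) unfolding asymptotic_def by blast
  obtain c' d' N' where N': "\<And>i j. N' \<le> i \<Longrightarrow> N' \<le> j \<Longrightarrow> e (i + c', j + d') = b (i, j)"
    using assms(2) unfolding asymptotic_def by blast
  show ?thesis
  proof (rule asymptoticI[of "max N (N' + \<bar>c\<bar> + \<bar>d\<bar>)" _ "c + c'" "d + d'"])
    fix i j assume "max N (N' + \<bar>c\<bar> + \<bar>d\<bar>) \<le> i" "max N (N' + \<bar>c\<bar> + \<bar>d\<bar>) \<le> j"
    then have "N \<le> i" "N \<le> j" "N' \<le> i + c" "N' \<le> j + d" by linarith+
    then show "e (i + (c + c'), j + (d + d')) = a (i, j)"
      using N[of i j] N'[of "i + c" "j + d"] by (simp add: add.assoc)
  qed
qed

lemma vertex_in_standard_cone: "0 \<le> i \<Longrightarrow> 0 \<le> j \<Longrightarrow> {(i, j)} \<in> standard_cone"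
  by (simp add: standard_cone_def coxeter_vertex)

lemma standard_cone_quadrant: "s \<in> standard_cone \<Longrightarrow> (i, j) \<in> s \<Longrightarrow> 0 \<le> i \<and> 0 \<le> j"
  by (auto simp: standard_cone_def)

context triangle_graph
begin

lemma sector_of_in_sectors: "flat a \<Longrightarrow> sector_of a \<in> sectors building"
  using sectors_iff by blast

lemma sector_of_vertices: "\<Union>(sector_of a) = {a (i, j) |i j. 0 \<le> i \<and> 0 \<le> j}"
proof (intro equalityI subsetI)
  fix x assume "x \<in> \<Union>(sector_of a)"
  then obtain s p where "s \<in> standard_cone" "p \<in> s" "x = a p" by (auto simp: sector_of_def)
  then show "x \<in> {a (i, j) |i j. 0 \<le> i \<and> 0 \<le> j}" using standard_cone_quadrant by (cases p) blast
next
  fix x assume "x \<in> {a (i, j) |i j. 0 \<le> i \<and> 0 \<le> j}"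
  then obtain i j where "x = a (i, j)" "0 \<le> i" "0 \<le> j" by blast
  then show "x \<in> \<Union>(sector_of a)"
    using vertex_in_standard_cone[of i j] by (auto simp: sector_of_def intro!: bexI[of _ "{(i, j)}"])
qed

lemma sector_of_translate_subset:
  assumes "0 \<le> c" "0 \<le> d" "\<And>i j. 0 \<le> i \<Longrightarrow> 0 \<le> j \<Longrightarrow> e (i, j) = a (i + c, j + d)"
  shows "sector_of e \<subseteq> sector_of a"
proof
  fix x assume "x \<in> sector_of e"
  then obtain s where s: "s \<in> standard_cone" "x = e ` s" by (auto simp: sector_of_def)
  have "x = a ` ((\<lambda>(i, j). (i + c, j + d)) ` s)"
    unfolding s(2) image_image
    by (rule image_cong) (use assms(3) standard_cone_quadrant[OF s(1)] in auto)
  moreover have "(\<lambda>(i, j). (i + c, j + d)) ` s \<in> standard_cone"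
    using s(1) coxeter_shift assms(1,2) by (fastforce simp: standard_cone_def)
  ultimately show "x \<in> sector_of a" by (auto simp: sector_of_def)
qed

lemma sector_of_eq:
  assumes "\<And>i j. 0 \<le> i \<Longrightarrow> 0 \<le> j \<Longrightarrow> a (i, j) = b (i, j)"
  shows "sector_of a = sector_of b"
  using sector_of_translate_subset[of 0 0 a b] sector_of_translate_subset[of 0 0 b a] assms by simp

lemma subsector_asymptotic:
  assumes "flat a" "flat e" "sector_of e \<subseteq> sector_of a"
  shows "asymptotic e a"
proof -
  have "\<exists>k l. 0 \<le> k \<and> 0 \<le> l \<and> e (i, j) = a (k, l)" if "0 \<le> i" "0 \<le> j" for i j
  proof -
    have "e (i, j) \<in> \<Union>(sector_of e)" using that sector_of_vertices by blast
    then have "e (i, j) \<in> \<Union>(sector_of a)" using assms(3) by blast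
    then show ?thesis using sector_of_vertices by auto
  qed
  from subsector_translate[OF assms(1,2) this] obtain c d where
    "\<And>i j. 0 \<le> i \<Longrightarrow> 0 \<le> j \<Longrightarrow> e (i, j) = a (i + c, j + d)" by metis
  then show ?thesis by (intro asymptoticI[of 0 _ c d]) simp
qed

theorem sector_equiv_iff:
  assumes "flat a" "flat b"
  shows "(sector_of a, sector_of b) \<in> sector_equiv building \<longleftrightarrow> asymptotic a b"
proof
  assume "(sector_of a, sector_of b) \<in> sector_equiv building"
  then obtain S where S: "S \<in> sectors building" "S \<subseteq> sector_of a" "S \<subseteq> sector_of b"
    unfolding sector_equiv_def by blast
  then obtain e where e: "flat e" "S = sector_of e" using sectors_iff by blast
  have "asymptotic e a" "asymptotic e b"
    using subsector_asymptotic[OF assms(1) e(1)] subsector_asymptotic[OF assms(2) e(1)] S e(2)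
    by simp_all
  then show "asymptotic a b" using asymptotic_sym asymptotic_trans by metis
next
  assume "asymptotic a b"
  then obtain c d N where N: "\<And>i j. N \<le> i \<Longrightarrow> N \<le> j \<Longrightarrow> b (i + c, j + d) = a (i, j)"
    unfolding asymptotic_def by blast
  define n where "n = max 0 (max N (\<bar>c\<bar> + \<bar>d\<bar>))"
  have n: "0 \<le> n" "N \<le> n" "0 \<le> n + c" "0 \<le> n + d" by (auto simp: n_def)
  let ?e = "\<lambda>(i, j). a (i + n, j + n)"
  have "flat ?e" using flat_shift[OF assms(1)] .
  moreover have "sector_of ?e \<subseteq> sector_of a" by (rule sector_of_translate_subset[of n n]) (use n in auto)
  moreover have "sector_of ?e \<subseteq> sector_of b"
  proof (rule sector_of_translate_subset[of "n + c" "n + d"])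
    fix i j :: int assume "0 \<le> i" "0 \<le> j"
    then show "?e (i, j) = b (i + (n + c), j + (n + d))"
      using N[of "i + n" "j + n"] n by (simp add: add.assoc)
  qed (use n in auto)
  ultimately show "(sector_of a, sector_of b) \<in> sector_equiv building"
    unfolding sector_equiv_def mem_Collect_eq prod.case
    by (intro conjI bexI[of _ "sector_of ?e"] sector_of_in_sectors assms)
qed

abbreviation sector_class :: "(int \<times> int \<Rightarrow> 'a) \<Rightarrow> 'a set set set" where
  "sector_class a \<equiv> {sector_of f |f. flat f \<and> asymptotic a f}"

lemma boundary_iff:
  "\<omega> \<in> boundary building \<longleftrightarrow> (\<exists>a. flat a \<and> \<omega> = sector_class a)"
proof -
  have cls: "sector_equiv building `` {sector_of a} = sector_class a"
    if "flat a" for a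
  proof (intro equalityI subsetI)
    fix S assume S: "S \<in> sector_equiv building `` {sector_of a}"
    then have "S \<in> sectors building" unfolding sector_equiv_def by blast
    then obtain b where "flat b" "S = sector_of b" using sectors_iff by blast
    then show "S \<in> sector_class a"
      using S sector_equiv_iff[OF that] by blast
  qed (use sector_equiv_iff[OF that] in blast)
  have "\<omega> \<in> boundary building \<longleftrightarrow> (\<exists>S\<in>sectors building. \<omega> = sector_equiv building `` {S})"
    by (auto simp: boundary_def quotient_def)
  also have "\<dots> \<longleftrightarrow> (\<exists>a. flat a \<and> \<omega> = sector_equiv building `` {sector_of a})"
    unfolding Bex_def sectors_iff by blast
  also have "\<dots> \<longleftrightarrow> (\<exists>a. flat a \<and> \<omega> = sector_class a)"
  proof
    assume "\<exists>a. flat a \<and> \<omega> = sector_equiv building `` {sector_of a}"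
    then obtain a where a: "flat a" "\<omega> = sector_equiv building `` {sector_of a}" by blast
    then show "\<exists>a. flat a \<and> \<omega> = sector_class a"
      using cls[OF a(1)] by (intro exI[of _ a]) simp
  next
    assume "\<exists>a. flat a \<and> \<omega> = sector_class a"
    then obtain a where a: "flat a" "\<omega> = sector_class a" by blast
    then show "\<exists>a. flat a \<and> \<omega> = sector_equiv building `` {sector_of a}"
      using cls[OF a(1)] by (intro exI[of _ a]) simp
  qed
  finally show ?thesis .
qed

text \<open>Far out on the diagonal the flats have a common vertex, and \<open>parallelogram_unique\<close> applies to
arbitrarily large parallelograms.\<close>

lemma asymptotic_same_base:
  assumes "flat a" "flat b" "a (0, 0) = b (0, 0)" "asymptotic a b" "0 \<le> i" "0 \<le> j"
  shows "a (i, j) = b (i, j)"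
proof -
  obtain c d N where N: "\<And>i j. N \<le> i \<Longrightarrow> N \<le> j \<Longrightarrow> b (i + c, j + d) = a (i, j)"
    using assms(4) unfolding asymptotic_def by blast
  define n where "n = max (max i j) (max N (\<bar>c\<bar> + \<bar>d\<bar>))"
  have n: "i \<le> n" "j \<le> n" "N \<le> n" "0 \<le> n" "0 \<le> n + c" "0 \<le> n + d" using assms(5) by (auto simp: n_def)
  have "a (n, n) = b (n + c, n + d)" using N n by simp
  from parallelogram_unique[OF assms(1-3) this] show ?thesis using n assms(5,6) by blast
qed

lemma boundary_asymptotic:
  assumes "\<omega> \<in> boundary building" "sector_of a \<in> \<omega>" "flat a" "flat b"
  shows "sector_of b \<in> \<omega> \<longleftrightarrow> asymptotic a b"
proof -
  obtain e where e: "flat e" "\<omega> = sector_class e"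
    using boundary_iff[THEN iffD1, OF assms(1)] by blast
  have mem: "sector_of f \<in> \<omega> \<longleftrightarrow> asymptotic e f" if "flat f" for f
  proof
    assume "sector_of f \<in> \<omega>"
    then obtain g where g: "sector_of f = sector_of g" "flat g" "asymptotic e g" using e by blast
    then have "asymptotic f g" using sector_equiv_iff[OF that g(2)] sector_equiv_iff[OF that that]
        asymptotic_refl[of f] by simp
    then show "asymptotic e f" using g(3) asymptotic_sym[of f g] asymptotic_trans[of e g f] by blast
  qed (use e that in blast)
  show ?thesis using mem[OF assms(3)] mem[OF assms(4)] assms(2)
      asymptotic_sym[of e a] asymptotic_trans[of e a b] asymptotic_trans[of a e b] by blast
qed

lemma base_chamber_sector:
  assumes "flat b"
  shows "base_chamber (sector_of b) (b (0, 0)) = {b (0, 0), b (1, 0), b (0, 1)}"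
  unfolding base_chamber_def
proof (rule the_equality)
  let ?s = "{(0, 0), (1, 0), (0, 1)} :: (int \<times> int) set"
  have inj: "inj b" using flat_inj[OF assms] .
  have "?s \<in> standard_cone" using coxeter_chambers(1)[of 0 0] by (simp add: standard_cone_def)
  then have "b ` ?s \<in> sector_of b" unfolding sector_of_def by (rule imageI)
  moreover have "card (b ` ?s) = 3" using card_image[OF inj_on_subset[OF inj subset_UNIV], of ?s] by simp
  ultimately show "{b (0, 0), b (1, 0), b (0, 1)} \<in> sector_of b \<and>
      card {b (0, 0), b (1, 0), b (0, 1)} = 3 \<and> b (0, 0) \<in> {b (0, 0), b (1, 0), b (0, 1)}" by simp
  fix C assume C: "C \<in> sector_of b \<and> card C = 3 \<and> b (0, 0) \<in> C"
  then obtain s where s: "s \<in> standard_cone" "C = b ` s" by (auto simp: sector_of_def)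
  have card: "card s = 3" using C s card_image[OF inj_on_subset[OF inj subset_UNIV], of s] by simp
  have o: "(0, 0) \<in> s" using C s inj by (auto dest: injD)
  have pos: "0 \<le> i" "0 \<le> j" if "(i, j) \<in> s" for i j using standard_cone_quadrant[OF s(1)] that by auto
  have "s \<in> coxeter_A2_tilde" using s(1) by (simp add: standard_cone_def)
  then have "s = ?s"
  proof (cases rule: coxeterE)
    case (1 i j)
    have "card {(i, j), (i + 1, j), (i, j + 1)} = 3" by simp
    then have e: "s = {(i, j), (i + 1, j), (i, j + 1)}"
      using card_subset_eq[OF _ 1(2)] card by simp
    then have "i \<ge> 0" "j \<ge> 0" using pos by auto
    then have "i = 0" "j = 0" using o e by auto
    then show ?thesis using e by simp
  next
    case (2 i j)
    have "card {(i + 1, j), (i, j + 1), (i + 1, j + 1)} = 3" by simp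
    then have e: "s = {(i + 1, j), (i, j + 1), (i + 1, j + 1)}"
      using card_subset_eq[OF _ 2(2)] card by simp
    then have "j \<ge> 0" "i \<ge> 0" using pos by auto
    then show ?thesis using o e by auto
  qed
  then show "C = {b (0, 0), b (1, 0), b (0, 1)}" using s by simp
qed

abbreviation flat_part :: "(int \<times> int \<Rightarrow> 'a) \<Rightarrow> (int \<times> int) set \<Rightarrow> 'a set set" where
  "flat_part b H \<equiv> (`) b ` {s \<in> coxeter_A2_tilde. s \<subseteq> H}"

text \<open>The flat \<open>b \<circ> r\<close> parametrizes the same apartment, and \<open>r\<close> carries the half-plane
\<open>0 \<le> i\<close> to \<open>H\<close>.\<close>

lemma half_apartment_preimage:
  assumes "flat b"
    and r: "\<And>s. s \<in> coxeter_A2_tilde \<Longrightarrow> r ` s \<in> coxeter_A2_tilde"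
      "\<And>s. s \<in> coxeter_A2_tilde \<Longrightarrow> r' ` s \<in> coxeter_A2_tilde" "\<And>p. r (r' p) = p" "\<And>p. r' (r p) = p"
    and H: "\<And>p. p \<in> H \<longleftrightarrow> 0 \<le> fst (r' p)"
  shows "flat_part b H \<in> half_apartments building"
proof -
  have "simplicial_iso (\<lambda>p. b (r p)) coxeter_A2_tilde ((`) b ` coxeter_A2_tilde)"
    by (rule simplicial_iso_precompose[OF flat_simplicial_iso(1)[OF assms(1)] r])
  moreover have "flat_part b H =
      (`) (\<lambda>p. b (r p)) ` {s \<in> coxeter_A2_tilde. s \<subseteq> {(i, j). 0 \<le> i}}"
  proof (intro equalityI subsetI)
    fix x assume "x \<in> flat_part b H"
    then obtain s where s: "s \<in> coxeter_A2_tilde" "s \<subseteq> H" "x = b ` s" by blast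
    have "x = (\<lambda>p. b (r p)) ` (r' ` s)" by (simp add: s(3) image_image r(3))
    moreover have "0 \<le> fst (r' p)" if "p \<in> s" for p using s(2) H that by blast
    then have "r' ` s \<subseteq> {(i, j). 0 \<le> i}" unfolding split_beta by blast
    ultimately show "x \<in> (`) (\<lambda>p. b (r p)) ` {s \<in> coxeter_A2_tilde. s \<subseteq> {(i, j). 0 \<le> i}}"
      using r(2)[OF s(1)] \<open>r' ` s \<subseteq> {(i, j). 0 \<le> i}\<close> by blast
  next
    fix x assume "x \<in> (`) (\<lambda>p. b (r p)) ` {s \<in> coxeter_A2_tilde. s \<subseteq> {(i, j). 0 \<le> i}}"
    then obtain s where s: "s \<in> coxeter_A2_tilde" "s \<subseteq> {(i, j). 0 \<le> i}" "x = (\<lambda>p. b (r p)) ` s" by blast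
    have "x = b ` (r ` s)" by (simp add: s(3) image_image)
    moreover have "r p \<in> H" if "p \<in> s" for p using s(2) H r(4) that by fastforce
    then have "r ` s \<subseteq> H" by blast
    ultimately show "x \<in> flat_part b H"
      using r(1)[OF s(1)] \<open>r ` s \<subseteq> H\<close> by blast
  qed
  ultimately show ?thesis
    unfolding half_apartments_def using flat_simplicial_iso(2)[OF assms(1)] by blast
qed

lemma flat_half_apartments:
  assumes "flat b"
  shows "flat_part b {(i, j). 0 \<le> i} \<in> half_apartments building"
    and "flat_part b {(i, j). 0 \<le> j} \<in> half_apartments building"
    and "flat_part b {(i, j). i \<le> M} \<in> half_apartments building"
    and "flat_part b {(i, j). j \<le> M} \<in> half_apartments building"
proof -
  show "flat_part b {(i, j). 0 \<le> i} \<in> half_apartments building"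
    by (rule half_apartment_preimage[OF assms, of "\<lambda>p. p" "\<lambda>p. p"]) auto
  show "flat_part b {(i, j). 0 \<le> j} \<in> half_apartments building"
    by (rule half_apartment_preimage[OF assms, of "\<lambda>(i, j). (j, i)" "\<lambda>(i, j). (j, i)"])
      (use coxeter_swap in auto)
  show "flat_part b {(i, j). i \<le> M} \<in> half_apartments building"
    by (rule half_apartment_preimage[OF assms, of "\<lambda>(i, j). (M - i, M - j)" "\<lambda>(i, j). (M - i, M - j)"])
      (use coxeter_reflect in auto)
  show "flat_part b {(i, j). j \<le> M} \<in> half_apartments building"
  proof (rule half_apartment_preimage[OF assms, of "\<lambda>(i, j). (M - j, M - i)" "\<lambda>(i, j). (M - j, M - i)"])
    show "(\<lambda>(i, j). (M - j, M - i)) ` s \<in> coxeter_A2_tilde" if "s \<in> coxeter_A2_tilde" for s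
      using coxeter_reflect[OF coxeter_swap[OF that], of M M] by (simp add: image_image split_beta)
    then show "(\<lambda>(i, j). (M - j, M - i)) ` s \<in> coxeter_A2_tilde" if "s \<in> coxeter_A2_tilde" for s
      using that .
  qed auto
qed

text \<open>The square is the intersection of four half-planes of one apartment.  Half-apartments of other
apartments could only make the hull smaller.\<close>

lemma hull_bounded:
  assumes "flat b" and mn: "0 \<le> m" "m \<le> M" "0 \<le> n" "n \<le> M" "1 \<le> M"
  shows "convex_hull building {{b (m, n)}, {b (0, 0), b (1, 0), b (0, 1)}} \<subseteq>
    flat_part b ({0..M} \<times> {0..M})"
proof
  fix x assume x: "x \<in> convex_hull building {{b (m, n)}, {b (0, 0), b (1, 0), b (0, 1)}}"
  have *: "x \<in> flat_part b H"
    if "flat_part b H \<in> half_apartments building"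
      "{(m, n)} \<subseteq> H" "{(0, 0), (1, 0), (0, 1)} \<subseteq> H" for H
  proof -
    have "b ` {(m, n)} \<in> flat_part b H"
      using that(2) coxeter_vertex by (intro imageI) auto
    moreover have "b ` {(0, 0), (1, 0), (0, 1)} \<in> flat_part b H"
      using that(3) coxeter_chambers(1)[of 0 0] by (intro imageI) auto
    ultimately show ?thesis using x that(1) unfolding convex_hull_def by auto
  qed
  have "x \<in> flat_part b {(i, j). 0 \<le> i}"
    by (rule *[OF flat_half_apartments(1)[OF assms(1)]]) (use mn in auto)
  then obtain s where s: "x = b ` s" "s \<in> coxeter_A2_tilde" "s \<subseteq> {(i, j). 0 \<le> i}" by blast
  have **: "s \<subseteq> H" if "x \<in> flat_part b H" for H
    using that s(1) flat_inj[OF assms(1)] by (auto simp: inj_image_eq_iff)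
  have "s \<subseteq> {(i, j). 0 \<le> j}"
    by (rule **, rule *[OF flat_half_apartments(2)[OF assms(1)]]) (use mn in auto)
  moreover have "s \<subseteq> {(i, j). i \<le> M}"
    by (rule **, rule *[OF flat_half_apartments(3)[OF assms(1)]]) (use mn in auto)
  moreover have "s \<subseteq> {(i, j). j \<le> M}"
    by (rule **, rule *[OF flat_half_apartments(4)[OF assms(1)]]) (use mn in auto)
  ultimately have "s \<subseteq> {0..M} \<times> {0..M}" using s(3) by auto
  then show "x \<in> flat_part b ({0..M} \<times> {0..M})" using s by blast
qed

end

section \<open>The topology of the boundary\<close>

locale connected_triangle_graph = thick_triangle_graph +
  assumes connected: "v \<in> \<Union>building \<Longrightarrow> w \<in> \<Union>building \<Longrightarrow> E\<^sup>*\<^sup>* v w"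
begin

lemma flat_vertex: "flat a \<Longrightarrow> a p \<in> \<Union>building"
  using flat_simplicial_iso(2)[of a] coxeter_vertex[of p] unfolding apartment_def by blast

lemma based_representative:
  assumes "\<omega> \<in> boundary building" "v \<in> \<Union>building"
  obtains a where "flat a" "a (0, 0) = v" "sector_of a \<in> \<omega>"
proof -
  obtain e where e: "flat e" "\<omega> = sector_class e"
    using boundary_iff[THEN iffD1, OF assms(1)] by blast
  obtain N where "\<forall>a. flat a \<longrightarrow> a (0, 0) = e (0, 0) \<longrightarrow> (\<exists>b c d. flat b \<and> b (0, 0) = v \<and> \<bar>c\<bar> \<le> N \<and> \<bar>d\<bar> \<le> N \<and>
     (\<forall>i j. N \<le> i \<longrightarrow> N \<le> j \<longrightarrow> b (i + c, j + d) = a (i, j)))"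
    using sector_change_base[OF connected[OF flat_vertex[OF e(1)] assms(2)]] by blast
  then obtain b c d where b: "flat b" "b (0, 0) = v"
    "\<forall>i j. N \<le> i \<longrightarrow> N \<le> j \<longrightarrow> b (i + c, j + d) = e (i, j)" using e(1) by blast
  then have "asymptotic e b" by (intro asymptoticI[of N]) blast
  then show thesis using that b e(2) by blast
qed

lemma rep_sector_eq:
  assumes "\<omega> \<in> boundary building" "flat a" "a (0, 0) = v" "sector_of a \<in> \<omega>"
  shows "rep_sector building v \<omega> = sector_of a"
  unfolding rep_sector_def
proof (rule the_equality)
  show "sector_of a \<in> \<omega> \<and> sector_at building v (sector_of a)"
    using assms sector_at_iff by blast
  fix S assume S: "S \<in> \<omega> \<and> sector_at building v S"
  then obtain b where b: "flat b" "b (0, 0) = v" "S = sector_of b" using sector_at_iff by blast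
  then have "asymptotic a b" using boundary_asymptotic[OF assms(1,4,2) b(1)] S by simp
  then have "a (i, j) = b (i, j)" if "0 \<le> i" "0 \<le> j" for i j
    using asymptotic_same_base[OF assms(2) b(1)] assms(3) b(2) that by simp
  then show "S = sector_of a" using sector_of_eq[of a b] b(3) by simp
qed

lemma hull_from_bounded:
  assumes "\<omega> \<in> boundary building" "flat b" "b (0, 0) = v" "sector_of b \<in> \<omega>"
    "u \<in> \<Union>(rep_sector building v \<omega>)"
  shows "\<exists>M\<ge>0. hull_from building v u \<omega> \<subseteq> flat_part b ({0..M} \<times> {0..M})"
proof -
  have rep: "rep_sector building v \<omega> = sector_of b" using rep_sector_eq[OF assms(1-4)] .
  then have "u \<in> {b (i, j) |i j. 0 \<le> i \<and> 0 \<le> j}" using assms(5) sector_of_vertices by simp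
  then obtain m n where mn: "u = b (m, n)" "0 \<le> m" "0 \<le> n" by blast
  define M where "M = max 1 (max m n)"
  have "hull_from building v u \<omega> =
      convex_hull building {{b (m, n)}, {b (0, 0), b (1, 0), b (0, 1)}}"
    unfolding hull_from_def rep mn(1) using base_chamber_sector[OF assms(2)] assms(3) by simp
  moreover have "m \<le> M" "n \<le> M" "1 \<le> M" by (auto simp: M_def)
  ultimately show ?thesis using hull_bounded[OF assms(2) mn(2) _ mn(3)] by (intro exI[of _ M]) simp
qed

lemma box_in_standard_cone: "s \<in> coxeter_A2_tilde \<Longrightarrow> s \<subseteq> {0..M} \<times> {0..M} \<Longrightarrow> s \<in> standard_cone"
  by (auto simp: standard_cone_def)

lemma basic_nbhd_contains_point:
  assumes "\<omega> \<in> boundary building" "v \<in> \<Union>building" "u \<in> \<Union>(rep_sector building v \<omega>)"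
  shows "\<omega> \<in> basic_nbhd building v u \<omega>"
proof -
  obtain b where b: "flat b" "b (0, 0) = v" "sector_of b \<in> \<omega>"
    using based_representative[OF assms(1,2)] by blast
  obtain M where "hull_from building v u \<omega> \<subseteq> flat_part b ({0..M} \<times> {0..M})"
    using hull_from_bounded[OF assms(1) b assms(3)] by blast
  also have "\<dots> \<subseteq> sector_of b" unfolding sector_of_def using box_in_standard_cone by blast
  finally show ?thesis unfolding basic_nbhd_def using rep_sector_eq[OF assms(1) b] assms(1) by simp
qed

text \<open>A single common vertex on the diagonal is enough: by \<open>parallelogram_unique\<close> it forces the sectors to
agree on the square \<open>{0..N} \<times> {0..N}\<close>.\<close>

definition cylinder :: "(int \<times> int \<Rightarrow> 'a) \<Rightarrow> int \<Rightarrow> 'a set set set set" where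
  "cylinder a N = {\<omega> \<in> boundary building. \<exists>b. flat b \<and> b (0, 0) = a (0, 0) \<and> b (N, N) = a (N, N) \<and>
     sector_of b \<in> \<omega>}"

lemma cylinder_antimono:
  assumes "flat a" "0 \<le> N" "N \<le> N'"
  shows "cylinder a N' \<subseteq> cylinder a N"
proof -
  have "b (N, N) = a (N, N)" if "flat b" "b (0, 0) = a (0, 0)" "b (N', N') = a (N', N')" for b
    using parallelogram_unique[OF that(1) assms(1) that(2,3)] assms by simp
  then show ?thesis unfolding cylinder_def by blast
qed

text \<open>The hull that defines the neighbourhood lies in a square \<open>{0..M} \<times> {0..M}\<close> of the sector based at
\<open>v\<close>.  Changing the base vertex moves coordinates by at most \<open>K\<close>, so that square is determined by
the vertex \<open>(M + K, M + K)\<close> of the sector with the original base vertex.\<close>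

lemma cylinder_in_basic_nbhd:
  assumes \<omega>0: "\<omega>0 \<in> boundary building" "v \<in> \<Union>building" "u \<in> \<Union>(rep_sector building v \<omega>0)"
    and \<omega>: "\<omega> \<in> basic_nbhd building v u \<omega>0" "flat a" "sector_of a \<in> \<omega>"
  shows "\<exists>N\<ge>0. cylinder a N \<subseteq> basic_nbhd building v u \<omega>0"
proof -
  have \<omega>b: "\<omega> \<in> boundary building" and hull: "hull_from building v u \<omega>0 \<subseteq> rep_sector building v \<omega>"
    using \<omega>(1) by (auto simp: basic_nbhd_def)
  obtain b0 where b0: "flat b0" "b0 (0, 0) = v" "sector_of b0 \<in> \<omega>0"
    using based_representative[OF \<omega>0(1,2)] by blast
  obtain M where M: "0 \<le> M"
    "hull_from building v u \<omega>0 \<subseteq> flat_part b0 ({0..M} \<times> {0..M})"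
    using hull_from_bounded[OF \<omega>0(1) b0 \<omega>0(3)] by blast
  obtain K where K: "0 \<le> K" "\<And>e. flat e \<Longrightarrow> e (0, 0) = a (0, 0) \<Longrightarrow>
      \<exists>b c d. flat b \<and> b (0, 0) = v \<and> \<bar>c\<bar> \<le> K \<and> \<bar>d\<bar> \<le> K \<and>
        (\<forall>i j. K \<le> i \<longrightarrow> K \<le> j \<longrightarrow> b (i + c, j + d) = e (i, j))"
    using sector_change_base[OF connected[OF flat_vertex[OF \<omega>(2)] \<omega>0(2)]] by metis
  obtain a' c d where a': "flat a'" "a' (0, 0) = v" "\<bar>c\<bar> \<le> K" "\<bar>d\<bar> \<le> K"
    "\<And>i j. K \<le> i \<Longrightarrow> K \<le> j \<Longrightarrow> a' (i + c, j + d) = a (i, j)"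
    using K(2)[OF \<omega>(2) HOL.refl] by blast
  have "asymptotic a a'" by (rule asymptoticI) (rule a'(5))
  then have "sector_of a' \<in> \<omega>" using boundary_asymptotic[OF \<omega>b \<omega>(3,2) a'(1)] by simp
  then have rep: "rep_sector building v \<omega> = sector_of a'" using rep_sector_eq[OF \<omega>b a'(1,2)] by blast
  have "cylinder a (M + K) \<subseteq> basic_nbhd building v u \<omega>0"
  proof
    fix \<omega>' assume "\<omega>' \<in> cylinder a (M + K)"
    then obtain b where b: "\<omega>' \<in> boundary building" "flat b" "b (0, 0) = a (0, 0)"
      "b (M + K, M + K) = a (M + K, M + K)" "sector_of b \<in> \<omega>'" unfolding cylinder_def by blast
    obtain b' c' d' where b': "flat b'" "b' (0, 0) = v" "\<bar>c'\<bar> \<le> K" "\<bar>d'\<bar> \<le> K"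
      "\<And>i j. K \<le> i \<Longrightarrow> K \<le> j \<Longrightarrow> b' (i + c', j + d') = b (i, j)"
      using K(2)[OF b(2,3)] by blast
    have "asymptotic b b'" by (rule asymptoticI) (rule b'(5))
    then have "sector_of b' \<in> \<omega>'" using boundary_asymptotic[OF b(1,5,2) b'(1)] by simp
    then have rep': "rep_sector building v \<omega>' = sector_of b'" using rep_sector_eq[OF b(1) b'(1,2)] by blast
    have far: "a' (M + K + c, M + K + d) = b' (M + K + c', M + K + d')"
      using a'(5)[of "M + K" "M + K"] b'(5)[of "M + K" "M + K"] b(4) M(1) by simp
    have pos: "M \<le> M + K + c" "M \<le> M + K + d" "0 \<le> M + K + c'" "0 \<le> M + K + d'"
      using a'(3,4) b'(3,4) M(1) by linarith+
    have base: "a' (0, 0) = b' (0, 0)" using a'(2) b'(2) by simp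
    have "0 \<le> M + K + c" "0 \<le> M + K + d" using pos M(1) by linarith+
    from parallelogram_unique[OF a'(1) b'(1) base far this pos(3,4)]
    have agree: "a' (i, j) = b' (i, j)" if "0 \<le> i" "i \<le> M" "0 \<le> j" "j \<le> M" for i j
      using that pos(1,2) by auto
    have "x \<in> sector_of b'" if x: "x \<in> hull_from building v u \<omega>0" for x
    proof -
      obtain s0 where s0: "x = b0 ` s0" "s0 \<subseteq> {0..M} \<times> {0..M}" using M(2) x by blast
      obtain s where s: "x = a' ` s" "s \<in> standard_cone"
        using hull rep x unfolding sector_of_def by blast
      \<comment> \<open>A vertex common to two flats with the same origin has the same coordinates in both.\<close>
      have box: "0 \<le> i \<and> i \<le> M \<and> 0 \<le> j \<and> j \<le> M" if ij: "(i, j) \<in> s" for i j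
      proof -
        have "a' (i, j) \<in> b0 ` s0" using ij s(1) s0(1) by blast
        then obtain k l where kl: "a' (i, j) = b0 (k, l)" "(k, l) \<in> s0" by auto
        then have "0 \<le> k" "0 \<le> l" "k \<le> M" "l \<le> M" using s0(2) by auto
        moreover have "0 \<le> i" "0 \<le> j" using standard_cone_quadrant[OF s(2) ij] by auto
        moreover have "a' (0, 0) = b0 (0, 0)" using a'(2) b0(2) by simp
        ultimately show ?thesis using parallelogram_unique[OF a'(1) b0(1) _ kl(1)] by simp
      qed
      have "x = b' ` s" unfolding s(1) by (rule image_cong[OF HOL.refl]) (use box agree in auto)
      then show ?thesis using s(2) by (simp add: sector_of_def)
    qed
    then show "\<omega>' \<in> basic_nbhd building v u \<omega>0" using b(1) rep' by (auto simp: basic_nbhd_def)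
  qed
  then show ?thesis using M(1) K(1) by (intro exI[of _ "M + K"]) simp
qed

text \<open>The cylinders around a boundary point are nested.  Hence the property of containing, with each
point, a cylinder around it passes from the generating neighbourhoods to finite intersections and to
unions, and so holds for all open sets.\<close>

theorem dense_if_meets_cylinders:
  assumes o: "o' \<in> \<Union>building" and D: "D \<subseteq> boundary building"
    and meets: "\<And>a N. flat a \<Longrightarrow> a (0, 0) = o' \<Longrightarrow> 0 \<le> N \<Longrightarrow> D \<inter> cylinder a N \<noteq> {}"
  shows "boundary_topology building closure_of D = boundary building"
proof -
  define B where "B = {basic_nbhd building v u \<omega> |v u \<omega>. \<omega> \<in> boundary building \<and> v \<in> \<Union>building \<and>
      u \<in> \<Union>(rep_sector building v \<omega>)}"
  have topo: "boundary_topology building = topology_generated_by B"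
    by (simp add: boundary_topology_def B_def)
  have "\<Union>B \<subseteq> boundary building" by (auto simp: B_def basic_nbhd_def)
  moreover have "\<omega> \<in> \<Union>B" if \<omega>: "\<omega> \<in> boundary building" for \<omega>
  proof -
    obtain a where a: "flat a" "a (0, 0) = o'" "sector_of a \<in> \<omega>"
      using based_representative[OF \<omega> o] by blast
    have "a (0, 0) \<in> \<Union>(sector_of a)" using sector_of_vertices[of a] by force
    then have u: "o' \<in> \<Union>(rep_sector building o' \<omega>)" using rep_sector_eq[OF \<omega> a] a(2) by simp
    then show ?thesis using basic_nbhd_contains_point[OF \<omega> o u] \<omega> o unfolding B_def by blast
  qed
  ultimately have space: "topspace (topology_generated_by B) = boundary building" by auto
  have cyl: "\<exists>N\<ge>0. cylinder a N \<subseteq> U"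
    if "generate_topology_on B U" "\<omega> \<in> U" "\<omega> \<in> boundary building" "flat a" "a (0, 0) = o'" "sector_of a \<in> \<omega>"
    for U \<omega> a
    using that(1,2)
  proof (induction rule: generate_topology_on.induct)
    case (Int U V)
    then obtain N N' where N: "N \<ge> 0" "cylinder a N \<subseteq> U" "N' \<ge> 0" "cylinder a N' \<subseteq> V" by blast
    have "cylinder a (max N N') \<subseteq> cylinder a N" "cylinder a (max N N') \<subseteq> cylinder a N'"
      using cylinder_antimono[OF that(4)] N by auto
    then show ?case using N by (intro exI[of _ "max N N'"]) auto
  next
    case (UN \<U>)
    then obtain U where "U \<in> \<U>" "\<omega> \<in> U" by blast
    then show ?case using UN.IH[of U] by blast
  next
    case (Basis U)
    then obtain v u \<omega>0 where "U = basic_nbhd building v u \<omega>0" "\<omega>0 \<in> boundary building" "v \<in> \<Union>building"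
      "u \<in> \<Union>(rep_sector building v \<omega>0)" unfolding B_def by blast
    then show ?case using cylinder_in_basic_nbhd[of \<omega>0 v u \<omega> a] Basis.prems that(4,6) by blast
  qed simp
  have "boundary building \<subseteq> topology_generated_by B closure_of D"
  proof
    fix \<omega> assume \<omega>: "\<omega> \<in> boundary building"
    obtain a where a: "flat a" "a (0, 0) = o'" "sector_of a \<in> \<omega>"
      using based_representative[OF \<omega> o] by blast
    have "\<exists>y. y \<in> D \<and> y \<in> U" if U: "\<omega> \<in> U" "openin (topology_generated_by B) U" for U
    proof -
      obtain N where "0 \<le> N" "cylinder a N \<subseteq> U"
        using cyl[OF openin_topology_generated_by[OF U(2)] U(1) \<omega> a] by blast
      then show ?thesis using meets[OF a(1,2)] by blast
    qed
    then show "\<omega> \<in> topology_generated_by B closure_of D" using \<omega> space by (auto simp: in_closure_of)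
  qed
  then show ?thesis using closure_of_subset_topspace[of "topology_generated_by B" D] space topo by auto
qed

end

section \<open>Normal forms in a triangle group\<close>

text \<open>The line \<open>\<lambda>(x)\<close> is represented by \<open>x\<close>, so a point \<open>y\<close> is on the line \<open>x\<close> when \<open>(x, y, z)\<close> is in \<open>T\<close> for
some \<open>z\<close>.  The last three assumptions are the incidence axioms of a projective plane in these terms.\<close>

locale triangle_structure =
  fixes P :: "'p set" and T :: "('p \<times> 'p \<times> 'p) set"
  assumes T_in: "(x, y, z) \<in> T \<Longrightarrow> x \<in> P \<and> y \<in> P \<and> z \<in> P"
    and T_rot: "(x, y, z) \<in> T \<Longrightarrow> (y, z, x) \<in> T"
    and T_fun: "(x, y, z) \<in> T \<Longrightarrow> (x, y, z') \<in> T \<Longrightarrow> z = z'"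
    and T_ex: "x \<in> P \<Longrightarrow> \<exists>y z. (x, y, z) \<in> T"
    and common_pred: "x \<in> P \<Longrightarrow> y \<in> P \<Longrightarrow> x \<noteq> y \<Longrightarrow> \<exists>u s t. (u, x, s) \<in> T \<and> (u, y, t) \<in> T"
    and common_succ: "x \<in> P \<Longrightarrow> y \<in> P \<Longrightarrow> x \<noteq> y \<Longrightarrow> \<exists>u s t. (x, u, s) \<in> T \<and> (y, u, t) \<in> T"
    and no_square: "(u, x, s) \<in> T \<Longrightarrow> (u, y, s') \<in> T \<Longrightarrow> (v, x, t) \<in> T \<Longrightarrow> (v, y, t') \<in> T
      \<Longrightarrow> x \<noteq> y \<Longrightarrow> u = v"
begin

definition inc :: "'p \<Rightarrow> 'p \<Rightarrow> bool" where
  "inc x y \<longleftrightarrow> (\<exists>z. (x, y, z) \<in> T)"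

definition third :: "'p \<Rightarrow> 'p \<Rightarrow> 'p" where
  "third x y = (THE z. (x, y, z) \<in> T)"

definition join :: "'p \<Rightarrow> 'p \<Rightarrow> 'p" where
  "join x y = (THE u. inc u x \<and> inc u y)"

lemma third_eq: "(x, y, z) \<in> T \<Longrightarrow> third x y = z"
  unfolding third_def using T_fun by blast

lemma incI: "(x, y, z) \<in> T \<Longrightarrow> inc x y"
  unfolding inc_def by blast

lemma inc_no_square: "inc u x \<Longrightarrow> inc u y \<Longrightarrow> inc v x \<Longrightarrow> inc v y \<Longrightarrow> u = v \<or> x = y"
  unfolding inc_def using no_square by blast

lemma join_eq: "x \<noteq> y \<Longrightarrow> inc u x \<Longrightarrow> inc u y \<Longrightarrow> join x y = u"
  unfolding join_def using inc_no_square by blast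

lemma T_fun1: "(x, y, z) \<in> T \<Longrightarrow> (x', y, z) \<in> T \<Longrightarrow> x = x'"
  using T_rot T_fun by blast

lemma T_fun2: "(x, y, z) \<in> T \<Longrightarrow> (x, y', z) \<in> T \<Longrightarrow> y = y'"
  using T_rot T_fun by blast

text \<open>A pair \<open>(xs, ys)\<close> of lists stands for the product of the generators in \<open>xs\<close> followed by the inverses
of the generators in \<open>ys\<close>.  Multiplication by \<open>a\<^sub>z\<^sup>-\<^sup>1\<close> from the left either prolongs \<open>ys\<close> or, if
\<open>(y, z, w)\<close> is in \<open>T\<close>, replaces \<open>a\<^sub>z\<^sup>-\<^sup>1 a\<^sub>y\<^sup>-\<^sup>1\<close> by \<open>a\<^sub>w\<close>.\<close>

definition inv_cons :: "'p \<Rightarrow> 'p list \<Rightarrow> 'p list \<times> 'p list" where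
  "inv_cons z ys = (case ys of [] \<Rightarrow> ([], [z])
     | y # ys' \<Rightarrow> if inc y z then ([third y z], ys') else ([], z # ys))"

text \<open>Left multiplication by \<open>a\<^sub>z\<^sup>-\<^sup>1\<close>, which moves through \<open>xs\<close> from left to right.  For \<open>x \<noteq> z\<close> let \<open>u\<close> be the
line joining \<open>x\<close> and \<open>z\<close>, with \<open>(u, z, x')\<close> and \<open>(u, x, z')\<close> in \<open>T\<close>; then \<open>a\<^sub>z a\<^sub>x\<^sub>'\<close> and \<open>a\<^sub>x a\<^sub>z\<^sub>'\<close> both are
\<open>a\<^sub>u\<^sup>-\<^sup>1\<close>, and therefore \<open>a\<^sub>z\<^sup>-\<^sup>1 a\<^sub>x = a\<^sub>x\<^sub>' a\<^sub>z\<^sub>'\<^sup>-\<^sup>1\<close>.\<close>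

primrec inv_mult :: "'p list \<Rightarrow> 'p \<Rightarrow> 'p list \<Rightarrow> 'p list \<times> 'p list" where
  "inv_mult [] z ys = inv_cons z ys"
| "inv_mult (x # xs) z ys =
     (if x = z then (xs, ys)
      else apfst ((#) (third (join z x) z)) (inv_mult xs (third (join z x) x) ys))"

text \<open>Left multiplication by \<open>a\<^sub>x\<close>; if \<open>(x, x', z)\<close> is in \<open>T\<close>, then \<open>a\<^sub>x a\<^sub>x\<^sub>' = a\<^sub>z\<^sup>-\<^sup>1\<close>.\<close>

fun gen_mult :: "'p list \<Rightarrow> 'p \<Rightarrow> 'p list \<Rightarrow> 'p list \<times> 'p list" where
  "gen_mult [] x [] = ([x], [])"
| "gen_mult [] x (y # ys) = (if x = y then ([], ys) else ([x], y # ys))"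
| "gen_mult (x' # xs) x ys =
     (if inc x x' then inv_mult xs (third x x') ys else (x # x' # xs, ys))"

fun consable :: "'p \<Rightarrow> 'p list \<times> 'p list \<Rightarrow> bool" where
  "consable x ([], []) \<longleftrightarrow> True"
| "consable x ([], y # ys) \<longleftrightarrow> x \<noteq> y"
| "consable x (x' # xs, ys) \<longleftrightarrow> \<not> inc x x'"

fun normal :: "'p list \<Rightarrow> 'p list \<Rightarrow> bool" where
  "normal [] [] \<longleftrightarrow> True"
| "normal [] (y # ys) \<longleftrightarrow> y \<in> P \<and> normal [] ys \<and> (ys = [] \<or> \<not> inc (hd ys) y)"
| "normal (x # xs) ys \<longleftrightarrow> x \<in> P \<and> consable x (xs, ys) \<and> normal xs ys"

lemma consable_apfst [simp]: "consable x (apfst ((#) x') w) \<longleftrightarrow> \<not> inc x x'"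
  by (cases w) simp

lemma gen_mult_consable: "consable x (xs, ys) \<Longrightarrow> gen_mult xs x ys = (x # xs, ys)"
  by (cases xs; cases ys) auto

lemma inv_mult_flip:
  assumes "x \<noteq> z" "(u, z, x') \<in> T" "(u, x, z') \<in> T"
  shows "inv_mult (x # xs) z ys = apfst ((#) x') (inv_mult xs z' ys)"
proof -
  have "join z x = u" using assms by (auto intro!: join_eq incI)
  with assms show ?thesis by (simp add: third_eq)
qed

lemma inv_cons_red: "(y, z, w) \<in> T \<Longrightarrow> inv_cons z (y # ys) = ([w], ys)"
  by (simp add: inv_cons_def third_eq incI)

lemma inv_cons_normal: "normal [] (z # ys) \<Longrightarrow> inv_cons z ys = ([], z # ys)"
  by (cases ys) (auto simp: inv_cons_def)

lemma gen_mult_red: "(x, x', z) \<in> T \<Longrightarrow> gen_mult (x' # xs) x ys = inv_mult xs z ys"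
  by (auto simp: third_eq incI)

text \<open>This is the relation \<open>a\<^sub>x a\<^sub>z a\<^sub>u = 1\<close> in the form \<open>a\<^sub>u\<^sup>-\<^sup>1 a\<^sub>z\<^sup>-\<^sup>1 = a\<^sub>x\<close>.  When both factors pass a letter
of \<open>xs\<close>, they become two factors that satisfy a relation of the same form, to which the induction
hypothesis applies.\<close>

lemma inv_inv_mult:
  assumes "normal xs ys" "(x, z, u) \<in> T"
  shows "(case inv_mult xs z ys of (xs', ys') \<Rightarrow> inv_mult xs' u ys') = gen_mult xs x ys"
  using assms
proof (induction xs arbitrary: x z u)
  case Nil
  have Tz: "(z, u, x) \<in> T" using Nil T_rot by blast
  show ?case
  proof (cases ys)
    case [simp]: Nil
    show ?thesis using Tz by (simp add: inv_cons_def third_eq incI)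
  next
    case [simp]: (Cons y ys')
    show ?thesis
    proof (cases "inc y z")
      case True
      then obtain v where v: "(y, z, v) \<in> T" by (auto simp: inc_def)
      have Tv: "(z, v, y) \<in> T" using v T_rot by blast
      show ?thesis
      proof (cases "u = v")
        case True
        then have "x = y" using v Nil T_fun1 by blast
        then show ?thesis using True inv_cons_red[OF v] by simp
      next
        case False
        then have "x \<noteq> y" using v Nil T_fun by blast
        moreover have "inv_cons y ys' = ([], y # ys')"
          using Nil by (intro inv_cons_normal) simp
        ultimately show ?thesis
          using inv_cons_red[OF v] inv_mult_flip[of v u z x y "[]" ys'] False Tz Tv by simp
      qed
    next
      case False
      then have "x \<noteq> y" using Nil incI by blast
      then show ?thesis using False inv_cons_red[OF Tz, of ys]
        by (simp add: inv_cons_def[of z])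
    qed
  qed
next
  case (Cons v xs)
  have Tz: "(z, u, x) \<in> T" using Cons.prems T_rot by blast
  show ?case
  proof (cases "z = v")
    case True
    then show ?thesis using Cons.prems by (simp add: third_eq incI)
  next
    case False
    have "v \<in> P" "z \<in> P" using Cons.prems T_in by auto
    then obtain s t z' where s: "(s, z, t) \<in> T" "(s, v, z') \<in> T"
      using common_pred False by metis
    have L: "inv_mult (v # xs) z ys = apfst ((#) t) (inv_mult xs z' ys)"
      using inv_mult_flip[OF _ s] False by auto
    show ?thesis
    proof (cases "u = t")
      case True
      then have "s = x" using s Cons.prems T_fun1 by blast
      then show ?thesis using L True s by (auto simp: split_beta third_eq incI)
    next
      case f: False
      have Tt: "(z, t, s) \<in> T" using s T_rot by blast
      have ni: "\<not> inc x v"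
      proof
        assume "inc x v"
        then have "x = s" using Cons.prems(2) s False inc_no_square incI by blast
        then show False using f s Cons.prems T_fun by blast
      qed
      have "(v, z', s) \<in> T" using s T_rot by blast
      then have IH: "(case inv_mult xs z' ys of (xs', ys') \<Rightarrow> inv_mult xs' s ys') = gen_mult xs v ys"
        using Cons by auto
      have "gen_mult xs v ys = (v # xs, ys)" using Cons.prems by (intro gen_mult_consable) auto
      then show ?thesis using L IH inv_mult_flip[of t u z x s] f Tt Tz ni
        by (auto simp: split_beta)
    qed
  qed
qed

text \<open>After the first exchange \<open>a\<^sub>z a\<^sub>x\<^sub>'\<close> becomes \<open>a\<^sub>u\<^sup>-\<^sup>1\<close>, and the remaining product \<open>a\<^sub>u\<^sup>-\<^sup>1 a\<^sub>z\<^sub>'\<^sup>-\<^sup>1\<close> is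
evaluated by \<open>inv_inv_mult\<close>.\<close>

lemma gen_inv_mult:
  assumes "normal xs ys" "z \<in> P"
  shows "(case inv_mult xs z ys of (xs', ys') \<Rightarrow> gen_mult xs' z ys') = (xs, ys)"
proof (cases xs)
  case [simp]: Nil
  show ?thesis
  proof (cases ys)
    case Nil
    then show ?thesis by (simp add: inv_cons_def)
  next
    case [simp]: (Cons y ys')
    show ?thesis
    proof (cases "inc y z")
      case True
      then obtain w where w: "(y, z, w) \<in> T" by (auto simp: inc_def)
      then have "(z, w, y) \<in> T" using T_rot by blast
      then show ?thesis using inv_cons_red[OF w] inv_cons_normal[of y ys'] assms
        by (simp add: third_eq incI)
    qed (simp add: inv_cons_def)
  qed
next
  case [simp]: (Cons x xs')
  show ?thesis
  proof (cases "x = z")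
    case True
    then show ?thesis using assms by (auto simp: gen_mult_consable)
  next
    case False
    have "x \<in> P" using assms by auto
    then obtain u x' z' where u: "(u, z, x') \<in> T" "(u, x, z') \<in> T"
      using common_pred False assms by metis
    have "(z, x', u) \<in> T" "(x, z', u) \<in> T" using u T_rot by blast+
    moreover have "gen_mult xs' x ys = (x # xs', ys)" using assms by (intro gen_mult_consable) auto
    ultimately show ?thesis using inv_mult_flip[OF False u] inv_inv_mult[of xs' ys x z' u] assms
      by (auto simp: split_beta third_eq incI)
  qed
qed

text \<open>An exchange of \<open>a\<^sub>z\<^sup>-\<^sup>1\<close> with \<open>a\<^sub>v\<close> puts \<open>a\<^sub>x\<close> in front of the result of the recursion.  If \<open>a\<^sub>x\<close> could be merged
with its first letter, that letter would be \<open>y\<close>, the only point common to the lines \<open>x\<close> and \<open>u\<close>,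
and then the original word would not have been normal at \<open>v\<close>.\<close>

lemma consable_inv_mult:
  assumes "normal (v # xs) ys" "(y, v, u) \<in> T" "(y, z, x) \<in> T" "z \<noteq> v"
  shows "consable x (inv_mult xs u ys)"
proof -
  have xu: "x \<noteq> u" using assms T_fun2 by blast
  have Ty: "(u, y, v) \<in> T" "(x, y, z) \<in> T" using assms T_rot by blast+
  have *: "h = y" if "inc x h" "inc u h" for h
    using that Ty xu inc_no_square incI by blast
  show ?thesis
  proof (cases xs)
    case [simp]: Nil
    show ?thesis
    proof (cases ys)
      case [simp]: (Cons y1 ys')
      show ?thesis
      proof (cases "inc y1 u")
        case True
        then obtain h where h: "(y1, u, h) \<in> T" by (auto simp: inc_def)
        then have uh: "(u, h, y1) \<in> T" using T_rot by blast
        have "\<not> inc x h"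
        proof
          assume "inc x h"
          then have "h = y" using * uh incI by blast
          then have "v = y1" using uh Ty T_fun by blast
          then show False using assms by simp
        qed
        then show ?thesis using inv_cons_red[OF h] by simp
      qed (simp add: inv_cons_def xu)
    qed (simp add: inv_cons_def xu)
  next
    case [simp]: (Cons v2 xs')
    have "(v, u, y) \<in> T" using assms T_rot by blast
    then have "u \<noteq> v2" using assms incI by auto
    moreover have "v2 \<in> P" "u \<in> P" using assms T_in by auto
    ultimately obtain s t t' where s: "(s, u, t) \<in> T" "(s, v2, t') \<in> T"
      using common_pred by metis
    have ut: "(u, t, s) \<in> T" using s T_rot by blast
    have "\<not> inc x t"
    proof
      assume "inc x t"
      then have "t = y" using * ut incI by blast
      then have "s = v" using ut Ty T_fun by blast
      then show False using assms s incI by auto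
    qed
    then show ?thesis using inv_mult_flip[OF _ s] \<open>u \<noteq> v2\<close> by simp
  qed
qed

lemma gen_gen_mult:
  assumes "normal xs ys" "(x, y, z) \<in> T"
  shows "(case gen_mult xs y ys of (xs', ys') \<Rightarrow> gen_mult xs' x ys') = inv_mult xs z ys"
proof (cases "consable y (xs, ys)")
  case True
  then show ?thesis using gen_mult_consable assms gen_mult_red by auto
next
  case False
  have Ty: "(y, z, x) \<in> T" using assms T_rot by blast
  show ?thesis
  proof (cases xs)
    case [simp]: Nil
    then obtain ys' where [simp]: "ys = y # ys'" using False by (cases ys) auto
    have "consable x ([], ys')" using assms incI by (cases ys') auto
    then show ?thesis using inv_cons_red[OF Ty] by (simp add: gen_mult_consable)
  next
    case [simp]: (Cons v xs')
    then obtain u where u: "(y, v, u) \<in> T" using False by (auto simp: inc_def)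
    have uP: "u \<in> P" using u T_in by blast
    show ?thesis
    proof (cases "z = v")
      case True
      then have "u = x" using u Ty T_fun by blast
      then show ?thesis using True gen_mult_red[OF u] gen_inv_mult[of xs' ys u] assms uP by simp
    next
      case f: False
      obtain as bs where w: "inv_mult xs' u ys = (as, bs)" by fastforce
      have "consable x (as, bs)"
        using consable_inv_mult[of v xs' ys y u z x] u Ty f assms w by simp
      moreover have "gen_mult xs y ys = (as, bs)" using gen_mult_red[OF u] w by simp
      ultimately show ?thesis using inv_mult_flip[of v z y x u xs' ys] Ty u f w
        by (simp add: gen_mult_consable del: inv_mult.simps)
    qed
  qed
qed

lemma normal_inv_mult: "normal xs ys \<Longrightarrow> z \<in> P \<Longrightarrow> case_prod normal (inv_mult xs z ys)"
proof (induction xs arbitrary: z)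
  case Nil
  show ?case
  proof (cases ys)
    case (Cons y ys')
    show ?thesis
    proof (cases "inc y z")
      case True
      then obtain w where w: "(y, z, w) \<in> T" by (auto simp: inc_def)
      have "(w, y, z) \<in> T" using w T_rot by blast
      then have "consable w ([], ys')" using Nil Cons incI by (cases ys') auto
      then show ?thesis using inv_cons_red[OF w] Nil Cons T_in[OF w] by simp
    qed (use Nil Cons in \<open>auto simp: inv_cons_def\<close>)
  qed (use Nil in \<open>auto simp: inv_cons_def\<close>)
next
  case (Cons x xs)
  show ?case
  proof (cases "x = z")
    case False
    have "x \<in> P" using Cons.prems by auto
    then obtain u x' z' where u: "(u, z, x') \<in> T" "(u, x, z') \<in> T"
      using common_pred False Cons.prems by metis
    have "consable x' (inv_mult xs z' ys)"
      using consable_inv_mult[OF Cons.prems(1) u(2,1)] False by auto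
    then show ?thesis using inv_mult_flip[OF False u] Cons u T_in by (auto simp: split_beta)
  qed (use Cons in auto)
qed

lemma normal_gen_mult: "normal xs ys \<Longrightarrow> x \<in> P \<Longrightarrow> case_prod normal (gen_mult xs x ys)"
proof (cases "consable x (xs, ys)")
  case False
  assume a: "normal xs ys" "x \<in> P"
  show ?thesis
  proof (cases xs)
    case Nil
    then show ?thesis using a False by (cases ys) auto
  next
    case (Cons v xs')
    then obtain u where u: "(x, v, u) \<in> T" using False by (auto simp: inc_def)
    show ?thesis using gen_mult_red[OF u] normal_inv_mult a T_in[OF u] Cons by auto
  qed
qed (auto simp: gen_mult_consable)

text \<open>Words act on normal forms.  All relators act trivially, so congruent words act alike, and a
normal word carries the empty normal form to the normal form that it spells.\<close>

fun act :: "'p \<times> bool \<Rightarrow> 'p list \<times> 'p list \<Rightarrow> 'p list \<times> 'p list" where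
  "act (x, True) (xs, ys) = gen_mult xs x ys"
| "act (x, False) (xs, ys) = inv_mult xs x ys"

lemma act_gen: "act (x, True) w = (case w of (xs, ys) \<Rightarrow> gen_mult xs x ys)"
  by (cases w) simp

lemma normal_act: "case_prod normal w \<Longrightarrow> x \<in> P \<Longrightarrow> case_prod normal (act (x, b) w)"
  using normal_gen_mult normal_inv_mult by (cases w; cases b) auto

lemma act_gen_inv: "case_prod normal w \<Longrightarrow> x \<in> P \<Longrightarrow> act (x, True) (act (x, False) w) = w"
  using gen_inv_mult by (cases w) (auto simp: act_gen)

lemma act_gen_gen:
  "case_prod normal w \<Longrightarrow> (x, y, z) \<in> T \<Longrightarrow> act (x, True) (act (y, True) w) = act (z, False) w"
  using gen_gen_mult by (cases w) (auto simp: act_gen)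

lemma act_relator:
  assumes "case_prod normal w" "(x, y, z) \<in> T"
  shows "act (x, True) (act (y, True) (act (z, True) w)) = w"
proof -
  have "(y, z, x) \<in> T" using assms T_rot by blast
  then show ?thesis using act_gen_gen[of w y z x] act_gen_inv[of w x] assms T_in by simp
qed

lemma act_inv_gen:
  assumes "case_prod normal w" "x \<in> P"
  shows "act (x, False) (act (x, True) w) = w"
proof -
  obtain y z where "(x, y, z) \<in> T" using T_ex assms by blast
  then have "(y, z, x) \<in> T" using T_rot by blast
  then show ?thesis
    using act_gen_gen[OF normal_act[OF assms, of True], of y z x] act_relator[OF assms(1)] by simp
qed

lemma normal_foldr_act:
  "case_prod normal w \<Longrightarrow> u \<in> words P \<Longrightarrow> case_prod normal (foldr act u w)"
proof (induction u)
  case (Cons c u)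
  then show ?case using normal_act by (cases c) (auto simp: words_def)
qed auto

lemma word_cong_act:
  "(u, v) \<in> word_cong P (triangle_relators T) \<Longrightarrow> case_prod normal w
    \<Longrightarrow> foldr act u w = foldr act v w"
proof (induction rule: word_cong.induct)
  case (cancel u v x b)
  then show ?case using normal_foldr_act[of w v] act_inv_gen act_gen_inv by (cases b) auto
next
  case (relator u v r)
  then show ?case using normal_foldr_act[of w v] act_relator by (auto simp: triangle_relators_def)
qed auto

definition normal_word :: "'p list \<Rightarrow> 'p list \<Rightarrow> ('p \<times> bool) list" where
  "normal_word xs ys = map (\<lambda>x. (x, True)) xs @ map (\<lambda>y. (y, False)) ys"

lemma normal_word_words: "normal xs ys \<Longrightarrow> normal_word xs ys \<in> words P"
  by (induction xs ys rule: normal.induct) (auto simp: normal_word_def words_def)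

lemma act_normal_word: "normal xs ys \<Longrightarrow> foldr act (normal_word xs ys) ([], []) = (xs, ys)"
proof (induction xs ys rule: normal.induct)
  case (2 y ys)
  then show ?case using inv_cons_normal[of y ys] by (auto simp: normal_word_def)
next
  case (3 x xs ys)
  then show ?case by (auto simp: normal_word_def gen_mult_consable)
qed (auto simp: normal_word_def)

abbreviation word_class :: "('p \<times> bool) list \<Rightarrow> ('p \<times> bool) list set" where
  "word_class w \<equiv> word_cong P (triangle_relators T) `` {w}"

abbreviation \<Gamma> where "\<Gamma> \<equiv> triangle_group P T"

abbreviation mult_\<Gamma> (infixl "\<cdot>" 70) where "g \<cdot> h \<equiv> g \<otimes>\<^bsub>\<Gamma>\<^esub> h"

abbreviation inv_\<Gamma> ("\<iota>") where "\<iota> \<equiv> m_inv \<Gamma>"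

abbreviation one_\<Gamma> ("\<e>") where "\<e> \<equiv> \<one>\<^bsub>\<Gamma>\<^esub>"

theorem normal_word_unique:
  assumes "normal xs ys" "normal xs' ys'"
    "word_class (normal_word xs ys) = word_class (normal_word xs' ys')"
  shows "xs = xs' \<and> ys = ys'"
proof -
  have "normal_word xs ys \<in> words P" "normal_word xs' ys' \<in> words P"
    using normal_word_words assms by auto
  then have "(normal_word xs ys, normal_word xs' ys') \<in> word_cong P (triangle_relators T)"
    using assms(3) eq_equiv_class[OF _ equiv_word_cong] by metis
  from word_cong_act[OF this, of "([], [])"] show ?thesis
    using assms act_normal_word by auto
qed

lemma group_\<Gamma>: "group \<Gamma>"
  by (simp add: triangle_group_def group_presented_group)

lemma word_class_carrier: "u \<in> words P \<Longrightarrow> word_class u \<in> carrier \<Gamma>"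
  using carrier_presented_group triangle_group_def by metis

lemma word_class_append:
  "u \<in> words P \<Longrightarrow> v \<in> words P \<Longrightarrow> word_class (u @ v) = word_class u \<cdot> word_class v"
  by (simp add: presented_group_mult triangle_group_def)

lemma word_class_Nil: "word_class [] = \<e>"
  by (simp add: one_presented_group triangle_group_def)

lemma gen_carrier: "x \<in> P \<Longrightarrow> gen P T x \<in> carrier \<Gamma>"
  unfolding gen_def by (rule word_class_carrier) (simp add: words_def)

lemma word_class_inv:
  assumes "x \<in> P"
  shows "word_class [(x, False)] = \<iota> (gen P T x)"
proof -
  interpret group \<Gamma> by (rule group_\<Gamma>)
  have w: "[(x, False)] \<in> words P" "[(x, True)] \<in> words P" using assms by (auto simp: words_def)
  have "word_class [(x, False), (x, True)] = word_class []"
    using word_cong.cancel[of "[]" P "[]" x False "triangle_relators T"] assms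
      equiv_class_eq[OF equiv_word_cong] by fastforce
  then have "word_class [(x, False)] \<cdot> gen P T x = \<e>"
    using word_class_append[OF w] word_class_Nil by (simp add: gen_def)
  then show ?thesis using word_class_carrier w gen_carrier assms inv_equality by metis
qed

lemma gen_relation:
  assumes "(x, y, z) \<in> T"
  shows "gen P T x \<cdot> gen P T y \<cdot> gen P T z = \<e>"
proof -
  have P: "x \<in> P" "y \<in> P" "z \<in> P" using assms T_in by auto
  then have w: "[(x, True)] \<in> words P" "[(y, True)] \<in> words P" "[(z, True)] \<in> words P"
    by (auto simp: words_def)
  have "[(x, True), (y, True), (z, True)] \<in> triangle_relators T \<inter> words P"
    using P assms by (auto simp: words_def triangle_relators_def)
  from word_cong.relator[OF words_Nil words_Nil this]
  have "word_class [(x, True), (y, True), (z, True)] = word_class []"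
    using equiv_class_eq[OF equiv_word_cong] by fastforce
  then show ?thesis
    using word_class_append[of "[(x, True)]" "[(y, True)]"]
      word_class_append[of "[(x, True), (y, True)]" "[(z, True)]"] w P
    by (simp add: gen_def word_class_Nil words_def)
qed

end

section \<open>The Cayley graph of a triangle group\<close>

context triangle_structure
begin

definition edge :: "('p \<times> bool) list set \<Rightarrow> ('p \<times> bool) list set \<Rightarrow> bool" where
  "edge g h \<longleftrightarrow> g \<in> carrier \<Gamma> \<and> oriented_edge P T g h"

interpretation \<Gamma>: group \<Gamma> by (rule group_\<Gamma>)

lemma edge_iff: "edge g h \<longleftrightarrow> g \<in> carrier \<Gamma> \<and> (\<exists>x\<in>P. h = g \<cdot> gen P T x)"
  by (simp add: edge_def oriented_edge_def)

lemma edge_iff_inv: "edge h g \<longleftrightarrow> g \<in> carrier \<Gamma> \<and> (\<exists>x\<in>P. h = g \<cdot> \<iota> (gen P T x))"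
proof
  assume "edge h g"
  then obtain x where "h \<in> carrier \<Gamma>" "x \<in> P" "g = h \<cdot> gen P T x" by (auto simp: edge_iff)
  then show "g \<in> carrier \<Gamma> \<and> (\<exists>x\<in>P. h = g \<cdot> \<iota> (gen P T x))"
    using gen_carrier by (auto simp: \<Gamma>.m_assoc intro!: bexI[of _ x])
next
  assume "g \<in> carrier \<Gamma> \<and> (\<exists>x\<in>P. h = g \<cdot> \<iota> (gen P T x))"
  then obtain x where "g \<in> carrier \<Gamma>" "x \<in> P" "h = g \<cdot> \<iota> (gen P T x)" by blast
  then show "edge h g"
    unfolding edge_iff using gen_carrier by (auto simp: \<Gamma>.m_assoc intro!: bexI[of _ x])
qed

lemma edge_carrier: "edge g h \<Longrightarrow> g \<in> carrier \<Gamma> \<and> h \<in> carrier \<Gamma>"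
  using gen_carrier by (auto simp: edge_iff)

lemma gen_word_class: "gen P T x = word_class [(x, True)]"
  by (simp add: gen_def)

lemma gen_inj: "x \<in> P \<Longrightarrow> y \<in> P \<Longrightarrow> gen P T x = gen P T y \<Longrightarrow> x = y"
  using normal_word_unique[of "[x]" "[]" "[y]" "[]"] by (simp add: gen_word_class normal_word_def)

lemma gen_product_iff:
  assumes "x \<in> P" "y \<in> P" "z \<in> P"
  shows "gen P T x \<cdot> gen P T y \<cdot> gen P T z = \<e> \<longleftrightarrow> (x, y, z) \<in> T"
proof
  assume eq: "gen P T x \<cdot> gen P T y \<cdot> gen P T z = \<e>"
  note c = gen_carrier[OF assms(1)] gen_carrier[OF assms(2)] gen_carrier[OF assms(3)]
  have xy: "gen P T x \<cdot> gen P T y = \<iota> (gen P T z)"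
    using \<Gamma>.inv_equality[OF eq] c by simp
  show "(x, y, z) \<in> T"
  proof (cases "inc x y")
    case True
    then obtain t where t: "(x, y, t) \<in> T" by (auto simp: inc_def)
    then have tP: "t \<in> P" using T_in by blast
    have "gen P T x \<cdot> gen P T y = \<iota> (gen P T t)"
      using \<Gamma>.inv_equality[OF gen_relation[OF t]] c gen_carrier[OF tP] by simp
    then have "gen P T z = gen P T t" using xy c gen_carrier[OF tP] \<Gamma>.inv_inv by metis
    then show ?thesis using gen_inj assms tP t by metis
  next
    case False
    have w: "[(x, True)] \<in> words P" "[(y, True)] \<in> words P" using assms by (auto simp: words_def)
    have "word_class [(x, True), (y, True)] = word_class [(z, False)]"
      using xy word_class_append[OF w] word_class_inv[OF assms(3)] by (simp add: gen_word_class)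
    then show ?thesis
      using normal_word_unique[of "[x, y]" "[]" "[]" "[z]"] assms False by (simp add: normal_word_def)
  qed
qed (rule gen_relation)

text \<open>The plane at a vertex of the Cayley graph is the plane of the presentation.\<close>

lemma edge_link:
  assumes "g \<in> carrier \<Gamma>" "x \<in> P" "y \<in> P"
  shows "edge (g \<cdot> gen P T x) (g \<cdot> \<iota> (gen P T y)) \<longleftrightarrow> inc y x"
proof -
  note c = assms(1) gen_carrier[OF assms(2)] gen_carrier[OF assms(3)]
  have "g \<cdot> \<iota> (gen P T y) = g \<cdot> gen P T x \<cdot> gen P T t \<longleftrightarrow> (x, t, y) \<in> T" if "t \<in> P" for t
  proof -
    note ct = gen_carrier[OF that]
    have "g \<cdot> \<iota> (gen P T y) = g \<cdot> gen P T x \<cdot> gen P T t \<longleftrightarrow>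
        \<iota> (gen P T y) = gen P T x \<cdot> gen P T t"
      using c ct by (simp add: \<Gamma>.m_assoc)
    also have "\<dots> \<longleftrightarrow> gen P T x \<cdot> gen P T t \<cdot> gen P T y = \<e>"
      using c ct \<Gamma>.inv_equality by (metis \<Gamma>.l_inv \<Gamma>.m_closed)
    also have "\<dots> \<longleftrightarrow> (x, t, y) \<in> T" using gen_product_iff assms that by simp
    finally show ?thesis .
  qed
  then have "edge (g \<cdot> gen P T x) (g \<cdot> \<iota> (gen P T y)) \<longleftrightarrow> (\<exists>t\<in>P. (x, t, y) \<in> T)"
    unfolding edge_iff using c by auto
  also have "\<dots> \<longleftrightarrow> inc y x" unfolding inc_def using T_rot T_in by blast
  finally show ?thesis .
qed

lemma link_planes_edge: "link_planes edge"
proof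
  fix v h h' assume a: "edge v h" "edge v h'" "h \<noteq> h'"
  then obtain x y where xy: "x \<in> P" "y \<in> P" "v \<in> carrier \<Gamma>" "h = v \<cdot> gen P T x"
    "h' = v \<cdot> gen P T y" by (auto simp: edge_iff)
  then have "x \<noteq> y" using a by auto
  then obtain u where u: "u \<in> P" "inc u x" "inc u y"
    using common_pred[OF xy(1,2)] T_in unfolding inc_def by blast
  let ?k = "v \<cdot> \<iota> (gen P T u)"
  have "edge ?k v" unfolding edge_iff_inv using xy u by blast
  moreover have "edge h ?k" "edge h' ?k" using edge_link xy u by auto
  ultimately show "\<exists>k. edge k v \<and> edge h k \<and> edge h' k" by blast
next
  fix k v k' assume a: "edge k v" "edge k' v" "k \<noteq> k'"
  then obtain x y where xy: "x \<in> P" "y \<in> P" "v \<in> carrier \<Gamma>" "k = v \<cdot> \<iota> (gen P T x)"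
    "k' = v \<cdot> \<iota> (gen P T y)" by (auto simp: edge_iff_inv)
  then have "x \<noteq> y" using a by auto
  then obtain u where u: "u \<in> P" "inc x u" "inc y u"
    using common_succ[OF xy(1,2)] T_in unfolding inc_def by blast
  let ?h = "v \<cdot> gen P T u"
  have "edge v ?h" unfolding edge_iff using xy u by blast
  moreover have "edge ?h k" "edge ?h k'" using edge_link xy u by auto
  ultimately show "\<exists>h. edge v h \<and> edge h k \<and> edge h k'" by blast
next
  fix v h h' k k'
  assume a: "edge v h" "edge v h'" "edge k v" "edge k' v" "edge h k" "edge h k'" "edge h' k" "edge h' k'"
  obtain x y where xy: "x \<in> P" "y \<in> P" "v \<in> carrier \<Gamma>" "h = v \<cdot> gen P T x"
    "h' = v \<cdot> gen P T y" using a(1,2) by (auto simp: edge_iff)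
  obtain s t where st: "s \<in> P" "t \<in> P" "k = v \<cdot> \<iota> (gen P T s)"
    "k' = v \<cdot> \<iota> (gen P T t)" using a(3,4) by (auto simp: edge_iff_inv)
  have "inc s x" "inc t x" "inc s y" "inc t y" using a(5-8) edge_link xy st by auto
  then have "s = t \<or> x = y" using inc_no_square by blast
  then show "h = h' \<or> k = k'" using xy st by auto
qed

interpretation link: link_planes edge by (rule link_planes_edge)

definition path_letter :: "(nat \<Rightarrow> ('p \<times> bool) list set) \<Rightarrow> nat \<Rightarrow> nat \<Rightarrow> 'p" where
  "path_letter f m t = (SOME x. x \<in> P \<and> (if t < m then f (Suc t) = f t \<cdot> gen P T x
     else f t = f (Suc t) \<cdot> gen P T x))"

lemma path_letter:
  assumes "link.straight_path f m n" "t < m + n"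
  shows "path_letter f m t \<in> P"
    and "f t \<in> carrier \<Gamma>" "f (Suc t) \<in> carrier \<Gamma>"
    and "t < m \<Longrightarrow> f (Suc t) = f t \<cdot> gen P T (path_letter f m t)"
    and "\<not> t < m \<Longrightarrow> f t = f (Suc t) \<cdot> gen P T (path_letter f m t)"
proof -
  have e: "if t < m then edge (f t) (f (Suc t)) else edge (f (Suc t)) (f t)"
    using assms unfolding link.straight_path_def by auto
  then have "\<exists>x. x \<in> P \<and> (if t < m then f (Suc t) = f t \<cdot> gen P T x
     else f t = f (Suc t) \<cdot> gen P T x)" by (auto simp: edge_iff split: if_splits)
  from someI_ex[OF this, folded path_letter_def]
  show "path_letter f m t \<in> P"
    "t < m \<Longrightarrow> f (Suc t) = f t \<cdot> gen P T (path_letter f m t)"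
    "\<not> t < m \<Longrightarrow> f t = f (Suc t) \<cdot> gen P T (path_letter f m t)" by (auto split: if_splits)
  show "f t \<in> carrier \<Gamma>" "f (Suc t) \<in> carrier \<Gamma>" using e edge_carrier by (auto split: if_splits)
qed

lemma solve_right_inverse:
  "h \<in> carrier \<Gamma> \<Longrightarrow> x \<in> P \<Longrightarrow> g = h \<cdot> gen P T x \<Longrightarrow> h = g \<cdot> \<iota> (gen P T x)"
  using gen_carrier by (simp add: \<Gamma>.m_assoc)

text \<open>By \<open>edge_link\<close>, straightness of the path at a vertex is normality of the word at the two letters
that meet there.\<close>

lemma normal_path_word:
  assumes s: "link.straight_path f m n"
  shows "normal (map (path_letter f m) [0..<m]) (map (path_letter f m) [m..<m + n])"
proof -
  let ?x = "path_letter f m"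
  note pl = path_letter[OF s]
  have ys: "normal [] (map ?x [j..<m + n])" if "j \<le> m + n" "m \<le> j" for j
    using that
  proof (induction rule: inc_induct)
    case (step j)
    have "\<not> inc (?x (Suc j)) (?x j)" if j: "Suc j < m + n"
    proof -
      let ?v = "f (Suc j)"
      have "\<not> edge (f j) (f (j + 2))" using s step j unfolding link.straight_path_def by auto
      moreover have "f j = ?v \<cdot> gen P T (?x j)" using pl(5)[of j] step j by simp
      moreover have "f (j + 2) = ?v \<cdot> \<iota> (gen P T (?x (Suc j)))"
        using solve_right_inverse[OF pl(3)[of "Suc j"] pl(1)[of "Suc j"] pl(5)[of "Suc j"]] step j by simp
      ultimately show ?thesis using edge_link[of ?v "?x j" "?x (Suc j)"] pl(1)[of j] pl(1)[of "Suc j"]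
          pl(3)[of j] step j by auto
    qed
    then show ?case using step pl(1)[of j]
      by (cases "Suc j < m + n") (auto simp: upt_conv_Cons)
  qed simp
  have "normal (map ?x [i..<m]) (map ?x [m..<m + n])" if "i \<le> m" for i
    using that
  proof (induction rule: inc_induct)
    case (step i)
    let ?v = "f (Suc i)"
    have prev: "f i = ?v \<cdot> \<iota> (gen P T (?x i))"
      using solve_right_inverse[OF pl(2)[of i] pl(1)[of i] pl(4)[of i]] step by simp
    have "consable (?x i) (map ?x [Suc i..<m], map ?x [m..<m + n])"
    proof (cases "Suc i < m")
      case True
      have "\<not> edge (f (i + 2)) (f i)" using s True unfolding link.straight_path_def by auto
      moreover have "f (i + 2) = ?v \<cdot> gen P T (?x (Suc i))" using pl(4)[of "Suc i"] True by simp
      ultimately have "\<not> inc (?x i) (?x (Suc i))"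
        using edge_link[of ?v "?x (Suc i)" "?x i"] prev pl(1)[of i] pl(1)[of "Suc i"] pl(3)[of i] True by auto
      then show ?thesis using True by (simp add: upt_conv_Cons)
    next
      case False
      then have i: "Suc i = m" using step by simp
      show ?thesis
      proof (cases "n = 0")
        case n: False
        have "f (m - 1) \<noteq> f (m + 1)" using s n step unfolding link.straight_path_def by auto
        moreover have "f (m + 1) = ?v \<cdot> \<iota> (gen P T (?x m))"
          using solve_right_inverse[OF pl(3)[of m] pl(1)[of m] pl(5)[of m]] n i by simp
        ultimately have "?x i \<noteq> ?x m" using prev i by auto
        then show ?thesis using i n by (simp add: upt_conv_Cons)
      qed (use i in simp)
    qed
    then show ?case using step pl(1)[of i] by (simp add: upt_conv_Cons)
  qed (use ys[of m] in simp)
  then show ?thesis by simp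
qed

lemma path_endpoint:
  assumes s: "link.straight_path f m n" and "f 0 \<in> carrier \<Gamma>" "t \<le> m + n"
  shows "f t = f 0 \<cdot> word_class (map (\<lambda>t. (path_letter f m t, t < m)) [0..<t])"
  using assms(3)
proof (induction t)
  case 0
  then show ?case using assms(2) by (simp add: word_class_Nil)
next
  case (Suc t)
  let ?w = "map (\<lambda>t. (path_letter f m t, t < m)) [0..<t]"
  let ?c = "[(path_letter f m t, t < m)]"
  have w: "?w \<in> words P" "?c \<in> words P" using path_letter(1)[OF s] Suc.prems by (auto simp: words_def)
  have "f (Suc t) = f t \<cdot> word_class ?c"
  proof (cases "t < m")
    case True
    then show ?thesis using path_letter(4)[OF s, of t] Suc.prems by (simp add: gen_word_class)
  next
    case False
    then show ?thesis
      using solve_right_inverse[OF path_letter(3,1,5)[OF s]] word_class_inv path_letter(1)[OF s] Suc.prems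
      by simp
  qed
  then show ?case
    using Suc word_class_append[OF w] word_class_carrier[OF w(1)] word_class_carrier[OF w(2)] assms(2)
    by (simp add: \<Gamma>.m_assoc)
qed

theorem triangle_graph_edge: "triangle_graph edge"
proof
  fix f m n f' m' n'
  assume s: "link.straight_path f m n" "link.straight_path f' m' n'"
    and e: "f 0 = f' 0" "f (m + n) = f' (m' + n')"
  let ?x = "path_letter f m" and ?x' = "path_letter f' m'"
  let ?w = "\<lambda>f m t. map (\<lambda>t. (path_letter f m t, t < m)) [0..<t]"
  show "m = m' \<and> n = n' \<and> (\<forall>t\<le>m + n. f t = f' t)"
  proof (cases "m + n = 0 \<and> m' + n' = 0")
    case True
    then show ?thesis using e by simp
  next
    case False
    have c: "f 0 \<in> carrier \<Gamma>" "f' 0 \<in> carrier \<Gamma>"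
      using path_letter(2)[OF s(1), of 0] path_letter(2)[OF s(2), of 0] False e(1) by (metis gr0I)+
    have W: "?w f m (m + n) = normal_word (map (path_letter f m) [0..<m]) (map (path_letter f m) [m..<m + n])"
      for f m n
      unfolding normal_word_def by (simp add: upt_add_eq_append[of 0 m n])
    have N: "normal (map ?x [0..<m]) (map ?x [m..<m + n])"
      "normal (map ?x' [0..<m']) (map ?x' [m'..<m' + n'])"
      using normal_path_word s by auto
    have wc: "word_class (?w f m (m + n)) \<in> carrier \<Gamma>" "word_class (?w f' m' (m' + n')) \<in> carrier \<Gamma>"
      unfolding W using normal_word_words[OF N(1)] normal_word_words[OF N(2)] word_class_carrier by auto
    have "f 0 \<cdot> word_class (?w f m (m + n)) = f 0 \<cdot> word_class (?w f' m' (m' + n'))"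
      using path_endpoint[OF s(1) c(1), of "m + n"] path_endpoint[OF s(2) c(2), of "m' + n'"] e by simp
    then have "word_class (?w f m (m + n)) = word_class (?w f' m' (m' + n'))" using c wc by simp
    then have eq: "map ?x [0..<m] = map ?x' [0..<m']" "map ?x [m..<m + n] = map ?x' [m'..<m' + n']"
      unfolding W using normal_word_unique[OF N] by auto
    have m: "m = m'" using arg_cong[OF eq(1), of length] by simp
    have n: "n = n'" using arg_cong[OF eq(2), of length] by simp
    have x: "?x t = ?x' t" if "t < m + n" for t
      using eq m n that by (cases "t < m") auto
    have "f t = f' t" if "t \<le> m + n" for t
    proof -
      have w: "?w f m t = ?w f' m' t" using x that m by auto
      have "f t = f 0 \<cdot> word_class (?w f m t)" by (rule path_endpoint[OF s(1) c(1) that])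
      also have "\<dots> = f' 0 \<cdot> word_class (?w f' m' t)" by (simp only: w e(1))
      also have "\<dots> = f' t" by (rule path_endpoint[OF s(2) c(2), symmetric]) (use that m n in simp)
      finally show ?thesis .
    qed
    then show ?thesis using m n by blast
  qed
qed

end

section \<open>Density and invariance of the periodic limit points\<close>

locale triangle_plane = triangle_structure +
  fixes q :: nat
  assumes finite_points: "finite P"
    and card_line: "x \<in> P \<Longrightarrow> card {y. inc x y} = q + 1"
    and order_bounds: "1 \<le> q" "q + 1 < card P"
begin

lemma finite_line: "finite {y. inc x y}"
  using finite_points T_in by (auto simp: inc_def intro: finite_subset[of _ P])

lemma edge_left_mult:
  assumes "g \<in> carrier \<Gamma>" "u \<in> carrier \<Gamma>" "v \<in> carrier \<Gamma>"
  shows "edge (g \<cdot> u) (g \<cdot> v) \<longleftrightarrow> edge u v"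
proof -
  interpret group \<Gamma> by (rule group_\<Gamma>)
  have "g \<cdot> v = g \<cdot> u \<cdot> gen P T x \<longleftrightarrow> v = u \<cdot> gen P T x" if "x \<in> P" for x
    using assms gen_carrier[OF that] by (simp add: m_assoc)
  then show ?thesis using assms by (auto simp: edge_iff)
qed

end

sublocale triangle_plane \<subseteq> graph: homogeneous_triangle_graph \<Gamma> edge "card P" q
proof -
  interpret \<Gamma>: group \<Gamma> by (rule group_\<Gamma>)
  interpret tg: triangle_graph edge by (rule triangle_graph_edge)
  show "homogeneous_triangle_graph \<Gamma> edge (card P) q"
  proof
    fix u v assume "edge u v"
    then obtain x where x: "u \<in> carrier \<Gamma>" "x \<in> P" "v = u \<cdot> gen P T x" by (auto simp: edge_iff)
    then have v: "v \<in> carrier \<Gamma>" using gen_carrier by simp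
    have inj: "inj_on (\<lambda>y. w \<cdot> gen P T y) P" if "w \<in> carrier \<Gamma>" for w
      using that gen_carrier gen_inj by (auto intro!: inj_onI)
    have "{w. edge u w} = (\<lambda>y. u \<cdot> gen P T y) ` P" using x by (auto simp: edge_iff)
    then show "finite {w. edge u w} \<and> card {w. edge u w} = card P"
      using card_image[OF inj[OF x(1)]] finite_points by simp
    have u: "u = v \<cdot> \<iota> (gen P T x)" using solve_right_inverse[OF x] .
    have sub: "{y. inc x y} \<subseteq> P" using T_in by (auto simp: inc_def)
    have "edge (v \<cdot> gen P T y) u \<longleftrightarrow> inc x y" if "y \<in> P" for y
      unfolding u using edge_link[OF v that x(2)] v u by simp
    then have "{w. edge v w \<and> edge w u} = (\<lambda>y. v \<cdot> gen P T y) ` {y. inc x y}"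
      using v sub unfolding edge_iff[of v] by blast
    then show "finite {w. edge v w \<and> edge w u} \<and> card {w. edge v w \<and> edge w u} = q + 1"
      using card_image[OF inj_on_subset[OF inj[OF v] sub]] finite_line card_line[OF x(2)] by simp
    show "u \<in> carrier \<Gamma> \<and> v \<in> carrier \<Gamma>" using x v by blast
  qed (use order_bounds edge_left_mult in auto)
qed

context triangle_plane
begin

lemma reachable_left_mult:
  assumes "edge\<^sup>*\<^sup>* u v" "u \<in> carrier \<Gamma>" "g \<in> carrier \<Gamma>"
  shows "edge\<^sup>*\<^sup>* (g \<cdot> u) (g \<cdot> v)"
  using assms(1)
proof (induction rule: rtranclp_induct)
  case (step y z)
  then have "edge (g \<cdot> y) (g \<cdot> z)" using edge_left_mult assms(3) edge_carrier by blast
  then show ?case using step by simp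
qed simp

text \<open>Directed paths suffice, because the inverse of a generator is a product of two generators.\<close>

lemma reachable_word: "w \<in> words P \<Longrightarrow> edge\<^sup>*\<^sup>* \<e> (word_class w)"
proof (induction w)
  case Nil
  then show ?case by (simp add: word_class_Nil)
next
  case (Cons c w)
  obtain x b where c: "c = (x, b)" by (cases c)
  have w: "w \<in> words P" "[(x, b)] \<in> words P" "x \<in> P" using Cons.prems c by (auto simp: words_def)
  note cw = word_class_carrier[OF w(1)]
  have "edge\<^sup>*\<^sup>* \<e> (word_class [(x, b)])"
  proof (cases b)
    case True
    then have "edge \<e> (word_class [(x, b)])"
      using w gen_carrier by (auto simp: edge_iff gen_word_class[symmetric])
    then show ?thesis by blast
  next
    case False
    obtain y z where T: "(x, y, z) \<in> T" using T_ex w by blast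
    then have T': "(y, z, x) \<in> T" and P: "y \<in> P" "z \<in> P" using T_rot T_in by blast+
    have "\<iota> (gen P T x) = gen P T y \<cdot> gen P T z"
      using graph.inv_equality[OF gen_relation[OF T']] gen_carrier w P by simp
    then have "word_class [(x, b)] = gen P T y \<cdot> gen P T z"
      using word_class_inv w False by simp
    moreover have "edge \<e> (gen P T y)" "edge (gen P T y) (gen P T y \<cdot> gen P T z)"
      using gen_carrier P by (auto simp: edge_iff)
    ultimately show ?thesis by (metis converse_rtranclp_into_rtranclp r_into_rtranclp)
  qed
  moreover have "edge\<^sup>*\<^sup>* (word_class [(x, b)] \<cdot> \<e>) (word_class [(x, b)] \<cdot> word_class w)"
    using reachable_left_mult[OF Cons.IH[OF w(1)]] word_class_carrier[OF w(2)] by simp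
  ultimately show ?case
    using word_class_append[OF w(2,1)] word_class_carrier[OF w(2)] c by simp
qed

lemma reachable:
  assumes "u \<in> carrier \<Gamma>" "v \<in> carrier \<Gamma>" shows "edge\<^sup>*\<^sup>* u v"
proof -
  have "\<iota> u \<cdot> v \<in> carrier \<Gamma>" using assms by simp
  then obtain w where w: "w \<in> words P" "\<iota> u \<cdot> v = word_class w"
    using carrier_presented_group triangle_group_def by metis
  have "edge\<^sup>*\<^sup>* (u \<cdot> \<e>) (u \<cdot> (\<iota> u \<cdot> v))"
    unfolding w(2) by (rule reachable_left_mult[OF reachable_word[OF w(1)]]) (use assms in auto)
  then show ?thesis using assms by (simp add: graph.m_assoc[symmetric])
qed

lemma building_carrier: "v \<in> \<Union>graph.building \<Longrightarrow> v \<in> carrier \<Gamma>"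
  using edge_carrier by (auto simp: graph.building_def complex_of_def graph.triangle_def)

end

sublocale triangle_plane \<subseteq> graph: connected_triangle_graph edge
  using reachable building_carrier by unfold_locales blast

context triangle_plane
begin

lemma triangle_building_eq: "triangle_building P T = graph.building"
proof -
  have "{{g, g \<cdot> \<iota> (gen P T x), g \<cdot> gen P T y} |g x y. g \<in> carrier \<Gamma> \<and> (\<exists>z. (x, y, z) \<in> T)}
    = {{u, v, w} |u v w. graph.triangle u v w}" (is "?L = ?R")
  proof (intro equalityI subsetI)
    fix C assume "C \<in> ?L"
    then obtain g x y where C: "C = {g, g \<cdot> \<iota> (gen P T x), g \<cdot> gen P T y}"
      "g \<in> carrier \<Gamma>" "inc x y" unfolding inc_def by blast
    then have P: "x \<in> P" "y \<in> P" using T_in by (auto simp: inc_def)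
    have "graph.triangle g (g \<cdot> gen P T y) (g \<cdot> \<iota> (gen P T x))"
      unfolding graph.triangle_def using edge_link[OF C(2) P(2,1)] C P
      by (auto simp: edge_iff[of g] edge_iff_inv[of _ g])
    then show "C \<in> ?R" using C(1) by blast
  next
    fix C assume "C \<in> ?R"
    then obtain u v w where C: "C = {u, v, w}" and e: "edge u v" "edge v w" "edge w u"
      by (auto simp: graph.triangle_def)
    obtain y where y: "y \<in> P" "v = u \<cdot> gen P T y" "u \<in> carrier \<Gamma>" using e(1) by (auto simp: edge_iff)
    obtain x where x: "x \<in> P" "w = u \<cdot> \<iota> (gen P T x)" using e(3) by (auto simp: edge_iff_inv)
    have "inc x y" using edge_link[OF y(3,1) x(1)] e(2) x y by simp
    moreover have "C = {u, u \<cdot> \<iota> (gen P T x), u \<cdot> gen P T y}" using C x y by blast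
    ultimately show "C \<in> ?L" using y(3) unfolding inc_def by blast
  qed
  then show ?thesis unfolding triangle_building_def graph.building_def Let_def by simp
qed

text \<open>Of the two parametrizations of a sector that differ by the exchange of the coordinates, the
prescribed orientation of the bounding rays selects the one that is a flat.\<close>

lemma sector_coords_iff: "sector_coords P T S a \<longleftrightarrow> graph.flat a \<and> S = graph.sector_of a"
proof
  assume a: "sector_coords P T S a"
  then obtain A where A: "apartment graph.building A" "simplicial_iso a coxeter_A2_tilde A"
    unfolding sector_coords_def triangle_building_eq by blast
  have "oriented_edge P T (a (0, 0)) (a (1, 0))" using a by (auto simp: sector_coords_def)
  have or: "graph.flat a \<or> graph.flat (\<lambda>(i, j). a (j, i))"
    using graph.simplicial_iso_flat[OF A(2)] A(1) by (auto simp: apartment_def)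
  have "graph.flat a"
  proof (rule ccontr)
    assume "\<not> graph.flat a"
    then have e: "edge (a (1, 0)) (a (0, 0))" using or graph.flatD(3)[of "\<lambda>(i, j). a (j, i)" 0 0] by simp
    then have "edge (a (0, 0)) (a (1, 0))"
      using \<open>oriented_edge P T (a (0, 0)) (a (1, 0))\<close> edge_carrier[OF e] unfolding edge_def by blast
    then show False using e graph.no_two_cycle by blast
  qed
  then show "graph.flat a \<and> S = graph.sector_of a"
    using a by (auto simp: sector_coords_def graph.sector_of_def)
next
  assume a: "graph.flat a \<and> S = graph.sector_of a"
  then have "oriented_edge P T (a (i, 0)) (a (i + 1, 0))" "oriented_edge P T (a (0, i + 1)) (a (0, i))" for i
    using graph.flatD(1)[of a i 0] graph.flatD(3)[of a 0 i] by (auto simp: edge_def)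
  then show "sector_coords P T S a"
    unfolding sector_coords_def triangle_building_eq
    using a graph.flat_simplicial_iso[of a] by (auto simp: graph.sector_of_def)
qed

abbreviation translate where
  "translate g \<equiv> (`) ((`) (\<lambda>h. g \<cdot> h))"

lemma translate_sector: "translate g (graph.sector_of a) = graph.sector_of (\<lambda>p. g \<cdot> a p)"
  by (simp add: graph.sector_of_def image_image)

lemma boundary_action_cancel:
  assumes "g \<in> carrier \<Gamma>" "\<omega> \<in> Omega P T"
  shows "boundary_action P T g \<omega> \<in> Omega P T"
    and "boundary_action P T g (boundary_action P T (\<iota> g) \<omega>) = \<omega>"
proof -
  have "\<omega> \<in> boundary graph.building" using assms(2) by (simp only: Omega_def triangle_building_eq)
  from graph.boundary_iff[THEN iffD1, OF this]
  obtain a where a: "graph.flat a" "\<omega> = graph.sector_class a"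
    by blast
  have act: "boundary_action P T h (graph.sector_class e) =
      graph.sector_class (\<lambda>p. h \<cdot> e p)" (is "_ = ?R")
    if h: "h \<in> carrier \<Gamma>" and e: "graph.flat e" for h e
  proof (intro equalityI subsetI)
    fix S assume "S \<in> boundary_action P T h (graph.sector_class e)"
    then obtain b where b: "S = graph.sector_of (\<lambda>p. h \<cdot> b p)" "graph.flat b" "asymptotic e b"
      unfolding boundary_action_def using translate_sector by auto
    have "asymptotic (\<lambda>p. h \<cdot> e p) (\<lambda>p. h \<cdot> b p)" using b(3) unfolding asymptotic_def by metis
    then show "S \<in> ?R" using b graph.flat_left_mult[OF b(2) h] by blast
  next
    fix S assume "S \<in> ?R"
    then obtain b where b: "S = graph.sector_of b" "graph.flat b" "asymptotic (\<lambda>p. h \<cdot> e p) b" by blast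
    let ?b = "\<lambda>p. \<iota> h \<cdot> b p"
    have fb: "graph.flat ?b" using graph.flat_left_mult[OF b(2)] h by simp
    have "h \<cdot> ?b p = b p" for p
      using h graph.flat_carrier[OF b(2), of p] by (simp add: graph.m_assoc[symmetric])
    then have S: "S = translate h (graph.sector_of ?b)" unfolding translate_sector b(1) by simp
    have c: "\<iota> h \<cdot> (h \<cdot> e p) = e p" for p
      using h graph.flat_carrier[OF e, of p] by (simp add: graph.m_assoc[symmetric])
    have "asymptotic (\<lambda>p. \<iota> h \<cdot> (h \<cdot> e p)) ?b"
      using b(3) unfolding asymptotic_def by metis
    then have "asymptotic e ?b" unfolding c .
    then show "S \<in> boundary_action P T h (graph.sector_class e)"
      unfolding boundary_action_def S using fb by blast
  qed
  have ga: "boundary_action P T h \<omega> = graph.sector_class (\<lambda>p. h \<cdot> a p)"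
    if "h \<in> carrier \<Gamma>" for h
    unfolding a(2) by (rule act[OF that a(1)])
  show "boundary_action P T g \<omega> \<in> Omega P T"
    unfolding Omega_def triangle_building_eq graph.boundary_iff
    using ga[OF assms(1)] graph.flat_left_mult[OF a(1) assms(1)] by blast
  have ig: "\<iota> g \<in> carrier \<Gamma>" using assms(1) by simp
  have "g \<cdot> (\<iota> g \<cdot> a p) = a p" for p
    using assms(1) graph.flat_carrier[OF a(1), of p] by (simp add: graph.m_assoc[symmetric])
  then show "boundary_action P T g (boundary_action P T (\<iota> g) \<omega>) = \<omega>"
    unfolding ga[OF ig] act[OF assms(1) graph.flat_left_mult[OF a(1) ig]] by (simp add: a(2))
qed

lemma displacement_translate:
  assumes "g \<in> carrier \<Gamma>" "u \<in> carrier \<Gamma>" "v \<in> carrier \<Gamma>"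
  shows "\<iota> (g \<cdot> u) \<cdot> (g \<cdot> v) = \<iota> u \<cdot> v"
proof -
  have "\<iota> g \<cdot> (g \<cdot> v) = v" using assms by (simp add: graph.m_assoc[symmetric])
  then show ?thesis using assms by (simp add: graph.inv_mult_group graph.m_assoc)
qed

lemma rs_periodic_translate:
  assumes "rs_periodic P T S r s" "g \<in> carrier \<Gamma>"
  shows "rs_periodic P T (translate g S) r s"
proof -
  obtain a where a: "graph.flat a" "S = graph.sector_of a"
    and per: "\<forall>i\<ge>0. \<forall>j\<ge>0. \<forall>k\<ge>0. \<forall>l\<ge>0. i + r \<ge> 0 \<longrightarrow> j + s \<ge> 0 \<longrightarrow> k + r \<ge> 0 \<longrightarrow> l + s \<ge> 0 \<longrightarrow>
          \<iota> (a (i, j)) \<cdot> a (k, l) = \<iota> (a (i + r, j + s)) \<cdot> a (k + r, l + s)"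
    using assms(1) unfolding rs_periodic_def Let_def sector_coords_iff by blast
  have "\<iota> (g \<cdot> a p) \<cdot> (g \<cdot> a p') = \<iota> (a p) \<cdot> a p'" for p p'
    using displacement_translate[OF assms(2)] graph.flat_carrier[OF a(1)] by blast
  then show ?thesis
    unfolding rs_periodic_def Let_def sector_coords_iff a(2) translate_sector
    using per graph.flat_left_mult[OF a(1) assms(2)] by (intro exI[of _ "\<lambda>p. g \<cdot> a p"]) simp
qed

lemma group_invariant_if_translate:
  assumes "\<And>S g. Q S \<Longrightarrow> g \<in> carrier \<Gamma> \<Longrightarrow> Q (translate g S)"
  shows "group_invariant P T {\<omega> \<in> Omega P T. \<exists>S\<in>\<omega>. Q S}"
  unfolding group_invariant_def
proof
  fix g assume g: "g \<in> carrier \<Gamma>"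
  have sub: "boundary_action P T h \<omega> \<in> {\<omega> \<in> Omega P T. \<exists>S\<in>\<omega>. Q S}"
    if h: "h \<in> carrier \<Gamma>" "\<omega> \<in> {\<omega> \<in> Omega P T. \<exists>S\<in>\<omega>. Q S}" for h \<omega>
  proof -
    obtain S where "S \<in> \<omega>" "Q S" using h by blast
    then have "translate h S \<in> boundary_action P T h \<omega>" "Q (translate h S)"
      using assms h(1) by (auto simp: boundary_action_def)
    then show ?thesis using boundary_action_cancel(1)[OF h(1)] h(2) by blast
  qed
  show "boundary_action P T g ` {\<omega> \<in> Omega P T. \<exists>S\<in>\<omega>. Q S} = {\<omega> \<in> Omega P T. \<exists>S\<in>\<omega>. Q S}"
  proof (intro equalityI subsetI)
    fix \<omega> assume \<omega>: "\<omega> \<in> {\<omega> \<in> Omega P T. \<exists>S\<in>\<omega>. Q S}"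
    have "\<omega> = boundary_action P T g (boundary_action P T (\<iota> g) \<omega>)"
      by (rule boundary_action_cancel(2)[OF g, symmetric]) (use \<omega> in blast)
    then show "\<omega> \<in> boundary_action P T g ` {\<omega> \<in> Omega P T. \<exists>S\<in>\<omega>. Q S}"
      by (rule image_eqI) (rule sub[OF graph.inv_closed[OF g] \<omega>])
  qed (use sub[OF g] in blast)
qed

lemma rigidly_periodic_imp_periodic:
  assumes "rigidly_periodic_sector P T S"
  shows "periodic_sector P T S"
proof -
  obtain r s where "(r, s) \<noteq> (0, 0)" "rs_periodic P T S r s"
  proof (cases "doubly_periodic_sector P T S")
    case True
    then obtain r s t u where rs: "r * u - s * t \<noteq> 0" "rs_periodic P T S r s"
      unfolding doubly_periodic_sector_def by blast
    from rs(1) have "(r, s) \<noteq> (0, 0)" by auto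
    then show thesis using rs(2) that by blast
  next
    case False
    then show thesis using assms that unfolding rigidly_periodic_sector_def by blast
  qed
  then show ?thesis unfolding periodic_sector_def by blast
qed

lemma rigidly_periodic_in_cylinder:
  assumes a: "graph.flat a" "a (0, 0) = \<e>" "0 \<le> N"
  shows "rigidly_periodic_points P T \<inter> graph.cylinder a N \<noteq> {}"
proof -
  \<comment> \<open>One step more than needed, since a closed walk must not be empty.\<close>
  define n where "n = nat (N + 1)"
  have n: "0 < n" "N \<le> int n" using a(3) by (auto simp: n_def)
  obtain b g M where b: "graph.flat b" "b (0, 0) = \<e>" "b (int n, int n) = a (int n, int n)"
    "0 < M" "g \<in> carrier \<Gamma>"
    "\<And>i j. 0 \<le> i \<Longrightarrow> 0 \<le> j \<Longrightarrow> b (i + int M, j + int M) = g \<cdot> b (i, j)"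
    using graph.periodic_flat_through[OF a(1,2) n(1)] by blast
  let ?\<omega> = "graph.sector_class b"
  have \<omega>: "?\<omega> \<in> boundary graph.building" unfolding graph.boundary_iff using b(1) by blast
  have S: "graph.sector_of b \<in> ?\<omega>" using b(1) asymptotic_refl by blast
  have "\<iota> (b (i, j)) \<cdot> b (k, l) =
      \<iota> (b (i + int M, j + int M)) \<cdot> b (k + int M, l + int M)"
    if "0 \<le> i" "0 \<le> j" "0 \<le> k" "0 \<le> l" for i j k l
    unfolding b(6)[OF that(1,2)] b(6)[OF that(3,4)]
    by (rule displacement_translate[symmetric]) (rule b(5) graph.flat_carrier[OF b(1)])+
  then have "rs_periodic P T (graph.sector_of b) (int M) (int M)"
    unfolding rs_periodic_def Let_def sector_coords_iff using b(1) by blast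
  then have "rigidly_periodic_sector P T (graph.sector_of b)"
    unfolding rigidly_periodic_sector_def using b(4) by (intro disjI2 exI[of _ "int M"]) auto
  then have "?\<omega> \<in> rigidly_periodic_points P T"
    using \<omega> S unfolding rigidly_periodic_points_def Omega_def triangle_building_eq by blast
  moreover have "?\<omega> \<in> graph.cylinder a (int n)"
    unfolding graph.cylinder_def using \<omega> S b(1-3) a(2) by auto
  then have "?\<omega> \<in> graph.cylinder a N" using graph.cylinder_antimono[OF a(1,3) n(2)] by blast
  ultimately show ?thesis by blast
qed

lemma one_in_building: "\<e> \<in> \<Union>graph.building"
proof -
  have "P \<noteq> {}" using order_bounds by auto
  then obtain x y z where "(x, y, z) \<in> T" using T_ex by blast
  then have "{\<e>} \<in> triangle_building P T"
    unfolding triangle_building_def complex_of_def Let_def by blast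
  then show ?thesis unfolding triangle_building_eq by blast
qed

lemma dense_if_contains_rigidly_periodic:
  assumes "rigidly_periodic_points P T \<subseteq> D" "D \<subseteq> Omega P T"
  shows "dense_in_Omega P T D"
  unfolding dense_in_Omega_def Omega_topology_def triangle_building_eq
proof
  have D: "D \<subseteq> boundary graph.building" using assms(2) by (simp add: Omega_def triangle_building_eq)
  show "boundary_topology graph.building closure_of D = Omega P T"
    unfolding Omega_def triangle_building_eq
    by (rule graph.dense_if_meets_cylinders[OF one_in_building D])
      (use rigidly_periodic_in_cylinder assms(1) in blast)
qed (rule assms(2))

theorem periodic_points_dense_invariant:
  "dense_in_Omega P T (rigidly_periodic_points P T) \<and>
   group_invariant P T (rigidly_periodic_points P T) \<and>
   dense_in_Omega P T (periodic_points P T) \<and>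
   group_invariant P T (periodic_points P T)"
proof (intro conjI)
  show "dense_in_Omega P T (rigidly_periodic_points P T)"
    by (rule dense_if_contains_rigidly_periodic) (auto simp: rigidly_periodic_points_def)
  show "dense_in_Omega P T (periodic_points P T)"
    by (rule dense_if_contains_rigidly_periodic)
      (auto simp: rigidly_periodic_points_def periodic_points_def intro: rigidly_periodic_imp_periodic)
  show "group_invariant P T (rigidly_periodic_points P T)"
    unfolding rigidly_periodic_points_def
    by (rule group_invariant_if_translate)
      (use rs_periodic_translate in \<open>unfold rigidly_periodic_sector_def doubly_periodic_sector_def, blast\<close>)
  show "group_invariant P T (periodic_points P T)"
    unfolding periodic_points_def
    by (rule group_invariant_if_translate) (use rs_periodic_translate in \<open>unfold periodic_sector_def, blast\<close>)
qed

end

lemma triangle_plane_of_presentation: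
  assumes "q \<ge> 2" "finite_projective_plane_of_order q P L I" "bij_betw lam P L"
    "triangle_presentation P I lam T"
  shows "triangle_plane P T q"
proof -
  have fin: "finite P" and plane: "projective_plane P L I"
    and line_card: "\<And>l. l \<in> L \<Longrightarrow> card {x \<in> P. I x l} = q + 1"
    using assms(2) by (auto simp: finite_projective_plane_of_order_def)
  have TP: "(x, y, z) \<in> T \<Longrightarrow> x \<in> P \<and> y \<in> P \<and> z \<in> P" for x y z
    using assms(4) unfolding triangle_presentation_def by blast
  have Tinc: "(\<exists>z. (x, y, z) \<in> T) \<longleftrightarrow> I y (lam x)" if "x \<in> P" "y \<in> P" for x y
    using assms(4) that TP unfolding triangle_presentation_def by blast
  have lamL: "lam x \<in> L" if "x \<in> P" for x using assms(3) that by (auto simp: bij_betw_def)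
  have lam_onto: "\<exists>x\<in>P. lam x = l" if "l \<in> L" for l using assms(3) that by (auto simp: bij_betw_def)
  have lam_inj: "lam x = lam y \<Longrightarrow> x = y" if "x \<in> P" "y \<in> P" for x y
    using assms(3) that by (auto simp: bij_betw_def dest: inj_onD)
  have lines: "\<exists>!l. l \<in> L \<and> I x l \<and> I y l" if "x \<in> P" "y \<in> P" "x \<noteq> y" for x y
    using plane that unfolding projective_plane_def by blast
  have points: "\<exists>!x. x \<in> P \<and> I x l \<and> I x m" if "l \<in> L" "m \<in> L" "l \<noteq> m" for l m
    using plane that unfolding projective_plane_def by blast
  interpret triangle_structure P T
  proof
    show "(x, y, z) \<in> T \<Longrightarrow> (y, z, x) \<in> T" for x y z
      using assms(4) unfolding triangle_presentation_def by blast
    show "(x, y, z) \<in> T \<Longrightarrow> (x, y, z') \<in> T \<Longrightarrow> z = z'" for x y z z'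
      using assms(4) TP unfolding triangle_presentation_def by blast
    show "(x, y, z) \<in> T \<Longrightarrow> x \<in> P \<and> y \<in> P \<and> z \<in> P" for x y z using TP .
    fix x assume x: "x \<in> P"
    have "card {y \<in> P. I y (lam x)} \<noteq> 0" using line_card[OF lamL[OF x]] by simp
    then have "{y \<in> P. I y (lam x)} \<noteq> {}" by (metis card.empty)
    then show "\<exists>y z. (x, y, z) \<in> T" using Tinc[OF x] by blast
  next
    fix x y assume xy: "x \<in> P" "y \<in> P" "x \<noteq> y"
    obtain l where l: "l \<in> L" "I x l" "I y l" using lines[OF xy] by blast
    obtain u where "u \<in> P" "lam u = l" using lam_onto[OF l(1)] by blast
    then show "\<exists>u s t. (u, x, s) \<in> T \<and> (u, y, t) \<in> T" using Tinc[of u x] Tinc[of u y] l xy by blast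
    have "lam x \<noteq> lam y" using lam_inj xy by blast
    then obtain u where "u \<in> P" "I u (lam x)" "I u (lam y)" using points[OF lamL lamL] xy by blast
    then show "\<exists>u s t. (x, u, s) \<in> T \<and> (y, u, t) \<in> T" using Tinc[of x u] Tinc[of y u] xy by blast
  next
    fix u v x y s s' t t'
    assume T: "(u, x, s) \<in> T" "(u, y, s') \<in> T" "(v, x, t) \<in> T" "(v, y, t') \<in> T" and ne: "x \<noteq> y"
    then have P: "u \<in> P" "v \<in> P" "x \<in> P" "y \<in> P" using TP by blast+
    have "I x (lam u)" "I y (lam u)" "I x (lam v)" "I y (lam v)" using T Tinc P by blast+
    then have "lam u = lam v" using lines[OF P(3,4) ne] lamL P by blast
    then show "u = v" using lam_inj P by blast
  qed
  have inc_eq: "{y. inc x y} = {y \<in> P. I y (lam x)}" if "x \<in> P" for x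
    using Tinc[OF that] TP unfolding inc_def by blast
  have "\<exists>Q\<subseteq>P. card Q = 4 \<and> (\<forall>l\<in>L. card {x \<in> Q. I x l} \<le> 2)"
    using plane unfolding projective_plane_def by (elim conjE)
  then obtain Q where Q: "Q \<subseteq> P" "card Q = 4" "\<forall>l\<in>L. card {x \<in> Q. I x l} \<le> 2" by (elim exE conjE)
  show ?thesis
  proof
    show "finite P" by (rule fin)
    show "card {y. inc x y} = q + 1" if "x \<in> P" for x
      using line_card[OF lamL[OF that]] inc_eq[OF that] by simp
    show "1 \<le> q" using assms(1) by simp
    have "Q \<noteq> {}" using Q(2) by auto
    then obtain x where x: "x \<in> P" using Q(1) by blast
    have l: "{y \<in> P. I y (lam x)} \<subseteq> P" by blast
    \<comment> \<open>Of the four points in \<open>Q\<close> at most two are on any given line.\<close>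
    have "{y \<in> P. I y (lam x)} \<noteq> P"
    proof
      assume "{y \<in> P. I y (lam x)} = P"
      then have "{y \<in> Q. I y (lam x)} = Q" using Q(1) by blast
      then show False using Q(2) bspec[OF Q(3) lamL[OF x]] by simp
    qed
    then have "card {y \<in> P. I y (lam x)} < card P" using l fin by (meson psubsetI psubset_card_mono)
    then show "q + 1 < card P" using line_card[OF lamL[OF x]] by simp
  qed
qed

theorem corollary3p5:
  fixes P :: "'p set" and L :: "'l set" and I :: "'p \<Rightarrow> 'l \<Rightarrow> bool"
    and q :: nat and lam :: "'p \<Rightarrow> 'l" and T :: "('p \<times> 'p \<times> 'p) set"
  assumes "q \<ge> 2"
    and "finite_projective_plane_of_order q P L I"
    and "bij_betw lam P L"
    and "triangle_presentation P I lam T"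
  shows "dense_in_Omega P T (rigidly_periodic_points P T) \<and>
         group_invariant P T (rigidly_periodic_points P T) \<and>
         dense_in_Omega P T (periodic_points P T) \<and>
         group_invariant P T (periodic_points P T)"
  using triangle_plane.periodic_points_dense_invariant[OF triangle_plane_of_presentation[OF assms]] .

end
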